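(* Let $D\times D$ be the unit bidisc in $\mathbb{C}^2$, let $a_1,\ldots,a_k\in D$ be distinct, and put $w_i=(a_i,0)$ for $i=1,\ldots,k$. Let the weights $\nu_j\in[0,\infty)$ be ordered and normalized so that $1=\nu_1\ge\nu_2\ge\cdots\ge\nu_k$. For $z=(z_1,z_2)\in D\times D$ let $T_i(z_1)=\log\left|\frac{z_1-a_i}{1-\bar a_iz_1}\right|$ and $$h_j(z)=\max\{T_1(z_1)+\cdots+T_j(z_1),\ \log|z_2|\},\qquad 1\le j\le k,$$ which is the pluricomplex Green function of $D\times D$ with poles $w_1,\ldots,w_j$, each of weight $1$. (i) If at least two of the weights are different, then the pluricomplex Green function of $D\times D$ with poles $w_1,\ldots,w_k$ and weights $\nu=(1,\nu_2,\ldots,\nu_k)$ is $$g_\nu(z)=g_{(1,\nu_2,\ldots,\nu_k)}(z)=\nu_kh_k(z)+\sum_{j=1}^{k-1}(\nu_j-\nu_{j+1})h_j(z).$$ Consequently, $g_\nu$ is not extremal. (ii) If, on the other hand, all the weights are equal (so that $g_\nu(z)=\max\{\sum_{i=1}^kT_i(z_1),\ \log|z_2|\}$), then $g_\nu$ is extremal.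
   Context: $D$ is the open unit disc in $\mathbb{C}$. For a domain $\Omega\subset\mathbb{C}^n$, poles $w_1,\ldots,w_k\in\Omega$ and weights $\nu=(\nu_1,\ldots,\nu_k)\in[0,\infty)^k$, the pluricomplex Green function is $g_\nu(z)=\sup u(z)$, the supremum being over all plurisubharmonic functions $u\le 0$ on $\Omega$ such that for each $j$ there is a constant $C_u$ with $u(\zeta)-\nu_j\log|\zeta-w_j|\le C_u$ as $\zeta\to w_j$. Let $C$ be the convex cone of negative (i.e. $\le 0$) plurisubharmonic functions on $\Omega$. A function $u\in C$ is called extremal if whenever $u=u_1+u_2$ with $u_1,u_2\in C$, there are constants $\lambda_1,\lambda_2\ge 0$ with $u_1=\lambda_1u$ and $u_2=\lambda_2u$.
   Formalization: In (i), "g_ν is not extremal" is asserted only when at least two of the nonzero weights are different; with zero weights allowed it fails, e.g. for ν=(1,0), where g_ν=h_1 is extremal by (ii). *)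

theory Defs
  imports "HOL-Analysis.Analysis"
begin

definition usc_on :: "'a::topological_space set \<Rightarrow> ('a \<Rightarrow> ereal) \<Rightarrow> bool" where
  "usc_on S u \<longleftrightarrow> (\<forall>x\<in>S. \<forall>c. u x < c \<longrightarrow> (\<forall>\<^sub>F y in at x within S. u y < c))"

(* The integrals of the positive and of the negative part are subtracted (e2ennreal sends
   negative numbers to 0).  The expression \<infinity> - \<infinity> never arises below: an upper semicontinuous
   function with values in [-\<infinity>, \<infinity>) is bounded above on a circle. *)
definition ereal_integral :: "'a measure \<Rightarrow> ('a \<Rightarrow> ereal) \<Rightarrow> ereal" where
  "ereal_integral M f =
     enn2ereal (\<integral>\<^sup>+ x. e2ennreal (f x) \<partial>M) - enn2ereal (\<integral>\<^sup>+ x. e2ennreal (- f x) \<partial>M)"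

definition circle_mean :: "(complex \<Rightarrow> ereal) \<Rightarrow> complex \<Rightarrow> real \<Rightarrow> ereal" where
  "circle_mean u c r =
     ereal_integral (uniform_measure lborel {0..2 * pi}) (\<lambda>t. u (c + of_real r * cis t))"

(* For open S.  The constant function -\<infinity> counts as subharmonic, so that the restriction of a
   plurisubharmonic function to a complex line is always subharmonic. *)
definition subharmonic_on :: "complex set \<Rightarrow> (complex \<Rightarrow> ereal) \<Rightarrow> bool" where
  "subharmonic_on S u \<longleftrightarrow>
     usc_on S u \<and> (\<forall>x\<in>S. u x < \<infinity>) \<and>
     (\<forall>c r. 0 < r \<and> cball c r \<subseteq> S \<longrightarrow> u c \<le> circle_mean u c r)"

definition plurisubharmonic_on :: "(complex^'n) set \<Rightarrow> (complex^'n \<Rightarrow> ereal) \<Rightarrow> bool" where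
  "plurisubharmonic_on \<Omega> u \<longleftrightarrow>
     usc_on \<Omega> u \<and> (\<forall>z\<in>\<Omega>. u z < \<infinity>) \<and>
     (\<forall>a b. subharmonic_on {\<zeta>. a + \<zeta> *s b \<in> \<Omega>} (\<lambda>\<zeta>. u (a + \<zeta> *s b)))"

definition neg_psh_cone :: "(complex^'n) set \<Rightarrow> (complex^'n \<Rightarrow> ereal) set" where
  "neg_psh_cone \<Omega> = {u. plurisubharmonic_on \<Omega> u \<and> (\<forall>z\<in>\<Omega>. u z \<le> 0)}"

(* Values outside \<Omega> are irrelevant; in ereal, 0 * -\<infinity> = 0, so 0 * u is the zero function. *)
definition extremal_psh :: "(complex^'n) set \<Rightarrow> (complex^'n \<Rightarrow> ereal) \<Rightarrow> bool" where
  "extremal_psh \<Omega> u \<longleftrightarrow>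
     u \<in> neg_psh_cone \<Omega> \<and>
     (\<forall>u1 \<in> neg_psh_cone \<Omega>. \<forall>u2 \<in> neg_psh_cone \<Omega>.
        (\<forall>z\<in>\<Omega>. u z = u1 z + u2 z) \<longrightarrow>
        (\<exists>c1 c2 :: real. 0 \<le> c1 \<and> 0 \<le> c2 \<and>
           (\<forall>z\<in>\<Omega>. u1 z = ereal c1 * u z) \<and> (\<forall>z\<in>\<Omega>. u2 z = ereal c2 * u z)))"

definition green_function ::
    "(complex^'n) set \<Rightarrow> nat \<Rightarrow> (nat \<Rightarrow> complex^'n) \<Rightarrow> (nat \<Rightarrow> real) \<Rightarrow> complex^'n \<Rightarrow> ereal" where
  "green_function \<Omega> k w \<nu> z =
     (SUP u \<in> {u \<in> neg_psh_cone \<Omega>. \<forall>j\<in>{1..k}. \<exists>C::real.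
        \<forall>\<^sub>F \<zeta> in at (w j). u \<zeta> - ereal (\<nu> j * ln (norm (\<zeta> - w j))) \<le> ereal C}. u z)"

definition bidisc :: "(complex^2) set" where
  "bidisc = {z. norm (z $ 1) < 1 \<and> norm (z $ 2) < 1}"

(* logarithm with log 0 = -\<infinity> (the library has ln 0 = 0) *)
definition elog :: "real \<Rightarrow> ereal" where
  "elog x = (if x = 0 then -\<infinity> else ereal (ln x))"

definition T :: "complex \<Rightarrow> complex \<Rightarrow> ereal" where
  "T b \<zeta> = elog (norm ((\<zeta> - b) / (1 - cnj b * \<zeta>)))"

definition h :: "(nat \<Rightarrow> complex) \<Rightarrow> nat \<Rightarrow> complex^2 \<Rightarrow> ereal" where
  "h a j z = max (\<Sum>i=1..j. T (a i) (z $ 1)) (elog (norm (z $ 2)))"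

end

theory Submission
  imports Defs "HOL-Complex_Analysis.Riemann_Mapping"
begin

text \<open>
  Write \<open>F j\<close> for the Blaschke product with zeros \<open>a 1, \<dots>, a j\<close>, so that \<open>h a j z\<close> is the maximum of
  \<open>elog (norm (F j (z $ 1)))\<close> and \<open>elog (norm (z $ 2))\<close>, and \<open>weighted_h\<close> for the combination of these functions in the
  theorem.

  The function \<open>weighted_h\<close> is itself admissible in the definition of the Green function.  Conversely, every admissible \<open>u\<close> is
  below it.  Along the discs \<open>\<zeta> \<mapsto> (\<zeta>, c * F j \<zeta>)\<close> through the first \<open>j\<close> poles, \<open>u\<close> is dominated by the one variable
  Green function with the same poles (\<open>disc_bound\<close>).  For fixed \<open>z $ 2\<close> these bounds control \<open>u\<close> on the boundary of the
  regions between consecutive level sets \<open>norm (F j (z $ 1)) = norm (z $ 2)\<close>, inside of which \<open>weighted_h\<close> is harmonic in \<open>z $ 1\<close>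
  (\<open>upper_bound_weighted_h\<close>).  If two positive weights differ, the sum has a summand that is finite at one of its poles, and so
  \<open>weighted_h\<close> is not extremal.

  For equal weights let \<open>h a k = u1 + u2\<close>.  On punctured discs through a pole that are transversal to the zero axis of \<open>z $ 2\<close>, the sum
  is \<open>ln (norm \<zeta>)\<close>, and two negative subharmonic functions with this sum are \<open>B * ln (norm \<zeta>)\<close> and \<open>(1 - B) * ln (norm \<zeta>)\<close>
  (\<open>log_split\<close>).  The constant \<open>B\<close> depends neither on the disc nor on the pole.  So \<open>u1\<close> and \<open>u2\<close> are competitors for the Green
  functions with all weights \<open>B\<close> and \<open>1 - B\<close>.  These Green functions add up to \<open>h a k\<close>, which forces \<open>u1 = B * h a k\<close>
  (\<open>extremal_h\<close>).

  The analytic tool throughout is a maximum principle for plurisubharmonic functions along holomorphic curves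
  (\<open>psh_curve_max_principle\<close>).  Mean value inequalities and Harnack's inequality are derived from maximum principles by
  approximating continuous functions on circles by real parts of entire functions (\<open>approx_circle_Re_entire\<close>).
\<close>

section \<open>Means over circles\<close>

abbreviation circle_measure :: "real measure" where
  "circle_measure \<equiv> uniform_measure lborel {0..2 * pi}"

lemma emeasure_0_2pi: "emeasure lborel {0..2 * pi} = ennreal (2 * pi)"
  by (simp add: emeasure_lborel_Icc)

lemma emeasure_circle_measure: "emeasure circle_measure UNIV = 1"
proof -
  have "emeasure circle_measure UNIV = emeasure lborel ({0..2 * pi} \<inter> UNIV) / emeasure lborel {0..2 * pi}"
    by (rule emeasure_uniform_measure) auto
  also have "\<dots> = 1"
    by (simp add: divide_ennreal)
  finally show ?thesis .
qed

lemma finite_circle_measure: "finite_measure circle_measure"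
  by (rule finite_measureI) (simp add: emeasure_circle_measure[simplified])

lemma integrable_circle_measure:
  fixes g :: "real \<Rightarrow> real"
  assumes "continuous_on UNIV g"
  shows "integrable circle_measure g"
proof -
  have "bounded (g ` {0..2*pi})"
    by (intro compact_imp_bounded compact_continuous_image continuous_on_subset[OF assms]) auto
  then obtain B where B: "\<forall>x\<in>{0..2*pi}. \<bar>g x\<bar> \<le> B"
    by (auto simp: bounded_iff)
  have "AE x in circle_measure. norm (g x) \<le> B"
    by (rule AE_uniform_measureI) (simp, rule AE_I2, simp add: B)
  moreover have "g \<in> borel_measurable circle_measure"
    using borel_measurable_continuous_onI[OF assms] by simp
  ultimately show ?thesis
    by (rule finite_measure.integrable_const_bound[OF finite_circle_measure])
qed

lemma integral_circle_measure:
  fixes g :: "real \<Rightarrow> real"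
  assumes g: "continuous_on UNIV g" and I: "(g has_integral I) {0..2*pi}"
  shows "integral\<^sup>L circle_measure g = I / (2 * pi)"
proof -
  have m: "g \<in> borel_measurable borel" using g by (rule borel_measurable_continuous_onI)
  have "circle_measure = density lborel (\<lambda>x. ennreal (indicator {0..2*pi} x / (2*pi)))"
    unfolding uniform_measure_def
    by (intro density_cong) (auto simp: emeasure_0_2pi divide_ennreal[symmetric] split: split_indicator)
  then have "integral\<^sup>L circle_measure g = (\<integral>x. (indicator {0..2*pi} x / (2*pi)) *\<^sub>R g x \<partial>lborel)"
    by (simp, subst integral_density) (use m in auto)
  also have "\<dots> = (\<integral>x. (1/(2*pi)) * (indicator {0..2*pi} x *\<^sub>R g x) \<partial>lborel)"
    by (intro Bochner_Integration.integral_cong) auto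
  also have "\<dots> = (1/(2*pi)) * (LINT x:{0..2*pi}|lborel. g x)"
    by (simp only: integral_mult_right_zero set_lebesgue_integral_def)
  also have "(LINT x:{0..2*pi}|lborel. g x) = integral {0..2*pi} g"
  proof (rule set_borel_integral_eq_integral)
    show "set_integrable lborel {0..2*pi} g"
      by (rule borel_integrable_compact[folded set_integrable_def]) (auto intro: continuous_on_subset[OF g])
  qed
  finally show ?thesis using I by (simp add: integral_unique)
qed

lemma circle_mean_real:
  fixes g :: "complex \<Rightarrow> real"
  assumes g: "continuous_on (sphere c r) g" and r: "0 < r"
  shows "circle_mean (\<lambda>z. ereal (g z)) c r = ereal (\<integral>t. g (c + of_real r * cis t) \<partial>circle_measure)"
proof -
  define G where "G t = g (c + of_real r * cis t)" for t
  have G: "continuous_on UNIV G"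
    unfolding G_def
    by (rule continuous_on_compose2[OF g]) (use r in \<open>auto simp: dist_norm norm_mult intro!: continuous_intros\<close>)
  have "integrable circle_measure G" using G by (rule integrable_circle_measure)
  then have fin: "(\<integral>\<^sup>+ t. ennreal (G t) \<partial>circle_measure) \<noteq> \<infinity>" "(\<integral>\<^sup>+ t. ennreal (- G t) \<partial>circle_measure) \<noteq> \<infinity>"
    and eq: "integral\<^sup>L circle_measure G =
      enn2real (\<integral>\<^sup>+ t. ennreal (G t) \<partial>circle_measure) - enn2real (\<integral>\<^sup>+ t. ennreal (- G t) \<partial>circle_measure)"
    by (auto simp: real_integrable_def real_lebesgue_integral_def)
  have *: "enn2ereal x = ereal (enn2real x)" if "x \<noteq> \<infinity>" for x
    using that by (cases x) auto
  show ?thesis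
    unfolding circle_mean_def ereal_integral_def G_def[symmetric]
    by (simp add: *[OF fin(1)] *[OF fin(2)] eq)
qed

lemma circle_mean_mono:
  assumes "\<And>z. z \<in> sphere c r \<Longrightarrow> u z \<le> v z" "0 < r"
  shows "circle_mean u c r \<le> circle_mean v c r"
  unfolding circle_mean_def ereal_integral_def
proof (intro ereal_minus_mono)
  have *: "u (c + of_real r * cis t) \<le> v (c + of_real r * cis t)" for t
    by (rule assms) (use assms(2) in \<open>auto simp: dist_norm norm_mult\<close>)
  show "enn2ereal (\<integral>\<^sup>+ t. e2ennreal (u (c + of_real r * cis t)) \<partial>circle_measure)
     \<le> enn2ereal (\<integral>\<^sup>+ t. e2ennreal (v (c + of_real r * cis t)) \<partial>circle_measure)"
    by (intro less_eq_ennreal.rep_eq[THEN iffD1] nn_integral_mono e2ennreal_mono *)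
  show "enn2ereal (\<integral>\<^sup>+ t. e2ennreal (- v (c + of_real r * cis t)) \<partial>circle_measure)
     \<le> enn2ereal (\<integral>\<^sup>+ t. e2ennreal (- u (c + of_real r * cis t)) \<partial>circle_measure)"
    by (intro less_eq_ennreal.rep_eq[THEN iffD1] nn_integral_mono e2ennreal_mono) (simp add: *)
qed

text \<open>For nonpositive functions one integral suffices, which makes monotone convergence and
  additivity of the integral applicable without integrability.\<close>
lemma circle_mean_nonpos:
  assumes "\<And>z. z \<in> sphere c r \<Longrightarrow> u z \<le> 0" "0 < r"
  shows "circle_mean u c r = - enn2ereal (\<integral>\<^sup>+ t. e2ennreal (- u (c + of_real r * cis t)) \<partial>circle_measure)"
proof -
  have "e2ennreal (u (c + of_real r * cis t)) = 0" for t
    by (rule e2ennreal_neg, rule assms) (use assms(2) in \<open>auto simp: dist_norm norm_mult\<close>)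
  then show ?thesis
    by (simp add: circle_mean_def ereal_integral_def minus_ereal_def zero_ennreal.rep_eq)
qed

lemma submean_nonpos_iff:
  assumes "\<And>z. z \<in> sphere c r \<Longrightarrow> u z \<le> 0" "0 < r" "u c \<le> 0"
  shows "u c \<le> circle_mean u c r \<longleftrightarrow>
     (\<integral>\<^sup>+ t. e2ennreal (- u (c + of_real r * cis t)) \<partial>circle_measure) \<le> e2ennreal (- u c)"
    (is "_ \<longleftrightarrow> ?I \<le> _")
proof -
  have "u c \<le> - enn2ereal ?I \<longleftrightarrow> enn2ereal ?I \<le> - u c"
    by (metis ereal_minus_le_minus ereal_uminus_uminus)
  also have "\<dots> \<longleftrightarrow> enn2ereal ?I \<le> enn2ereal (e2ennreal (- u c))"
    using assms(3) by (simp add: enn2ereal_e2ennreal)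
  also have "\<dots> \<longleftrightarrow> ?I \<le> e2ennreal (- u c)"
    by (rule less_eq_ennreal.rep_eq[symmetric])
  finally show ?thesis
    by (simp only: circle_mean_nonpos[OF assms(1,2)])
qed

lemma mean_Re_holomorphic:
  assumes r: "0 < r" and cont: "continuous_on (cball c r) f" and hol: "f holomorphic_on ball c r"
  shows "(\<integral>t. Re (f (c + of_real r * cis t)) \<partial>circle_measure) = Re (f c)"
proof -
  have "((\<lambda>u. f u / (u - c)) has_contour_integral (2 * of_real pi * \<i> * f c)) (circlepath c r)"
    by (rule Cauchy_integral_circlepath) (use assms in auto)
  then have "((\<lambda>t. f (c + r * cis t) / (c + r * cis t - c) * r * \<i> * cis t) has_integral (2 * of_real pi * \<i> * f c)) {0..2*pi}"
    by (simp add: circlepath_def has_contour_integral_part_circlepath_iff)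
  then have "((\<lambda>t. \<i> * f (c + r * cis t)) has_integral (2 * of_real pi * \<i> * f c)) {0..2*pi}"
    by (rule has_integral_eq[rotated]) (use r in auto)
  then have "((\<lambda>t. Im (\<i> * f (c + r * cis t))) has_integral Im (2 * of_real pi * \<i> * f c)) {0..2*pi}"
    by (rule has_integral_linear[OF _ bounded_linear_Im, unfolded o_def])
  then have I: "((\<lambda>t. Re (f (c + r * cis t))) has_integral (2 * pi * Re (f c))) {0..2*pi}"
    by simp
  have "continuous_on UNIV (\<lambda>t. f (c + r * cis t))"
    by (rule continuous_on_compose2[OF cont]) (use r in \<open>auto simp: dist_norm norm_mult intro!: continuous_intros\<close>)
  then have "continuous_on UNIV (\<lambda>t. Re (f (c + r * cis t)))"
    by (intro continuous_intros)
  from integral_circle_measure[OF this I] show ?thesis by simp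
qed

section \<open>Approximation on circles by real parts of entire functions\<close>

text \<open>Real trigonometric polynomials, each written as the real part of a polynomial on the whole plane.
  On the unit circle, where conjugation is inversion, such functions are closed under products, which
  is what the Stone--Weierstrass theorem needs.\<close>
inductive trig_poly :: "(complex \<Rightarrow> real) \<Rightarrow> bool" where
  monomial: "trig_poly (\<lambda>z. Re (a * z ^ n))"
| add: "trig_poly f \<Longrightarrow> trig_poly g \<Longrightarrow> trig_poly (\<lambda>z. f z + g z)"

lemma Re_monomial_mult:
  assumes z: "norm z = 1" and le: "m \<le> n"
  shows "Re (a * z ^ n) * Re (b * z ^ m) =
    Re ((a * b / 2) * z ^ (n + m)) + Re ((a * cnj b / 2) * z ^ (n - m))"
proof -
  have cz: "z * cnj z = 1"
    using complex_norm_square[of z] z by simp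
  have "z ^ n * cnj z ^ m = z ^ (n - m) * (z ^ m * cnj z ^ m)"
    using le by (simp add: mult.assoc[symmetric] power_add[symmetric])
  also have "\<dots> = z ^ (n - m)"
    by (simp add: power_mult_distrib[symmetric] cz)
  finally have *: "z ^ n * cnj z ^ m = z ^ (n - m)" .
  have prod: "Re x * Re y = Re (x * y / 2) + Re (x * cnj y / 2)" for x y :: complex
    by (simp add: field_simps)
  have "(a * z ^ n) * (b * z ^ m) / 2 = (a * b / 2) * z ^ (n + m)"
    by (simp add: power_add)
  moreover have "(a * z ^ n) * cnj (b * z ^ m) / 2 = (a * cnj b / 2) * z ^ (n - m)"
    by (simp add: *[symmetric])
  ultimately show ?thesis
    unfolding prod[of "a * z ^ n"] by (simp only:)
qed

lemma trig_poly_mult_monomial: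
  assumes "trig_poly g"
  shows "\<exists>h. trig_poly h \<and> (\<forall>z\<in>sphere 0 1. h z = Re (a * z ^ n) * g z)"
  using assms
proof induction
  case (monomial b m)
  have t: "trig_poly (\<lambda>z. Re ((c * d / 2) * z ^ (i + j)) + Re ((c * cnj d / 2) * z ^ (i - j)))" for c d i j
    by (intro trig_poly.intros)
  show ?case
  proof (cases "m \<le> n")
    case True
    then show ?thesis
      by (intro exI[of _ "\<lambda>z. Re ((a * b / 2) * z ^ (n + m)) + Re ((a * cnj b / 2) * z ^ (n - m))"] conjI t ballI)
         (simp only: Re_monomial_mult mem_sphere_0)
  next
    case False
    then have "n \<le> m" by simp
    show ?thesis
    proof (intro exI conjI ballI)
      show "trig_poly (\<lambda>z. Re ((b * a / 2) * z ^ (m + n)) + Re ((b * cnj a / 2) * z ^ (m - n)))"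
        by (rule t)
      show "Re ((b * a / 2) * z ^ (m + n)) + Re ((b * cnj a / 2) * z ^ (m - n)) = Re (a * z ^ n) * Re (b * z ^ m)"
        if "z \<in> sphere 0 1" for z
        using Re_monomial_mult[OF _ \<open>n \<le> m\<close>, of z b a] that by (simp only: mem_sphere_0 mult.commute[of "Re (a * z ^ n)"])
    qed
  qed
next
  case (add f g)
  then obtain h1 h2 where "trig_poly h1" "\<forall>z\<in>sphere 0 1. h1 z = Re (a * z ^ n) * f z"
    "trig_poly h2" "\<forall>z\<in>sphere 0 1. h2 z = Re (a * z ^ n) * g z" by blast
  then show ?case
    by (intro exI[of _ "\<lambda>z. h1 z + h2 z"]) (auto intro: trig_poly.intros simp: distrib_left)
qed

lemma trig_poly_mult:
  assumes "trig_poly f" "trig_poly g"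
  shows "\<exists>h. trig_poly h \<and> (\<forall>z\<in>sphere 0 1. h z = f z * g z)"
  using assms
proof induction
  case (monomial a n)
  then show ?case by (rule trig_poly_mult_monomial)
next
  case (add f1 f2)
  then obtain h1 h2 where "trig_poly h1" "\<forall>z\<in>sphere 0 1. h1 z = f1 z * g z"
    "trig_poly h2" "\<forall>z\<in>sphere 0 1. h2 z = f2 z * g z" by blast
  then show ?case
    by (intro exI[of _ "\<lambda>z. h1 z + h2 z"]) (auto intro: trig_poly.intros simp: distrib_right)
qed

lemma real_polynomial_trig_poly:
  fixes f :: "complex \<Rightarrow> real"
  assumes "real_polynomial_function f"
  shows "\<exists>h. trig_poly h \<and> (\<forall>z\<in>sphere 0 1. h z = f z)"
  using assms
proof induction
  case (linear f)
  have "f z = Re ((of_real (f 1) - \<i> * of_real (f \<i>)) * z ^ 1)" for z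
  proof -
    interpret bounded_linear f by fact
    have "f z = f (Re z *\<^sub>R 1 + Im z *\<^sub>R \<i>)"
      by (rule arg_cong[of _ _ f]) (simp add: complex_eq_iff)
    also have "\<dots> = Re z * f 1 + Im z * f \<i>"
      by (simp only: add scaleR) simp
    finally show ?thesis by (simp add: mult.commute)
  qed
  then have "f = (\<lambda>z. Re ((of_real (f 1) - \<i> * of_real (f \<i>)) * z ^ 1))" by blast
  then have "trig_poly f" using trig_poly.monomial[of "of_real (f 1) - \<i> * of_real (f \<i>)" 1] by (simp only:)
  then show ?case by blast
next
  case (const c)
  then show ?case using trig_poly.monomial[of "of_real c" 0] by (intro exI[of _ "\<lambda>z. c"]) simp
next
  case (add f g)
  then obtain h1 h2 where "trig_poly h1" "\<forall>z\<in>sphere 0 1. h1 z = f z"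
    "trig_poly h2" "\<forall>z\<in>sphere 0 1. h2 z = g z" by blast
  then show ?case
    by (intro exI[of _ "\<lambda>z. h1 z + h2 z"]) (auto intro: trig_poly.intros)
next
  case (mult f g)
  then obtain h1 h2 where h: "trig_poly h1" "\<forall>z\<in>sphere 0 1. h1 z = f z"
    "trig_poly h2" "\<forall>z\<in>sphere 0 1. h2 z = g z" by blast
  obtain h where "trig_poly h" "\<forall>z\<in>sphere 0 1. h z = h1 z * h2 z"
    using trig_poly_mult[OF h(1,3)] by blast
  then show ?case using h(2,4) by (intro exI[of _ h]) simp
qed

lemma trig_poly_Re_entire:
  assumes "trig_poly f"
  shows "\<exists>p. p holomorphic_on UNIV \<and> f = (\<lambda>z. Re (p z))"
  using assms
proof induction
  case (monomial a n)
  then show ?case by (intro exI[of _ "\<lambda>z. a * z ^ n"]) (auto intro!: holomorphic_intros)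
next
  case (add f g)
  then obtain p q where "p holomorphic_on UNIV" "f = (\<lambda>z. Re (p z))"
    "q holomorphic_on UNIV" "g = (\<lambda>z. Re (q z))" by blast
  then show ?case
    by (intro exI[of _ "\<lambda>z. p z + q z"]) (auto intro!: holomorphic_intros)
qed

text \<open>This replaces the solution of the Dirichlet problem.  A maximum principle against real parts of
  entire functions turns the approximation on a circle into one on the disc, without Poisson integrals.\<close>
lemma approx_circle_Re_entire:
  fixes g :: "complex \<Rightarrow> real"
  assumes r: "0 < r" and g: "continuous_on (sphere c r) g" and e: "0 < e"
  obtains p where "p holomorphic_on UNIV" "\<And>z. z \<in> sphere c r \<Longrightarrow> \<bar>g z - Re (p z)\<bar> < e"
proof -
  have "continuous_on (sphere 0 1) (\<lambda>w. g (c + of_real r * w))"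
    by (rule continuous_on_compose2[OF g]) (use r in \<open>auto simp: dist_norm norm_mult intro!: continuous_intros\<close>)
  then obtain f where f: "real_polynomial_function f"
    "\<And>w. w \<in> sphere 0 1 \<Longrightarrow> \<bar>g (c + of_real r * w) - f w\<bar> < e"
    using Stone_Weierstrass_real_polynomial_function[OF compact_sphere _ e] by blast
  obtain h where h: "trig_poly h" "\<forall>w\<in>sphere 0 1. h w = f w"
    using real_polynomial_trig_poly[OF f(1)] by blast
  obtain q where "q holomorphic_on UNIV" "h = (\<lambda>z. Re (q z))"
    using trig_poly_Re_entire[OF h(1)] by blast
  with h(2) have q: "q holomorphic_on UNIV" "\<And>w. w \<in> sphere 0 1 \<Longrightarrow> Re (q w) = f w"
    by auto
  show ?thesis
  proof
    show "(\<lambda>z. q ((z - c) / of_real r)) holomorphic_on UNIV"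
      by (rule holomorphic_on_compose_gen[OF _ q(1), unfolded o_def])
         (use r in \<open>auto intro!: holomorphic_intros\<close>)
    show "\<bar>g z - Re (q ((z - c) / of_real r))\<bar> < e" if "z \<in> sphere c r" for z
    proof -
      have "(z - c) / of_real r \<in> sphere 0 1" using that r
        by (auto simp: norm_divide dist_norm norm_minus_commute)
      from f(2)[OF this] q(2)[OF this] show ?thesis using r by simp
    qed
  qed
qed

section \<open>Harnack's inequality\<close>

text \<open>The Cayley transform \<open>(q - q c) / (q + cnj (q c))\<close> maps the right half plane into the unit disc and
  \<open>q c\<close> to 0, so the Schwarz lemma bounds it by \<open>dist c z / R\<close>.\<close>
lemma Harnack_holomorphic:
  assumes hol: "q holomorphic_on ball c R" and pos: "\<And>z. z \<in> ball c R \<Longrightarrow> 0 < Re (q z)"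
    and z: "z \<in> ball c R"
  shows "Re (q z) \<le> (R + dist c z) / (R - dist c z) * Re (q c)"
proof -
  have R: "0 < R" using z order.strict_trans1[OF zero_le_dist] by auto
  define g where "g x = (q (c + of_real R * x) - q c) / (q (c + of_real R * x) + cnj (q c))" for x
  have in_ball: "c + of_real R * x \<in> ball c R" if "norm x < 1" for x
    using that R by (simp add: dist_norm norm_mult)
  have c_in: "c \<in> ball c R" using R by simp
  have nz: "q (c + of_real R * x) + cnj (q c) \<noteq> 0" if "norm x < 1" for x
    using pos[OF in_ball[OF that]] pos[OF c_in] by (auto simp: complex_eq_iff)
  have qh: "(\<lambda>x. q (c + of_real R * x)) holomorphic_on ball 0 1"
    by (rule holomorphic_on_compose_gen[OF _ hol, unfolded o_def]) (auto intro!: holomorphic_intros in_ball)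
  have gh: "g holomorphic_on ball 0 1"
    unfolding g_def using nz by (intro holomorphic_intros qh) auto
  have g1: "norm (g x) < 1" if "norm x < 1" for x
  proof -
    define X where "X = q (c + of_real R * x)"
    have X: "0 < Re X" "0 < Re (q c)" using pos[OF in_ball[OF that]] pos[OF c_in] by (auto simp: X_def)
    have "0 < Re X * Re (q c)" using X by simp
    then have "(norm (X - q c))\<^sup>2 < (norm (X + cnj (q c)))\<^sup>2"
      by (simp add: cmod_power2) (simp add: power2_eq_square algebra_simps)
    then have "norm (X - q c) < norm (X + cnj (q c))"
      by (rule power_less_imp_less_base) simp
    then show ?thesis
      using nz[OF that] by (simp add: g_def norm_divide X_def)
  qed
  define x where "x = (z - c) / of_real R"
  define t where "t = norm x"
  have xt: "t < 1" "0 \<le> t" "t = dist c z / R"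
    using z R by (auto simp: t_def x_def norm_divide dist_norm norm_minus_commute)
  have zx: "c + of_real R * x = z" using R by (simp add: x_def)
  have "norm (g x) \<le> norm x"
    by (rule Schwarz_Lemma(1)[OF gh _ g1]) (use xt in \<open>auto simp: g_def t_def\<close>)
  then have "norm (q z - q c) \<le> t * norm (q z + cnj (q c))"
    using nz[of x] xt by (simp add: g_def norm_divide zx t_def pos_divide_le_eq)
  then have "(norm (q z - q c))\<^sup>2 \<le> (t * norm (q z + cnj (q c)))\<^sup>2"
    by (intro power_mono) auto
  then have "(Re (q z) - Re (q c))\<^sup>2 + (Im (q z) - Im (q c))\<^sup>2 \<le>
      t\<^sup>2 * (Re (q z) + Re (q c))\<^sup>2 + t\<^sup>2 * (Im (q z) - Im (q c))\<^sup>2"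
    by (simp add: power_mult_distrib cmod_power2 algebra_simps)
  moreover have "t\<^sup>2 * (Im (q z) - Im (q c))\<^sup>2 \<le> 1 * (Im (q z) - Im (q c))\<^sup>2"
    using xt by (intro mult_right_mono) (auto simp: power_le_one)
  ultimately have "(Re (q z) - Re (q c))\<^sup>2 \<le> (t * (Re (q z) + Re (q c)))\<^sup>2"
    by (simp add: power_mult_distrib)
  then have "Re (q z) - Re (q c) \<le> t * (Re (q z) + Re (q c))"
    by (rule power2_le_imp_le) (use xt(2) pos[OF z] pos[OF c_in] in \<open>intro mult_nonneg_nonneg add_nonneg_nonneg; linarith\<close>)
  then have "Re (q z) * (1 - t) \<le> (1 + t) * Re (q c)"
    by (simp add: algebra_simps)
  then have "Re (q z) \<le> (1 + t) / (1 - t) * Re (q c)"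
    using xt by (simp add: pos_le_divide_eq)
  also have "(1 + t) / (1 - t) = (R + dist c z) / (R - dist c z)"
    unfolding xt(3) using R xt(1) by (simp add: divide_simps)
  finally show ?thesis .
qed

text \<open>The hypotheses \<open>upper\<close> and \<open>lower\<close> say that \<open>V\<close> is harmonic, in the form in which
  maximum principles for \<open>V\<close> and \<open>- V\<close> provide it.  They make \<open>V\<close> a uniform limit
  of real parts of entire functions, to which the holomorphic case applies.\<close>
lemma Harnack_max_principle:
  fixes V :: "complex \<Rightarrow> real"
  assumes cont: "continuous_on (sphere c R) V" and nonneg: "\<And>z. z \<in> cball c R \<Longrightarrow> 0 \<le> V z"
    and upper: "\<And>p z. \<lbrakk>p holomorphic_on UNIV; \<And>x. x \<in> sphere c R \<Longrightarrow> V x \<le> Re (p x); z \<in> cball c R\<rbrakk> \<Longrightarrow> V z \<le> Re (p z)"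
    and lower: "\<And>p z. \<lbrakk>p holomorphic_on UNIV; \<And>x. x \<in> sphere c R \<Longrightarrow> Re (p x) \<le> V x; z \<in> cball c R\<rbrakk> \<Longrightarrow> Re (p z) \<le> V z"
    and z: "z \<in> ball c R"
  shows "V z \<le> (R + dist c z) / (R - dist c z) * V c"
proof -
  let ?k = "(R + dist c z) / (R - dist c z)"
  have d: "dist c z < R" and R: "0 < R"
    using z order.strict_trans1[OF zero_le_dist] by auto
  define k where "k = ?k"
  have k: "0 < k" unfolding k_def using d zero_le_dist[of c z] R by (intro divide_pos_pos) linarith+
  have "V z \<le> k * V c + e" if e: "0 < e" for e
  proof -
    define e' where "e' = e / (3 * k)"
    have e': "0 < e'" unfolding e'_def using e k by auto
    obtain p where p: "p holomorphic_on UNIV" "\<And>x. x \<in> sphere c R \<Longrightarrow> \<bar>V x - Re (p x)\<bar> < e'"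
      using approx_circle_Re_entire[OF R cont e'] by blast
    have *: "V x \<le> Re (p x + of_real e')" if "x \<in> cball c R" for x
      by (rule upper[OF _ _ that]) (use p in \<open>force intro!: holomorphic_intros\<close>)+
    have pc: "Re (p c - of_real e') \<le> V c"
      by (rule lower) (use p R in \<open>force intro!: holomorphic_intros\<close>)+
    have "Re (p z + 2 * of_real e') \<le> k * Re (p c + 2 * of_real e')"
    unfolding k_def
    proof (rule Harnack_holomorphic[OF _ _ z])
      show "(\<lambda>a. p a + 2 * complex_of_real e') holomorphic_on ball c R"
        by (intro holomorphic_intros holomorphic_on_subset[OF p(1)]) auto
      show "0 < Re (p a + 2 * complex_of_real e')" if "a \<in> ball c R" for a
        using *[of a] nonneg[of a] that e' by auto
    qed
    also have "\<dots> \<le> k * (V c + 3 * e')"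
      using pc k by (intro mult_left_mono) auto
    also have "\<dots> = k * V c + e" using k by (simp add: e'_def field_simps)
    finally show ?thesis using *[of z] z e' by auto
  qed
  then show ?thesis unfolding k_def[symmetric] by (rule field_le_epsilon)
qed

section \<open>Upper semicontinuous functions\<close>

lemma usc_on_openin:
  "usc_on S u \<longleftrightarrow> (\<forall>c. openin (top_of_set S) {x\<in>S. u x < c})"
proof
  assume u: "usc_on S u"
  show "\<forall>c. openin (top_of_set S) {x\<in>S. u x < c}"
  proof
    fix c
    show "openin (top_of_set S) {x\<in>S. u x < c}"
    proof (subst openin_subopen, intro ballI)
      fix x assume x: "x \<in> {x\<in>S. u x < c}"
      with u have "\<forall>\<^sub>F y in at x within S. u y < c" unfolding usc_on_def by auto
      then obtain T where T: "open T" "x \<in> T" "\<forall>y\<in>T. y \<noteq> x \<longrightarrow> y \<in> S \<longrightarrow> u y < c"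
        unfolding eventually_at_topological by auto
      show "\<exists>T. openin (top_of_set S) T \<and> x \<in> T \<and> T \<subseteq> {x \<in> S. u x < c}"
        by (rule exI[of _ "S \<inter> T"]) (use T x in \<open>auto simp: openin_open\<close>)
    qed
  qed
next
  assume *: "\<forall>c. openin (top_of_set S) {x\<in>S. u x < c}"
  show "usc_on S u"
    unfolding usc_on_def
  proof (intro ballI allI impI)
    fix x c assume x: "x \<in> S" "u x < c"
    from * obtain T where "open T" "{x\<in>S. u x < c} = S \<inter> T" by (auto simp: openin_open)
    with x show "\<forall>\<^sub>F y in at x within S. u y < c"
      unfolding eventually_at_topological by (intro exI[of _ T]) auto
  qed
qed

lemma usc_on_compose:
  assumes u: "usc_on S u" and f: "continuous_on X f" "f ` X \<subseteq> S"
  shows "usc_on X (\<lambda>x. u (f x))"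
  unfolding usc_on_openin
proof
  fix c
  have "openin (top_of_set X) (X \<inter> f -` {y\<in>S. u y < c})"
    using continuous_openin_preimage[OF f(1), of S "{y\<in>S. u y < c}"] f(2) u
    by (auto simp: usc_on_openin)
  moreover have "X \<inter> f -` {y\<in>S. u y < c} = {x\<in>X. u (f x) < c}" using f by auto
  ultimately show "openin (top_of_set X) {x\<in>X. u (f x) < c}" by simp
qed

lemma ereal_add_less_iff:
  fixes x y c :: ereal
  assumes "x < \<infinity>" "y < \<infinity>"
  shows "x + y < c \<longleftrightarrow> (\<exists>a b. x < ereal a \<and> y < ereal b \<and> ereal (a + b) \<le> c)"
proof
  assume "x + y < c"
  then obtain e where e: "x + y < ereal e" "ereal e < c" using ereal_dense2 by blast
  have "\<exists>a b. x < ereal a \<and> y < ereal b \<and> a + b = e"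
  proof (cases x; cases y)
    fix p q assume pq: "x = ereal p" "y = ereal q"
    then show ?thesis using e
      by (intro exI[of _ "p + (e - p - q) / 2"] exI[of _ "q + (e - p - q) / 2"]) auto
  next
    fix q assume pq: "x = -\<infinity>" "y = ereal q"
    then show ?thesis by (intro exI[of _ "e - (q + 1)"] exI[of _ "q + 1"]) auto
  next
    fix p assume pq: "y = -\<infinity>" "x = ereal p"
    then show ?thesis by (intro exI[of _ "p + 1"] exI[of _ "e - (p + 1)"]) auto
  next
    assume pq: "x = -\<infinity>" "y = -\<infinity>"
    then show ?thesis by (intro exI[of _ "e"] exI[of _ "0"]) auto
  qed (use assms in auto)
  then show "\<exists>a b. x < ereal a \<and> y < ereal b \<and> ereal (a + b) \<le> c"
    using e(2) less_imp_le by blast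
next
  assume "\<exists>a b. x < ereal a \<and> y < ereal b \<and> ereal (a + b) \<le> c"
  then obtain a b where "x < ereal a" "y < ereal b" "ereal (a + b) \<le> c" by blast
  then show "x + y < c"
    by (metis ereal_add_strict_mono2 order_less_le_trans plus_ereal.simps(1))
qed

lemma usc_on_add:
  assumes f: "usc_on S f" and g: "usc_on S g"
    and fin: "\<And>x. x \<in> S \<Longrightarrow> f x < \<infinity>" "\<And>x. x \<in> S \<Longrightarrow> g x < \<infinity>"
  shows "usc_on S (\<lambda>x. f x + g x)"
  unfolding usc_on_openin
proof
  fix c
  have "{x\<in>S. f x + g x < c} =
      (\<Union>a. \<Union>b\<in>{b. ereal (a + b) \<le> c}. {x\<in>S. f x < ereal a} \<inter> {x\<in>S. g x < ereal b})"
  proof (intro equalityI subsetI)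
    fix x assume "x \<in> {x\<in>S. f x + g x < c}"
    then show "x \<in> (\<Union>a. \<Union>b\<in>{b. ereal (a + b) \<le> c}. {x\<in>S. f x < ereal a} \<inter> {x\<in>S. g x < ereal b})"
      using ereal_add_less_iff[OF fin, of x x c] by blast
  next
    fix x assume "x \<in> (\<Union>a. \<Union>b\<in>{b. ereal (a + b) \<le> c}. {x\<in>S. f x < ereal a} \<inter> {x\<in>S. g x < ereal b})"
    then show "x \<in> {x\<in>S. f x + g x < c}"
      using ereal_add_less_iff[OF fin, of x x c] by blast
  qed
  moreover have "openin (top_of_set S) \<dots>"
    using f g unfolding usc_on_openin by (intro openin_Union) (auto intro!: openin_Int openin_Union)
  ultimately show "openin (top_of_set S) {x\<in>S. f x + g x < c}" by simp
qed

lemma usc_on_cmult: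
  assumes f: "usc_on S f" and c: "0 \<le> c"
  shows "usc_on S (\<lambda>x. ereal c * f x)"
proof (cases "c = 0")
  case True
  then show ?thesis by (simp add: usc_on_def zero_ereal_def[symmetric])
next
  case False
  have *: "ereal c * y < d \<longleftrightarrow> y < d / ereal c" for y d
    using False c by (subst ereal_less_divide_pos) auto
  show ?thesis using f unfolding usc_on_def * by blast
qed

lemma usc_on_max:
  assumes f: "usc_on S f" and g: "usc_on S g"
  shows "usc_on S (\<lambda>x. max (f x) (g x))"
  using f g unfolding usc_on_def by (auto intro: eventually_conj)

lemma usc_on_continuous:
  fixes f :: "'a::topological_space \<Rightarrow> real"
  assumes "continuous_on S f"
  shows "usc_on S (\<lambda>x. ereal (f x))"
  unfolding usc_on_def
proof (intro ballI allI impI)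
  fix x c assume "x \<in> S" "ereal (f x) < c"
  then show "\<forall>\<^sub>F y in at x within S. ereal (f y) < c"
    using assms by (intro order_tendstoD(2)[of _ "ereal (f x)"]) (auto simp: continuous_on_def)
qed

text \<open>The sets where \<open>f\<close> stays below one of its values are relatively open.  Were the maximum not
  attained, they would cover \<open>K\<close>, and the largest value occurring in a finite subcover would exceed itself.\<close>
lemma usc_attains_max:
  assumes "compact K" "K \<noteq> {}" and f: "usc_on K f"
  shows "\<exists>x\<in>K. \<forall>y\<in>K. f y \<le> f x"
proof (rule ccontr)
  assume "\<not> ?thesis"
  then have *: "\<forall>x\<in>K. \<exists>y\<in>K. f x < f y" by (auto simp: not_le)
  let ?C = "(\<lambda>y. {x\<in>K. f x < f y}) ` K"
  have "\<forall>c\<in>?C. openin (top_of_set K) c" using f by (auto simp: usc_on_openin)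
  moreover have "K \<subseteq> \<Union> ?C" using * by auto
  ultimately obtain D where D: "D \<subseteq> ?C" "finite D" "K \<subseteq> \<Union> D"
    using \<open>compact K\<close>[unfolded compact_eq_openin_cover, rule_format, of ?C] by blast
  obtain Y where Y: "Y \<subseteq> K" "finite Y" "D = (\<lambda>y. {x\<in>K. f x < f y}) ` Y"
    using finite_subset_image[OF D(2,1)] by blast
  have "Y \<noteq> {}" using D(3) \<open>K \<noteq> {}\<close> Y(3) by auto
  then have "Max (f ` Y) \<in> f ` Y" using Y(2) by (intro Max_in) auto
  then obtain y where y: "y \<in> Y" "f y = Max (f ` Y)" by (metis imageE)
  then obtain y' where "y' \<in> Y" "f y < f y'" using D(3) Y by blast
  then show False using y Y(2) by (metis Max_ge finite_imageI imageI leD)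
qed

section \<open>Maximum principle along holomorphic curves\<close>

text \<open>Harmonicity, in the form in which the mean value property is a case of the Cauchy formula.\<close>
definition harmonic_on :: "complex set \<Rightarrow> (complex \<Rightarrow> real) \<Rightarrow> bool" where
  "harmonic_on U H \<longleftrightarrow>
     (\<forall>s\<in>U. \<exists>d>0. \<exists>g. g holomorphic_on ball s d \<and> (\<forall>x\<in>ball s d. H x = Re (g x)))"

lemma harmonic_on_Re:
  assumes "g holomorphic_on U" "open U"
  shows "harmonic_on U (\<lambda>x. Re (g x))"
  unfolding harmonic_on_def
proof
  fix s assume "s \<in> U"
  then obtain d where "d > 0" "ball s d \<subseteq> U" using assms(2) open_contains_ball by blast
  then show "\<exists>d>0. \<exists>h. h holomorphic_on ball s d \<and> (\<forall>x\<in>ball s d. Re (g x) = Re (h x))"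
    using holomorphic_on_subset[OF assms(1)] by blast
qed

lemma harmonic_on_const: "harmonic_on U (\<lambda>_. c)"
  unfolding harmonic_on_def
  by (intro ballI exI[of _ 1] conjI exI[of _ "\<lambda>_. of_real c"]) auto

lemma harmonic_on_add:
  assumes "harmonic_on U F" "harmonic_on U G"
  shows "harmonic_on U (\<lambda>x. F x + G x)"
  unfolding harmonic_on_def
proof
  fix s assume "s \<in> U"
  then obtain d1 d2 f g where *: "d1 > 0" "f holomorphic_on ball s d1" "\<forall>x\<in>ball s d1. F x = Re (f x)"
    "d2 > 0" "g holomorphic_on ball s d2" "\<forall>x\<in>ball s d2. G x = Re (g x)"
    using assms unfolding harmonic_on_def by metis
  have "(\<lambda>x. f x + g x) holomorphic_on ball s (min d1 d2)"
    by (intro holomorphic_intros holomorphic_on_subset[OF *(2)] holomorphic_on_subset[OF *(5)]) auto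
  then show "\<exists>d>0. \<exists>g. g holomorphic_on ball s d \<and> (\<forall>x\<in>ball s d. F x + G x = Re (g x))"
    using * by (intro exI[of _ "min d1 d2"] conjI exI[of _ "\<lambda>x. f x + g x"]) auto
qed

lemma harmonic_on_cmult:
  assumes "harmonic_on U F"
  shows "harmonic_on U (\<lambda>x. c * F x)"
  unfolding harmonic_on_def
proof
  fix s assume "s \<in> U"
  then obtain d f where *: "d > 0" "f holomorphic_on ball s d" "\<forall>x\<in>ball s d. F x = Re (f x)"
    using assms unfolding harmonic_on_def by metis
  have "(\<lambda>x. of_real c * f x) holomorphic_on ball s d" by (intro holomorphic_intros *)
  then show "\<exists>d>0. \<exists>g. g holomorphic_on ball s d \<and> (\<forall>x\<in>ball s d. c * F x = Re (g x))"
    using * by (intro exI[of _ d] conjI exI[of _ "\<lambda>x. of_real c * f x"]) auto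
qed

lemma harmonic_on_sum:
  assumes "\<And>i. i \<in> I \<Longrightarrow> harmonic_on U (F i)"
  shows "harmonic_on U (\<lambda>x. \<Sum>i\<in>I. F i x)"
  using assms
  by (induction I rule: infinite_finite_induct)
     (auto intro: harmonic_on_add harmonic_on_const)

lemma harmonic_on_ln_norm:
  assumes f: "f holomorphic_on U" "open U" and nz: "\<And>x. x \<in> U \<Longrightarrow> f x \<noteq> 0"
  shows "harmonic_on U (\<lambda>x. ln (norm (f x)))"
  unfolding harmonic_on_def
proof
  fix s assume "s \<in> U"
  then obtain d where d: "d > 0" "ball s d \<subseteq> U" using \<open>open U\<close> open_contains_ball by blast
  have "f holomorphic_on ball s d" using f(1) d(2) by (rule holomorphic_on_subset)
  then obtain g where g: "g holomorphic_on ball s d" "\<And>z. z \<in> ball s d \<Longrightarrow> f z = exp (g z)"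
    using contractible_imp_holomorphic_log[of f "ball s d"] nz d(2) convex_imp_contractible convex_ball
    by (metis subsetD)
  have "ln (norm (f x)) = Re (g x)" if "x \<in> ball s d" for x
    using g(2)[OF that] by simp
  with g(1) d(1) show "\<exists>d>0. \<exists>g. g holomorphic_on ball s d \<and> (\<forall>x\<in>ball s d. ln (norm (f x)) = Re (g x))"
    by blast
qed

lemma norm_vec_power2: "(norm (v :: complex^'n))\<^sup>2 = (\<Sum>i\<in>UNIV. (norm (v $ i))\<^sup>2)"
  by (simp add: norm_vec_def L2_set_def sum_nonneg)

lemma norm_diff_power2:
  fixes d e :: complex
  shows "(norm (d - e))\<^sup>2 = (norm d)\<^sup>2 - 2 * Re (cnj d * e) + (norm e)\<^sup>2"
  by (simp add: cmod_power2) (simp add: power2_eq_square algebra_simps)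

text \<open>Plurisubharmonicity only speaks about complex lines; this is the substitute for the theorem that
  \<open>u \<circ> \<phi>\<close> is subharmonic for every holomorphic curve \<open>\<phi>\<close>, and it needs no smoothing of \<open>u\<close>.

  Doubling variables, one maximizes \<open>u z - G s - N * |z - \<phi> s|\<^sup>2\<close> over \<open>s \<in> K\<close> and \<open>z\<close> near \<open>\<phi> s\<close>, where \<open>G\<close>
  is \<open>H\<close> made strictly superharmonic.  If the claim failed, then for large \<open>N\<close> the maximum would lie at a point
  \<open>(s0, z0)\<close> with \<open>s0 \<in> U\<close>.  Moving \<open>s\<close> to \<open>s0 + \<zeta>\<close> and \<open>z\<close> along the line \<open>z0 + \<zeta> *s \<phi>' s0\<close>, the penalty changes by
  a harmonic function of \<open>\<zeta>\<close> plus \<open>o(|\<zeta>|\<^sup>2)\<close>, because \<open>z - \<phi> s\<close> is holomorphic in \<open>\<zeta>\<close> with vanishing derivative at 0.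
  The gain from the strict superharmonicity of \<open>G\<close> is of order \<open>|\<zeta>|\<^sup>2\<close>, so the mean of \<open>u\<close> over a small circle in
  that line would be less than \<open>u z0\<close>.\<close>
proposition psh_curve_max_principle:
  fixes u :: "complex^'n \<Rightarrow> ereal" and \<phi> :: "complex \<Rightarrow> complex^'n"
  assumes psh: "plurisubharmonic_on \<Omega> u" and \<Omega>: "open \<Omega>"
    and K: "compact K" and U: "open U" "U \<subseteq> K"
    and \<phi>: "continuous_on K \<phi>" "\<phi> ` K \<subseteq> \<Omega>" "\<And>i. (\<lambda>s. \<phi> s $ i) holomorphic_on U"
    and H: "continuous_on K H" "harmonic_on U H"
    and bound: "\<And>s. s \<in> K - U \<Longrightarrow> u (\<phi> s) \<le> ereal (H s)"
    and s: "s \<in> K"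
  shows "u (\<phi> s) \<le> ereal (H s)"
proof (rule ccontr)
  assume "\<not> ?thesis"
  then have less: "ereal (H s) < u (\<phi> s)" by (simp add: not_le)
  have sU: "s \<in> U" using bound[of s] s less by (meson DiffI leD)
  have usc: "usc_on \<Omega> u" and fin: "\<And>z. z \<in> \<Omega> \<Longrightarrow> u z < \<infinity>"
    using psh by (auto simp: plurisubharmonic_on_def)
  obtain e where e: "H s < e" "ereal e < u (\<phi> s)"
    using ereal_dense2[OF less] by auto
  obtain R where R: "R > 0" "\<And>x. x \<in> K \<Longrightarrow> norm x \<le> R"
    using compact_imp_bounded[OF K] unfolding bounded_pos by blast
  define \<epsilon> where "\<epsilon> = (e - H s) / R\<^sup>2"
  have \<epsilon>: "0 < \<epsilon>" using e R by (simp add: \<epsilon>_def)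
  define G where "G x = H x + \<epsilon> * (R\<^sup>2 - (norm x)\<^sup>2)" for x
  have GH: "H x \<le> G x" if "x \<in> K" for x
    using R(2)[OF that] \<epsilon> by (simp add: G_def power_mono)
  have "G s \<le> H s + \<epsilon> * R\<^sup>2" using \<epsilon> by (simp add: G_def)
  also have "\<dots> = e" using R by (simp add: \<epsilon>_def)
  finally have "ereal (G s) < u (\<phi> s)" using e(2) by (meson ereal_less_eq(3) order_le_less_trans)
  then obtain m' where m': "G s < m'" "ereal m' < u (\<phi> s)" using ereal_dense2[of "ereal (G s)"] by auto
  define m where "m = m' - G s"
  have m: "0 < m" "ereal m \<le> u (\<phi> s) + ereal (- G s)"
    using m' unfolding m_def by (cases "u (\<phi> s)"; auto)+
  have contG: "continuous_on K G"
    unfolding G_def by (intro continuous_intros H)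
  obtain \<delta> where \<delta>: "\<delta> > 0" "(\<Union>x\<in>\<phi> ` K. cball x \<delta>) \<subseteq> \<Omega>"
    using compact_subset_open_imp_cball_epsilon_subset[OF compact_continuous_image[OF \<phi>(1) K] \<Omega> \<phi>(2)] .
  define K2 where "K2 = {p. fst p \<in> K \<and> dist (\<phi> (fst p)) (snd p) \<le> \<delta>}"
  have K2\<Omega>: "z \<in> \<Omega>" if "(x, z) \<in> K2" for x z
  proof -
    have "z \<in> cball (\<phi> x) \<delta>" "x \<in> K" using that by (auto simp: K2_def)
    then show ?thesis using \<delta>(2) by blast
  qed
  have "K2 = (\<lambda>p. (fst p, \<phi> (fst p) + snd p)) ` (K \<times> cball 0 \<delta>)"
  proof (intro equalityI subsetI)
    fix p assume "p \<in> K2"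
    then show "p \<in> (\<lambda>p. (fst p, \<phi> (fst p) + snd p)) ` (K \<times> cball 0 \<delta>)"
      by (intro image_eqI[of _ _ "(fst p, snd p - \<phi> (fst p))"])
         (auto simp: K2_def dist_norm norm_minus_commute)
  qed (auto simp: K2_def dist_norm)
  moreover have "compact ((\<lambda>p. (fst p, \<phi> (fst p) + snd p)) ` (K \<times> cball 0 \<delta>))"
    by (intro compact_continuous_image compact_Times K compact_cball continuous_intros
        continuous_on_compose2[OF \<phi>(1)]) auto
  ultimately have K2: "compact K2" by simp
  have contG2: "continuous_on K2 (\<lambda>p. - G (fst p))"
    by (intro continuous_intros continuous_on_compose2[OF contG]) (auto simp: K2_def)
  have contd: "continuous_on K2 (\<lambda>p. (dist (\<phi> (fst p)) (snd p))\<^sup>2)"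
    by (intro continuous_intros continuous_on_compose2[OF \<phi>(1)]) (auto simp: K2_def)
  have uscK2: "usc_on K2 (\<lambda>p. u (snd p) + ereal (q p))" if "continuous_on K2 q" for q
    by (intro usc_on_add usc_on_compose[OF usc] usc_on_continuous that continuous_intros)
       (use K2\<Omega> fin in \<open>auto simp: image_subset_iff\<close>)
  define u2 where "u2 p = u (snd p) + ereal (- G (fst p))" for p
  have u2: "usc_on K2 u2" unfolding u2_def by (intro uscK2 contG2)
  have sK2: "(s, \<phi> s) \<in> K2" using s \<delta> by (simp add: K2_def)
  obtain C where C: "\<And>p. p \<in> K2 \<Longrightarrow> u2 p \<le> ereal C" "C \<ge> 0"
  proof -
    obtain p where p: "p \<in> K2" "\<forall>q\<in>K2. u2 q \<le> u2 p"
      using usc_attains_max[OF K2 _ u2] sK2 by blast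
    have "u (snd p) < \<infinity>" using p(1) by (intro fin K2\<Omega>[of "fst p"]) simp
    then have "u2 p < \<infinity>" by (simp add: u2_def)
    then obtain C where "u2 p \<le> ereal C" by (cases "u2 p") auto
    then have "u2 p \<le> ereal (max C 0)" by (meson ereal_less_eq(3) max.cobounded1 order_trans)
    then show ?thesis using p(2) by (intro that[of "max C 0"]) (auto intro: order_trans)
  qed
  define V where "V = {p. fst p \<in> U \<and> dist (\<phi> (fst p)) (snd p) < \<delta>}"
  \<comment> \<open>Where \<open>u2\<close> is large, \<open>W\<close> collects the points that the penalty has to exclude; the boundary estimate keeps them off the curve.\<close>
  define W where "W = {p\<in>K2. \<not> u2 p < ereal m \<and> p \<notin> V}"
  have "openin (top_of_set K2) (K2 \<inter> V)"
  proof -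
    have "openin (top_of_set K2) (K2 \<inter> (\<lambda>p. (fst p, dist (\<phi> (fst p)) (snd p))) -` (U \<times> {..<\<delta>}))"
      by (intro continuous_openin_preimage_gen continuous_intros continuous_on_compose2[OF \<phi>(1)])
         (auto simp: K2_def intro: open_Times U)
    moreover have "(\<lambda>p. (fst p, dist (\<phi> (fst p)) (snd p))) -` (U \<times> {..<\<delta>}) = V"
      by (auto simp: V_def)
    ultimately show ?thesis by simp
  qed
  moreover have "openin (top_of_set K2) {p\<in>K2. u2 p < ereal m}"
    using u2 by (simp add: usc_on_openin)
  ultimately have "closedin (top_of_set K2) (topspace (top_of_set K2) - ((K2 \<inter> V) \<union> {p\<in>K2. u2 p < ereal m}))"
    by (intro closedin_diff openin_Un) auto
  also have "topspace (top_of_set K2) - ((K2 \<inter> V) \<union> {p\<in>K2. u2 p < ereal m}) = W"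
    by (auto simp: W_def)
  finally have W: "compact W" using K2 closedin_compact by blast
  have Wpos: "0 < (dist (\<phi> (fst p)) (snd p))\<^sup>2" if "p \<in> W" for p
  proof (rule ccontr)
    assume "\<not> ?thesis"
    then have eq: "snd p = \<phi> (fst p)" by simp
    then have p: "fst p \<in> K - U" using that \<delta>(1) by (auto simp: W_def V_def K2_def)
    have "u2 p \<le> ereal (H (fst p)) + ereal (- G (fst p))"
      unfolding u2_def eq using bound[OF p] by (rule add_right_mono)
    also have "\<dots> < ereal m" using GH[of "fst p"] p m by simp
    finally show False using that by (simp add: W_def)
  qed
  obtain \<eta> where \<eta>: "\<eta> > 0" "\<And>p. p \<in> W \<Longrightarrow> \<eta> \<le> (dist (\<phi> (fst p)) (snd p))\<^sup>2"
  proof (cases "W = {}")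
    case False
    have "continuous_on W (\<lambda>p. (dist (\<phi> (fst p)) (snd p))\<^sup>2)"
      by (rule continuous_on_subset[OF contd]) (auto simp: W_def)
    from continuous_attains_inf[OF W False this] Wpos show ?thesis
      using that by blast
  qed (use that[of 1] in auto)
  define N where "N = C / \<eta>"
  have N: "N \<ge> 0" using C \<eta> by (simp add: N_def)
  define \<Psi> where "\<Psi> p = u (snd p) + ereal (- G (fst p) - N * (dist (\<phi> (fst p)) (snd p))\<^sup>2)" for p
  have "usc_on K2 \<Psi>"
    unfolding \<Psi>_def by (intro uscK2 continuous_on_diff continuous_on_mult continuous_on_const contG2 contd)
  then obtain s0 z0 where p0: "(s0, z0) \<in> K2" "\<And>q. q \<in> K2 \<Longrightarrow> \<Psi> q \<le> \<Psi> (s0, z0)"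
    using usc_attains_max[OF K2 _ \<open>usc_on K2 \<Psi>\<close>] sK2 by (metis empty_iff surj_pair)
  have mle: "ereal m \<le> \<Psi> (s0, z0)"
    using m(2) p0(2)[OF sK2] by (simp add: \<Psi>_def)
  have z0: "z0 \<in> \<Omega>" using K2\<Omega> p0(1) .
  obtain x0 where x0: "u z0 = ereal x0"
    using mle fin[OF z0] by (cases "u z0") (auto simp: \<Psi>_def)
  have mle': "m \<le> x0 - G s0 - N * (dist (\<phi> s0) z0)\<^sup>2"
    using mle by (simp add: \<Psi>_def x0)
  have u2x0: "u2 (s0, z0) = ereal (x0 - G s0)" by (simp add: u2_def x0)
  have Nd: "0 \<le> N * (dist (\<phi> s0) z0)\<^sup>2" using N by simp
  have V0: "(s0, z0) \<in> V"
  proof (rule ccontr)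
    assume "(s0, z0) \<notin> V"
    then have "(s0, z0) \<in> W" using p0(1) mle' Nd by (simp add: W_def u2x0)
    from \<eta>(2)[OF this] have "N * \<eta> \<le> N * (dist (\<phi> s0) z0)\<^sup>2" using N by (simp add: mult_left_mono)
    moreover have "N * \<eta> = C" using \<eta> by (simp add: N_def)
    moreover have "x0 - G s0 \<le> C" using C(1)[OF p0(1)] by (simp add: u2x0)
    ultimately show False using mle' m(1) by linarith
  qed
  then have s0U: "s0 \<in> U" and d0: "dist (\<phi> s0) z0 < \<delta>" by (auto simp: V_def)
  have s0K: "s0 \<in> K" using s0U U by auto
  define v where "v = (\<chi> i. deriv (\<lambda>x. \<phi> x $ i) s0)"
  define L where "L \<zeta> = z0 + \<zeta> *s v" for \<zeta>
  define er where "er i \<zeta> = \<phi> (s0 + \<zeta>) $ i - \<phi> s0 $ i - \<zeta> * v $ i" for i \<zeta>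
  define d where "d i = z0 $ i - \<phi> s0 $ i" for i
  have Ld: "L \<zeta> $ i - \<phi> (s0 + \<zeta>) $ i = d i - er i \<zeta>" for i \<zeta>
    by (simp add: L_def d_def er_def)
  define n where "n = real CARD('n)"
  \<comment> \<open>The second order error is at most \<open>N * n * \<eta>'\<^sup>2 * r\<^sup>2\<close>, which has to stay below \<open>\<epsilon> * r\<^sup>2\<close>.\<close>
  define \<eta>' where "\<eta>' = sqrt (\<epsilon> / (N * n + 1))"
  have Nn: "N * n \<ge> 0" using N by (simp add: n_def)
  have \<eta>': "\<eta>' > 0" "\<eta>'\<^sup>2 = \<epsilon> / (N * n + 1)" using \<epsilon> Nn by (auto simp: \<eta>'_def)
  have small: "N * n * \<eta>'\<^sup>2 < \<epsilon>"
    unfolding \<eta>'(2) using \<epsilon> Nn by (simp add: pos_divide_less_eq algebra_simps)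
  have id0: "((\<lambda>x::complex. x) \<longlongrightarrow> 0) (nhds 0)"
    by (rule filterlim_ident)
  have U0: "\<forall>\<^sub>F \<zeta> in nhds 0. s0 + \<zeta> \<in> U"
  proof -
    have "((\<lambda>\<zeta>. s0 + \<zeta>) \<longlongrightarrow> s0 + 0) (nhds 0)" by (intro tendsto_intros id0)
    then show ?thesis using s0U U(1) by (simp add: topological_tendstoD)
  qed
  have D0: "\<forall>\<^sub>F \<zeta> in nhds 0. dist (\<phi> (s0 + \<zeta>)) (L \<zeta>) < \<delta>"
  proof -
    have "isCont \<phi> s0" using \<phi>(1) U s0U continuous_on_interior interior_maximal by blast
    then have "((\<lambda>\<zeta>. \<phi> (s0 + \<zeta>)) \<longlongrightarrow> \<phi> (s0 + 0)) (nhds 0)"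
      by (intro isCont_tendsto_compose[where g=\<phi>] tendsto_intros id0) simp_all
    moreover have "((\<lambda>\<zeta>. z0 + \<zeta> *s v) \<longlongrightarrow> z0 + 0 *s v) (nhds 0)"
      by (intro tendsto_add tendsto_const vec_tendstoI) (auto intro!: tendsto_eq_intros id0)
    ultimately have "((\<lambda>\<zeta>. dist (\<phi> (s0 + \<zeta>)) (L \<zeta>)) \<longlongrightarrow> dist (\<phi> s0) z0) (nhds 0)"
      unfolding L_def using tendsto_dist by fastforce
    then show ?thesis using d0 by (rule order_tendstoD(2))
  qed
  have E0: "\<forall>\<^sub>F \<zeta> in nhds 0. \<forall>i. norm (er i \<zeta>) \<le> \<eta>' * norm \<zeta>"
  proof (rule eventually_all_finite)
    fix i
    have "((\<lambda>x. \<phi> x $ i) has_field_derivative v $ i) (at s0)"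
      using holomorphic_derivI[OF \<phi>(3) U(1) s0U] by (simp add: v_def)
    then obtain r where r: "r > 0" "\<And>y. norm (y - s0) < r \<Longrightarrow>
        norm (\<phi> y $ i - \<phi> s0 $ i - v $ i * (y - s0)) \<le> \<eta>' * norm (y - s0)"
      unfolding has_field_derivative_def has_derivative_at_alt using \<eta>'(1) by metis
    then show "\<forall>\<^sub>F \<zeta> in nhds 0. norm (er i \<zeta>) \<le> \<eta>' * norm \<zeta>"
      unfolding eventually_nhds_metric er_def
      by (intro exI[of _ r] conjI r(1) allI impI) (use r(2)[of "s0 + _"] in \<open>simp add: mult.commute\<close>)
  qed
  obtain dg g where g: "dg > 0" "g holomorphic_on ball s0 dg" "\<And>x. x \<in> ball s0 dg \<Longrightarrow> H x = Re (g x)"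
    using H(2) s0U unfolding harmonic_on_def by metis
  have "\<forall>\<^sub>F \<zeta>::complex in nhds 0. dist \<zeta> 0 < dg"
    unfolding eventually_nhds_metric using g(1) by blast
  then have "\<forall>\<^sub>F \<zeta> in nhds 0. s0 + \<zeta> \<in> U \<and> dist (\<phi> (s0 + \<zeta>)) (L \<zeta>) < \<delta> \<and>
      (\<forall>i. norm (er i \<zeta>) \<le> \<eta>' * norm \<zeta>) \<and> norm \<zeta> < dg"
    using U0 D0 E0 by eventually_elim auto
  then obtain r' where r': "r' > 0" "\<And>\<zeta>. norm \<zeta> < r' \<Longrightarrow> s0 + \<zeta> \<in> U \<and> dist (\<phi> (s0 + \<zeta>)) (L \<zeta>) < \<delta> \<and>
      (\<forall>i. norm (er i \<zeta>) \<le> \<eta>' * norm \<zeta>) \<and> norm \<zeta> < dg"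
    unfolding eventually_nhds_metric by auto
  define r where "r = r' / 2"
  have r: "0 < r" "r < r'" using r'(1) by (auto simp: r_def)
  have inK2: "(s0 + \<zeta>, L \<zeta>) \<in> K2" if "norm \<zeta> < r'" for \<zeta>
    using r'(2)[OF that] U(2) by (auto simp: K2_def)
  \<comment> \<open>On the circle of radius \<open>r\<close> the maximality of \<open>(s0, z0)\<close> bounds \<open>u\<close> by the real part of this holomorphic function.\<close>
  define P where "P \<zeta> = of_real x0 + (g (s0 + \<zeta>) - g s0) - 2 * of_real \<epsilon> * cnj s0 * \<zeta> - of_real (\<epsilon> * r\<^sup>2)
     + of_real N * (\<Sum>i\<in>UNIV. - 2 * cnj (d i) * er i \<zeta>) + of_real (N * n * \<eta>'\<^sup>2 * r\<^sup>2)" for \<zeta>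
  have shift: "(\<lambda>\<zeta>. s0 + \<zeta>) ` ball 0 r' \<subseteq> U \<inter> ball s0 dg"
  proof (intro image_subsetI)
    fix \<zeta> :: complex assume "\<zeta> \<in> ball 0 r'"
    then show "s0 + \<zeta> \<in> U \<inter> ball s0 dg" using r'(2)[of \<zeta>] by (simp add: dist_norm)
  qed
  have Phol: "P holomorphic_on ball 0 r'"
  proof -
    have "(\<lambda>\<zeta>. g (s0 + \<zeta>)) holomorphic_on ball 0 r'"
      using shift by (intro holomorphic_on_compose_gen[OF _ g(2), unfolded o_def] holomorphic_intros) blast
    moreover have "(\<lambda>\<zeta>. er i \<zeta>) holomorphic_on ball 0 r'" for i
    proof -
      have "(\<lambda>\<zeta>. \<phi> (s0 + \<zeta>) $ i) holomorphic_on ball 0 r'"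
        using shift by (intro holomorphic_on_compose_gen[OF _ \<phi>(3), unfolded o_def] holomorphic_intros) blast
      then show ?thesis unfolding er_def by (intro holomorphic_intros)
    qed
    ultimately show ?thesis unfolding P_def by (intro holomorphic_intros)
  qed
  have uP: "u (L \<zeta>) \<le> ereal (Re (P \<zeta>))" if "\<zeta> \<in> sphere 0 r" for \<zeta>
  proof -
    have \<zeta>: "norm \<zeta> = r" "norm \<zeta> < r'" using that r by auto
    have "\<Psi> (s0 + \<zeta>, L \<zeta>) \<le> \<Psi> (s0, z0)" using p0(2) inK2 \<zeta> by blast
    then have 1: "u (L \<zeta>) \<le> ereal (x0 - G s0 - N * (dist (\<phi> s0) z0)\<^sup>2 + G (s0 + \<zeta>) + N * (dist (\<phi> (s0 + \<zeta>)) (L \<zeta>))\<^sup>2)"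
      by (cases "u (L \<zeta>)") (auto simp: \<Psi>_def x0)
    have dist2: "(dist (\<phi> x) y)\<^sup>2 = (\<Sum>i\<in>UNIV. (norm (y $ i - \<phi> x $ i))\<^sup>2)" for x y
      by (simp add: dist_norm norm_vec_power2 norm_minus_commute)
    have "(dist (\<phi> (s0 + \<zeta>)) (L \<zeta>))\<^sup>2 = (\<Sum>i\<in>UNIV. (norm (d i - er i \<zeta>))\<^sup>2)"
      by (simp add: dist2 Ld)
    also have "\<dots> = (\<Sum>i\<in>UNIV. (norm (d i))\<^sup>2 - 2 * Re (cnj (d i) * er i \<zeta>) + (norm (er i \<zeta>))\<^sup>2)"
      by (simp only: norm_diff_power2)
    also have "\<dots> \<le> (\<Sum>i\<in>UNIV. (norm (d i))\<^sup>2 - 2 * Re (cnj (d i) * er i \<zeta>) + (\<eta>' * r)\<^sup>2)"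
      using r'(2)[OF \<zeta>(2)] \<zeta>(1) by (intro sum_mono add_left_mono power_mono) auto
    also have "\<dots> = (dist (\<phi> s0) z0)\<^sup>2 + (\<Sum>i\<in>UNIV. - 2 * Re (cnj (d i) * er i \<zeta>)) + n * (\<eta>'\<^sup>2 * r\<^sup>2)"
      by (simp add: dist2 d_def sum.distrib sum_subtractf sum_negf n_def power_mult_distrib sum_distrib_left)
    finally have 2: "N * (dist (\<phi> (s0 + \<zeta>)) (L \<zeta>))\<^sup>2 \<le>
        N * ((dist (\<phi> s0) z0)\<^sup>2 + (\<Sum>i\<in>UNIV. - 2 * Re (cnj (d i) * er i \<zeta>)) + n * (\<eta>'\<^sup>2 * r\<^sup>2))"
      using N by (rule mult_left_mono)
    have 3: "G (s0 + \<zeta>) - G s0 = Re (g (s0 + \<zeta>)) - Re (g s0) - \<epsilon> * (2 * Re (cnj s0 * \<zeta>) + r\<^sup>2)"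
    proof -
      have "(norm (s0 + \<zeta>))\<^sup>2 = (norm s0)\<^sup>2 + 2 * Re (cnj s0 * \<zeta>) + r\<^sup>2"
        using norm_diff_power2[of s0 "- \<zeta>"] \<zeta>(1) by simp
      moreover have "H (s0 + \<zeta>) = Re (g (s0 + \<zeta>))" "H s0 = Re (g s0)"
        using r'(2)[OF \<zeta>(2)] g by (auto simp: dist_norm)
      ultimately show ?thesis by (simp add: G_def algebra_simps)
    qed
    have "Re (P \<zeta>) = x0 + (Re (g (s0 + \<zeta>)) - Re (g s0)) - 2 * \<epsilon> * Re (cnj s0 * \<zeta>) - \<epsilon> * r\<^sup>2
       + N * (\<Sum>i\<in>UNIV. - 2 * Re (cnj (d i) * er i \<zeta>)) + N * n * \<eta>'\<^sup>2 * r\<^sup>2"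
    proof -
      have re: "Re (of_real c * z) = c * Re z" for c z by simp
      have "P \<zeta> = of_real x0 + (g (s0 + \<zeta>) - g s0) - of_real (2 * \<epsilon>) * (cnj s0 * \<zeta>) - of_real (\<epsilon> * r\<^sup>2)
        + of_real N * (\<Sum>i\<in>UNIV. of_real (- 2) * (cnj (d i) * er i \<zeta>)) + of_real (N * n * \<eta>'\<^sup>2 * r\<^sup>2)"
        by (simp add: P_def mult.assoc)
      then show ?thesis
        by (simp only: plus_complex.sel minus_complex.sel re Re_complex_of_real Re_sum)
    qed
    with 2 3 have "x0 - G s0 - N * (dist (\<phi> s0) z0)\<^sup>2 + G (s0 + \<zeta>) + N * (dist (\<phi> (s0 + \<zeta>)) (L \<zeta>))\<^sup>2 \<le> Re (P \<zeta>)"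
      by (simp add: algebra_simps)
    with 1 show ?thesis by (meson ereal_less_eq(3) order_trans)
  qed
  have "u (L 0) \<le> circle_mean (\<lambda>\<zeta>. u (L \<zeta>)) 0 r"
  proof -
    have "subharmonic_on {\<zeta>. L \<zeta> \<in> \<Omega>} (\<lambda>\<zeta>. u (L \<zeta>))"
      using psh unfolding plurisubharmonic_on_def L_def by blast
    moreover have "cball 0 r \<subseteq> {\<zeta>. L \<zeta> \<in> \<Omega>}"
      using K2\<Omega>[OF inK2] r by auto
    ultimately show ?thesis unfolding subharmonic_on_def using r(1) by blast
  qed
  also have "\<dots> \<le> circle_mean (\<lambda>\<zeta>. ereal (Re (P \<zeta>))) 0 r"
    using uP r(1) by (rule circle_mean_mono)
  also have "\<dots> = ereal (Re (P 0))"
  proof -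
    have "cball 0 r \<subseteq> ball 0 r'" "ball 0 r \<subseteq> ball 0 r'" "sphere 0 r \<subseteq> ball 0 r'" using r by auto
    then have "continuous_on (cball 0 r) P" "P holomorphic_on ball 0 r" "continuous_on (sphere 0 r) P"
      using Phol by (meson holomorphic_on_imp_continuous_on holomorphic_on_subset)+
    then show ?thesis
      using r(1) mean_Re_holomorphic[of r 0 P]
      by (subst circle_mean_real) (auto intro!: continuous_intros)
  qed
  also have "Re (P 0) = x0 - (\<epsilon> - N * n * \<eta>'\<^sup>2) * r\<^sup>2"
    by (simp add: P_def er_def algebra_simps)
  also have "\<dots> < x0" using small r(1) by simp
  also have "ereal x0 = u (L 0)" by (simp add: L_def x0)
  finally show False by simp
qed

section \<open>The cone of negative plurisubharmonic functions\<close>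

lemma usc_circle_measurable:
  assumes u: "usc_on S u" and r: "0 < r" and c: "cball c r \<subseteq> S"
  shows "(\<lambda>t. u (c + of_real r * cis t)) \<in> borel_measurable borel"
proof (rule borel_measurableI_less)
  fix y
  have "usc_on UNIV (\<lambda>t. u (c + of_real r * cis t))"
    by (rule usc_on_compose[OF u])
       (use r c in \<open>auto simp: image_subset_iff subset_iff dist_norm norm_mult intro!: continuous_intros\<close>)
  then have "open {t. u (c + of_real r * cis t) < y}"
    unfolding usc_on_openin by simp
  then show "{t \<in> space borel. u (c + of_real r * cis t) < y} \<in> sets borel"
    by simp
qed

lemma e2ennreal_uminus_add:
  assumes "x \<le> 0" "y \<le> 0"
  shows "e2ennreal (- (x + y)) = e2ennreal (- x) + e2ennreal (- y)"
  using assms by (cases x; cases y) (auto simp: ennreal_plus[symmetric] simp del: ennreal_plus)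

lemma e2ennreal_uminus_cmult:
  assumes "0 \<le> c" "x \<le> 0"
  shows "e2ennreal (- (ereal c * x)) = ennreal c * e2ennreal (- x)"
proof (cases x)
  case (real p)
  then show ?thesis using assms ennreal_mult[of c "- p"] by simp
next
  case MInf
  then show ?thesis using assms
    by (cases "c = 0") (auto simp: ennreal_mult_top e2ennreal_neg)
qed (use assms in auto)

lemma subharmonic_on_add:
  assumes u: "subharmonic_on S u" "\<And>z. z \<in> S \<Longrightarrow> u z \<le> 0"
    and v: "subharmonic_on S v" "\<And>z. z \<in> S \<Longrightarrow> v z \<le> 0"
  shows "subharmonic_on S (\<lambda>z. u z + v z)"
  unfolding subharmonic_on_def
proof (intro conjI ballI allI impI)
  show "usc_on S (\<lambda>z. u z + v z)"
    using u v by (intro usc_on_add) (auto simp: subharmonic_on_def)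
  show "u z + v z < \<infinity>" if "z \<in> S" for z
    using u v that by (auto simp: subharmonic_on_def)
  fix c r assume cr: "0 < r \<and> cball c r \<subseteq> S"
  then have r: "0 < r" and sub: "cball c r \<subseteq> S" and cS: "c \<in> S" by auto
  have in_S: "z \<in> S" if "z \<in> sphere c r" for z using that sub by auto
  let ?p = "\<lambda>t. c + of_real r * cis t"
  have pS: "?p t \<in> S" for t using in_S[of "?p t"] r by (simp add: dist_norm norm_mult)
  have meas: "(\<lambda>t. e2ennreal (- w (?p t))) \<in> borel_measurable circle_measure" if "usc_on S w" for w
    using usc_circle_measurable[OF that r sub] by simp
  have "(\<integral>\<^sup>+ t. e2ennreal (- (u (?p t) + v (?p t))) \<partial>circle_measure) =
      (\<integral>\<^sup>+ t. e2ennreal (- u (?p t)) + e2ennreal (- v (?p t)) \<partial>circle_measure)"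
    using u(2) v(2) pS by (intro nn_integral_cong e2ennreal_uminus_add) auto
  also have "\<dots> = (\<integral>\<^sup>+ t. e2ennreal (- u (?p t)) \<partial>circle_measure) + (\<integral>\<^sup>+ t. e2ennreal (- v (?p t)) \<partial>circle_measure)"
    using u v by (intro nn_integral_add meas) (auto simp: subharmonic_on_def)
  also have "\<dots> \<le> e2ennreal (- u c) + e2ennreal (- v c)"
  proof (intro add_mono)
    show "(\<integral>\<^sup>+ t. e2ennreal (- u (?p t)) \<partial>circle_measure) \<le> e2ennreal (- u c)"
      using u cr in_S cS by (subst submean_nonpos_iff[symmetric]) (auto simp: subharmonic_on_def)
    show "(\<integral>\<^sup>+ t. e2ennreal (- v (?p t)) \<partial>circle_measure) \<le> e2ennreal (- v c)"
      using v cr in_S cS by (subst submean_nonpos_iff[symmetric]) (auto simp: subharmonic_on_def)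
  qed
  also have "\<dots> = e2ennreal (- (u c + v c))"
    using u(2) v(2) cS by (simp add: e2ennreal_uminus_add)
  finally show "u c + v c \<le> circle_mean (\<lambda>z. u z + v z) c r"
    using u(2) v(2) in_S cS r by (subst submean_nonpos_iff) (auto intro: add_nonpos_nonpos)
qed

lemma subharmonic_on_cmult:
  assumes u: "subharmonic_on S u" "\<And>z. z \<in> S \<Longrightarrow> u z \<le> 0" and a: "0 \<le> a"
  shows "subharmonic_on S (\<lambda>z. ereal a * u z)"
  unfolding subharmonic_on_def
proof (intro conjI ballI allI impI)
  have nonpos: "ereal a * u z \<le> 0" if "z \<in> S" for z
    using u(2)[OF that] a by (simp add: ereal_mult_le_0_iff)
  show "usc_on S (\<lambda>z. ereal a * u z)"
    using u a by (intro usc_on_cmult) (auto simp: subharmonic_on_def)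
  show "ereal a * u z < \<infinity>" if "z \<in> S" for z
    using nonpos[OF that] by auto
  fix c r assume cr: "0 < r \<and> cball c r \<subseteq> S"
  then have r: "0 < r" and sub: "cball c r \<subseteq> S" and cS: "c \<in> S" by auto
  have in_S: "z \<in> S" if "z \<in> sphere c r" for z using that sub by auto
  let ?p = "\<lambda>t. c + of_real r * cis t"
  have pS: "?p t \<in> S" for t using in_S[of "?p t"] r by (simp add: dist_norm norm_mult)
  have "(\<integral>\<^sup>+ t. e2ennreal (- (ereal a * u (?p t))) \<partial>circle_measure) =
      (\<integral>\<^sup>+ t. ennreal a * e2ennreal (- u (?p t)) \<partial>circle_measure)"
    using u(2) pS a by (intro nn_integral_cong e2ennreal_uminus_cmult) auto
  also have "\<dots> = ennreal a * (\<integral>\<^sup>+ t. e2ennreal (- u (?p t)) \<partial>circle_measure)"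
    using usc_circle_measurable[OF _ r sub, of u] u(1)
    by (intro nn_integral_cmult) (auto simp: subharmonic_on_def)
  also have "\<dots> \<le> ennreal a * e2ennreal (- u c)"
    using u cr in_S cS by (intro mult_left_mono, subst submean_nonpos_iff[symmetric]) (auto simp: subharmonic_on_def)
  also have "\<dots> = e2ennreal (- (ereal a * u c))"
    using u(2) cS a by (simp add: e2ennreal_uminus_cmult)
  finally show "ereal a * u c \<le> circle_mean (\<lambda>z. ereal a * u z) c r"
    using nonpos in_S cS r by (subst submean_nonpos_iff) auto
qed

lemma subharmonic_on_max:
  assumes u: "subharmonic_on S u" and v: "subharmonic_on S v"
  shows "subharmonic_on S (\<lambda>z. max (u z) (v z))"
  unfolding subharmonic_on_def
proof (intro conjI ballI allI impI)
  show "usc_on S (\<lambda>z. max (u z) (v z))"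
    using u v by (intro usc_on_max) (auto simp: subharmonic_on_def)
  show "max (u z) (v z) < \<infinity>" if "z \<in> S" for z
    using u v that unfolding subharmonic_on_def max_less_iff_conj by blast
  fix c r assume cr: "0 < r \<and> cball c r \<subseteq> S"
  have "u c \<le> circle_mean u c r" "v c \<le> circle_mean v c r"
    using u v cr by (auto simp: subharmonic_on_def)
  moreover have "circle_mean u c r \<le> circle_mean (\<lambda>z. max (u z) (v z)) c r"
    "circle_mean v c r \<le> circle_mean (\<lambda>z. max (u z) (v z)) c r"
    using cr by (auto intro!: circle_mean_mono)
  ultimately show "max (u c) (v c) \<le> circle_mean (\<lambda>z. max (u z) (v z)) c r"
    by (auto intro: order_trans)
qed

lemma neg_psh_cone_add:
  assumes "u \<in> neg_psh_cone \<Omega>" "v \<in> neg_psh_cone \<Omega>"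
  shows "(\<lambda>z. u z + v z) \<in> neg_psh_cone \<Omega>"
  using assms unfolding neg_psh_cone_def plurisubharmonic_on_def
  by (auto intro!: usc_on_add subharmonic_on_add add_nonpos_nonpos)

lemma neg_psh_cone_cmult:
  assumes "u \<in> neg_psh_cone \<Omega>" "0 \<le> a"
  shows "(\<lambda>z. ereal a * u z) \<in> neg_psh_cone \<Omega>"
proof -
  have "ereal a * u z \<le> 0" if "z \<in> \<Omega>" for z
    using that assms by (simp add: ereal_mult_le_0_iff neg_psh_cone_def)
  moreover from this have "ereal a * u z \<noteq> \<infinity>" if "z \<in> \<Omega>" for z using that by fastforce
  ultimately show ?thesis
    using assms unfolding neg_psh_cone_def plurisubharmonic_on_def
    by (auto intro!: usc_on_cmult subharmonic_on_cmult)
qed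

lemma neg_psh_cone_max:
  assumes "u \<in> neg_psh_cone \<Omega>" "v \<in> neg_psh_cone \<Omega>"
  shows "(\<lambda>z. max (u z) (v z)) \<in> neg_psh_cone \<Omega>"
  using assms unfolding neg_psh_cone_def plurisubharmonic_on_def mem_Collect_eq max_less_iff_conj
    max.bounded_iff
  by (intro conjI ballI allI usc_on_max subharmonic_on_max) blast+

lemma submean_const_0: "(0::ereal) \<le> circle_mean (\<lambda>_. 0) c r"
  by (simp add: circle_mean_def ereal_integral_def)

lemma neg_psh_cone_0: "(\<lambda>_. 0) \<in> neg_psh_cone \<Omega>"
  unfolding neg_psh_cone_def plurisubharmonic_on_def subharmonic_on_def usc_on_def
  by (simp add: submean_const_0)

lemma neg_psh_cone_sum:
  assumes "\<And>i. i \<in> I \<Longrightarrow> f i \<in> neg_psh_cone \<Omega>"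
  shows "(\<lambda>z. \<Sum>i\<in>I. f i z) \<in> neg_psh_cone \<Omega>"
  using assms
  by (induction I rule: infinite_finite_induct) (auto intro: neg_psh_cone_0 neg_psh_cone_add)

lemma usc_on_cong:
  assumes "usc_on S u" "\<And>z. z \<in> S \<Longrightarrow> u z = v z"
  shows "usc_on S v"
proof -
  have "{x\<in>S. v x < c} = {x\<in>S. u x < c}" for c using assms(2) by auto
  then show ?thesis using assms(1) by (simp add: usc_on_openin)
qed

lemma subharmonic_on_cong:
  assumes u: "subharmonic_on S u" and eq: "\<And>z. z \<in> S \<Longrightarrow> u z = v z"
  shows "subharmonic_on S v"
  unfolding subharmonic_on_def
proof (intro conjI ballI allI impI)
  show "usc_on S v" using usc_on_cong[of S u v] u eq by (auto simp: subharmonic_on_def)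
  show "v z < \<infinity>" if "z \<in> S" for z using u eq[OF that] that by (auto simp: subharmonic_on_def)
  fix c r assume cr: "0 < r \<and> cball c r \<subseteq> S"
  have "u c \<le> circle_mean u c r" using u cr by (auto simp: subharmonic_on_def)
  also have "\<dots> \<le> circle_mean v c r"
  proof (rule circle_mean_mono)
    fix z assume "z \<in> sphere c r"
    then have "z \<in> S" using cr by auto
    then show "u z \<le> v z" by (simp add: eq)
  qed (use cr in auto)
  finally show "v c \<le> circle_mean v c r" using eq[of c] cr by (simp add: subset_iff)
qed

lemma neg_psh_cone_cong:
  assumes u: "u \<in> neg_psh_cone \<Omega>" and eq: "\<And>z. z \<in> \<Omega> \<Longrightarrow> u z = v z"
  shows "v \<in> neg_psh_cone \<Omega>"
proof -
  have "subharmonic_on {\<zeta>. a + \<zeta> *s b \<in> \<Omega>} (\<lambda>\<zeta>. v (a + \<zeta> *s b))" for a b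
    by (rule subharmonic_on_cong[of _ "\<lambda>\<zeta>. u (a + \<zeta> *s b)"])
       (use u eq in \<open>auto simp: neg_psh_cone_def plurisubharmonic_on_def\<close>)
  then show ?thesis
    using u eq usc_on_cong[of \<Omega> u v] unfolding neg_psh_cone_def plurisubharmonic_on_def by auto
qed

lemma extremal_psh_cong:
  assumes "extremal_psh \<Omega> u" "\<And>z. z \<in> \<Omega> \<Longrightarrow> u z = v z"
  shows "extremal_psh \<Omega> v"
  using assms neg_psh_cone_cong[of u \<Omega> v] unfolding extremal_psh_def by simp

lemma elog_less_iff:
  assumes "0 \<le> x"
  shows "elog x < ereal c \<longleftrightarrow> x < exp c"
  using assms by (cases "x = 0") (auto simp: elog_def ln_less_cancel_iff[of x "exp c", simplified])

lemma elog_mono: "0 \<le> x \<Longrightarrow> x \<le> y \<Longrightarrow> elog x \<le> elog y"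
  by (auto simp: elog_def)

lemma elog_nonpos: "0 \<le> x \<Longrightarrow> x \<le> 1 \<Longrightarrow> elog x \<le> 0"
  by (auto simp: elog_def ln_le_zero_iff)

lemma elog_mult: "0 \<le> x \<Longrightarrow> 0 \<le> y \<Longrightarrow> elog (x * y) = elog x + elog y"
  by (auto simp: elog_def ln_mult)

lemma usc_on_elog_norm:
  fixes f :: "'a::topological_space \<Rightarrow> complex"
  assumes "continuous_on S f"
  shows "usc_on S (\<lambda>z. elog (norm (f z)))"
  unfolding usc_on_def
proof (intro ballI allI impI)
  fix x c assume x: "x \<in> S" "elog (norm (f x)) < c"
  then obtain d where d: "elog (norm (f x)) < ereal d" "ereal d < c" using ereal_dense2 by blast
  have "((\<lambda>z. norm (f z)) \<longlongrightarrow> norm (f x)) (at x within S)"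
    using assms x(1) by (auto simp: continuous_on_def intro!: tendsto_intros)
  moreover have "norm (f x) < exp d" using d(1) by (simp add: elog_less_iff)
  ultimately have "\<forall>\<^sub>F y in at x within S. norm (f y) < exp d" by (rule order_tendstoD(2))
  then show "\<forall>\<^sub>F y in at x within S. elog (norm (f y)) < c"
    by eventually_elim (use d(2) in \<open>meson elog_less_iff norm_ge_zero less_trans\<close>)
qed

text \<open>Truncating the logarithm from below makes it continuous, so that monotone convergence reaches
  the singularities.\<close>
lemma e2ennreal_uminus_elog_SUP:
  assumes "0 \<le> x"
  shows "e2ennreal (- elog x) = (SUP n. ennreal (- ln (max x (exp (- real n)))))"
proof (cases "x = 0")
  case True
  then show ?thesis by (simp add: elog_def max_absorb2 ennreal_SUP_of_nat_eq_top ennreal_of_nat_eq_real_of_nat[symmetric])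
next
  case False
  with assms have x: "x > 0" by simp
  show ?thesis
  proof (rule SUP_eqI[symmetric])
    show "ennreal (- ln (max x (exp (- real n)))) \<le> e2ennreal (- elog x)" for n
      using x by (simp add: elog_def ennreal_leI)
    fix y assume y: "\<And>n. n \<in> UNIV \<Longrightarrow> ennreal (- ln (max x (exp (- real n)))) \<le> y"
    obtain n where "real n \<ge> - ln x" using real_arch_simple by blast
    then have "exp (- real n) \<le> x" using x by (metis exp_le_cancel_iff exp_ln minus_le_iff)
    then show "e2ennreal (- elog x) \<le> y" using y[of n] x by (simp add: elog_def max_absorb1)
  qed
qed

text \<open>On the circle, approximate the truncation \<open>ln (max (norm (f z)) (exp (- n)))\<close> from above by the real part
  of an entire \<open>p\<close>, up to \<open>e\<close>.  The maximum modulus principle for \<open>f * exp (- p)\<close> compares \<open>ln (norm (f c))\<close> with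
  \<open>Re (p c)\<close>, which is the mean of \<open>Re p\<close>.  Zeros of \<open>f\<close> need no separate treatment in this way, in contrast to
  a proof by Jensen's formula.\<close>
lemma subharmonic_on_elog_norm:
  assumes f: "f holomorphic_on S" "open S" and bound: "\<And>z. z \<in> S \<Longrightarrow> norm (f z) \<le> 1"
  shows "subharmonic_on S (\<lambda>z. elog (norm (f z)))"
  unfolding subharmonic_on_def
proof (intro conjI ballI allI impI)
  have nonpos: "elog (norm (f z)) \<le> 0" if "z \<in> S" for z
    using bound[OF that] by (intro elog_nonpos) auto
  have contf: "continuous_on S f" using f(1) by (rule holomorphic_on_imp_continuous_on)
  show "usc_on S (\<lambda>z. elog (norm (f z)))" using contf by (rule usc_on_elog_norm)
  show "elog (norm (f z)) < \<infinity>" if "z \<in> S" for z using nonpos[OF that] by auto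
  fix c r assume cr: "0 < r \<and> cball c r \<subseteq> S"
  then have r: "0 < r" and sub: "cball c r \<subseteq> S" and cS: "c \<in> S" by auto
  have in_S: "z \<in> S" if "z \<in> sphere c r" for z using that sub by auto
  let ?p = "\<lambda>t. c + of_real r * cis t"
  have pS: "?p t \<in> S" for t using in_S[of "?p t"] r by (simp add: dist_norm norm_mult)
  show "elog (norm (f c)) \<le> circle_mean (\<lambda>z. elog (norm (f z))) c r"
  proof (cases "f c = 0")
    case False
    define g where "g n z = ln (max (norm (f z)) (exp (- real n)))" for n z
    have g_pos: "0 < max (norm (f z)) (exp (- real n))" for n z by (simp add: less_max_iff_disj)
    have contg: "continuous_on (sphere c r) (g n)" for n
      unfolding g_def using g_pos[of _ n]
      by (intro continuous_intros continuous_on_subset[OF contf]) (use in_S in \<open>auto simp: less_le\<close>)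
    have contgp: "continuous_on UNIV (\<lambda>t. g n (?p t))" for n
      by (rule continuous_on_compose2[OF contg]) (use r in \<open>auto simp: dist_norm norm_mult intro!: continuous_intros\<close>)
    have g0: "g n z \<le> 0" if "z \<in> S" for n z
      using bound[OF that] g_pos[of z n] by (simp add: g_def ln_le_zero_iff)
    have key: "ln (norm (f c)) \<le> (\<integral>t. g n (?p t) \<partial>circle_measure)" for n
    proof (rule field_le_epsilon)
      fix e :: real assume e: "0 < e"
      obtain p where p: "p holomorphic_on UNIV" "\<And>z. z \<in> sphere c r \<Longrightarrow> \<bar>g n z - Re (p z)\<bar> < e / 2"
        using approx_circle_Re_entire[OF r contg, of "e / 2" n] e by auto
      define F where "F z = f z * exp (- p z - of_real (e / 2))" for z
      have Fhol: "F holomorphic_on S"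
        unfolding F_def by (intro holomorphic_intros f holomorphic_on_subset[OF p(1)]) auto
      have "norm (F z) \<le> 1" if z: "z \<in> sphere c r" for z
      proof -
        have "norm (f z) \<le> max (norm (f z)) (exp (- real n))" by simp
        also have "\<dots> = exp (g n z)" using g_pos[of z n] by (simp add: g_def)
        also have "\<dots> \<le> exp (Re (p z) + e / 2)" using p(2)[OF z] unfolding exp_le_cancel_iff by linarith
        finally have "norm (f z) * exp (- Re (p z) - e / 2) \<le> exp (Re (p z) + e / 2) * exp (- Re (p z) - e / 2)"
          by (rule mult_right_mono) simp
        then show ?thesis by (simp add: F_def norm_mult mult_exp_exp)
      qed
      then have "norm (F c) \<le> 1"
        using r sub by (intro maximum_modulus_frontier[of F "cball c r" 1 c])
          (auto intro: holomorphic_on_subset[OF Fhol] holomorphic_on_imp_continuous_on[OF holomorphic_on_subset[OF Fhol]] simp: subset_iff)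
      then have "norm (f c) * exp (- (Re (p c) + e / 2)) \<le> 1"
        by (simp add: F_def norm_mult)
      then have "norm (f c) \<le> exp (Re (p c) + e / 2)"
        by (simp add: exp_minus field_simps)
      then have "ln (norm (f c)) \<le> Re (p c) + e / 2"
        using False by (metis exp_ln exp_le_cancel_iff zero_less_norm_iff)
      also have "Re (p c) = (\<integral>t. Re (p (?p t)) \<partial>circle_measure)"
        using mean_Re_holomorphic[OF r, of c p] p(1)
        by (simp add: holomorphic_on_subset holomorphic_on_imp_continuous_on)
      also have "\<dots> \<le> (\<integral>t. g n (?p t) + e / 2 \<partial>circle_measure)"
      proof (rule integral_mono)
        have pc: "continuous_on UNIV p" using p(1) by (rule holomorphic_on_imp_continuous_on)
        show "integrable circle_measure (\<lambda>t. Re (p (?p t)))"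
          by (intro integrable_circle_measure continuous_intros continuous_on_compose2[OF pc]) auto
        show "integrable circle_measure (\<lambda>t. g n (?p t) + e / 2)"
          by (intro integrable_circle_measure continuous_intros contgp)
        show "Re (p (?p t)) \<le> g n (?p t) + e / 2" for t
        proof -
          have "?p t \<in> sphere c r" using r by (simp add: dist_norm norm_mult)
          from p(2)[OF this] show ?thesis by linarith
        qed
      qed
      also have "\<dots> = (\<integral>t. g n (?p t) \<partial>circle_measure) + e / 2"
      proof -
        have "measure circle_measure UNIV = 1"
          using emeasure_circle_measure by (simp add: measure_def)
        then show ?thesis
          using finite_circle_measure integrable_circle_measure[OF contgp, of n]
          by (subst Bochner_Integration.integral_add) (auto intro: finite_measure.integrable_const)
      qed
      finally show "ln (norm (f c)) \<le> (\<integral>t. g n (?p t) \<partial>circle_measure) + e" by simp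
    qed
    have "(\<integral>\<^sup>+ t. e2ennreal (- elog (norm (f (?p t)))) \<partial>circle_measure) =
        (\<integral>\<^sup>+ t. (SUP n. ennreal (- g n (?p t))) \<partial>circle_measure)"
      by (intro nn_integral_cong) (simp add: e2ennreal_uminus_elog_SUP g_def)
    also have "\<dots> = (SUP n. \<integral>\<^sup>+ t. ennreal (- g n (?p t)) \<partial>circle_measure)"
    proof (rule nn_integral_monotone_convergence_SUP)
      show "incseq (\<lambda>n t. ennreal (- g n (?p t)))"
      proof (intro monoI le_funI ennreal_leI)
        fix m n :: nat and t assume "m \<le> n"
        then have "max (norm (f (?p t))) (exp (- real n)) \<le> max (norm (f (?p t))) (exp (- real m))"
          by (intro max.mono) auto
        then show "- g m (?p t) \<le> - g n (?p t)"
          using g_pos[of "?p t" n] g_pos[of "?p t" m] by (simp add: g_def)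
      qed
      show "(\<lambda>t. ennreal (- g n (?p t))) \<in> borel_measurable circle_measure" for n
        using borel_measurable_continuous_onI[OF contgp, of n] by simp
    qed
    also have "\<dots> \<le> e2ennreal (- elog (norm (f c)))"
    proof (rule SUP_least)
      fix n
      have "(\<integral>\<^sup>+ t. ennreal (- g n (?p t)) \<partial>circle_measure) = ennreal (\<integral>t. - g n (?p t) \<partial>circle_measure)"
        using integrable_circle_measure[OF contgp, of n] g0 pS
        by (intro nn_integral_eq_integral) auto
      also have "\<dots> \<le> ennreal (- ln (norm (f c)))"
        using key[of n] by (intro ennreal_leI) simp
      finally show "(\<integral>\<^sup>+ t. ennreal (- g n (?p t)) \<partial>circle_measure) \<le> e2ennreal (- elog (norm (f c)))"
        using False by (simp add: elog_def)
    qed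
    finally show ?thesis
      using nonpos in_S cS r by (subst submean_nonpos_iff) auto
  qed (simp add: elog_def)
qed

lemma open_line_section:
  assumes "open \<Omega>"
  shows "open {\<zeta>::complex. a + \<zeta> *s b \<in> (\<Omega> :: (complex^'n) set)}"
proof -
  have "continuous_on UNIV (\<lambda>\<zeta>::complex. \<chi> i. a $ i + \<zeta> * b $ i)"
    by (intro continuous_on_vec_lambda continuous_intros)
  moreover have "(\<lambda>\<zeta>::complex. \<chi> i. a $ i + \<zeta> * b $ i) = (\<lambda>\<zeta>. a + \<zeta> *s b)"
    by (simp add: vec_eq_iff fun_eq_iff)
  ultimately have "open ((\<lambda>\<zeta>::complex. a + \<zeta> *s b) -` \<Omega>)" using assms by (metis open_vimage)
  then show ?thesis by (simp add: vimage_def)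
qed

lemma elog_norm_in_neg_psh_cone:
  fixes f :: "complex^'n \<Rightarrow> complex"
  assumes "open \<Omega>" "continuous_on \<Omega> f" "\<And>z. z \<in> \<Omega> \<Longrightarrow> norm (f z) \<le> 1"
    and "\<And>a b. (\<lambda>\<zeta>. f (a + \<zeta> *s b)) holomorphic_on {\<zeta>. a + \<zeta> *s b \<in> \<Omega>}"
  shows "(\<lambda>z. elog (norm (f z))) \<in> neg_psh_cone \<Omega>"
proof -
  have "elog (norm (f z)) \<le> 0" if "z \<in> \<Omega>" for z
    using assms(3)[OF that] by (intro elog_nonpos) auto
  moreover from this have "elog (norm (f z)) < \<infinity>" if "z \<in> \<Omega>" for z using that by fastforce
  moreover have "subharmonic_on {\<zeta>. a + \<zeta> *s b \<in> \<Omega>} (\<lambda>\<zeta>. elog (norm (f (a + \<zeta> *s b))))" for a b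
    using assms by (intro subharmonic_on_elog_norm open_line_section) auto
  ultimately show ?thesis
    unfolding neg_psh_cone_def plurisubharmonic_on_def using usc_on_elog_norm[OF assms(2)] by auto
qed

text \<open>Since \<open>f = q - g\<close>, the function \<open>f\<close> is also lower semicontinuous.\<close>
lemma usc_sum_continuous:
  fixes f g :: "'a::topological_space \<Rightarrow> ereal" and q :: "'a \<Rightarrow> real"
  assumes f: "usc_on S f" "\<And>x. x \<in> S \<Longrightarrow> f x < \<infinity>"
    and g: "usc_on S g" "\<And>x. x \<in> S \<Longrightarrow> g x < \<infinity>"
    and q: "continuous_on S q" "\<And>x. x \<in> S \<Longrightarrow> f x + g x = ereal (q x)"
  obtains F where "continuous_on S F" "\<And>x. x \<in> S \<Longrightarrow> f x = ereal (F x)" "\<And>x. x \<in> S \<Longrightarrow> g x = ereal (q x - F x)"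
proof
  define F where "F x = real_of_ereal (f x)" for x
  have *: "f x = ereal (F x) \<and> g x = ereal (q x - F x)" if "x \<in> S" for x
    using f(2)[OF that] g(2)[OF that] q(2)[OF that] unfolding F_def
    by (cases "f x"; cases "g x") auto
  then show "\<And>x. x \<in> S \<Longrightarrow> f x = ereal (F x)" "\<And>x. x \<in> S \<Longrightarrow> g x = ereal (q x - F x)" by auto
  show "continuous_on S F"
    unfolding continuous_on_def
  proof (intro ballI order_tendstoI)
    fix x a assume x: "x \<in> S" and a: "F x < a"
    have "\<forall>\<^sub>F y in at x within S. f y < ereal a"
      using f(1) x a * unfolding usc_on_def by auto
    moreover have "\<forall>\<^sub>F y in at x within S. y \<in> S" by (simp add: eventually_at_filter)
    ultimately show "\<forall>\<^sub>F y in at x within S. F y < a"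
      by eventually_elim (use * in auto)
  next
    fix x a assume x: "x \<in> S" and a: "a < F x"
    define d where "d = (F x - a) / 2"
    have d: "d > 0" using a by (simp add: d_def)
    have "\<forall>\<^sub>F y in at x within S. g y < ereal (q x - F x + d)"
      using g(1) x d * unfolding usc_on_def by auto
    moreover have "\<forall>\<^sub>F y in at x within S. q x - d < q y"
      using q(1) x d by (intro order_tendstoD(1)[of _ "q x"]) (auto simp: continuous_on_def)
    moreover have "\<forall>\<^sub>F y in at x within S. y \<in> S" by (simp add: eventually_at_filter)
    ultimately show "\<forall>\<^sub>F y in at x within S. a < F y"
      by eventually_elim (use * in \<open>auto simp: d_def field_simps\<close>)
  qed
qed

section \<open>Splitting a logarithm along a punctured disc\<close>

lemma neg_psh_coneD:
  assumes "u \<in> neg_psh_cone \<Omega>"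
  shows "plurisubharmonic_on \<Omega> u" "usc_on \<Omega> u" "z \<in> \<Omega> \<Longrightarrow> u z \<le> 0" "z \<in> \<Omega> \<Longrightarrow> u z < \<infinity>"
  using assms by (auto simp: neg_psh_cone_def plurisubharmonic_on_def)

lemma continuous_on_components:
  fixes \<phi> :: "complex \<Rightarrow> complex^'n"
  assumes "\<And>i. (\<lambda>s. \<phi> s $ i) holomorphic_on S"
  shows "continuous_on S \<phi>"
proof -
  have "continuous_on S (\<lambda>s. \<chi> i. \<phi> s $ i)"
    by (intro continuous_on_vec_lambda holomorphic_on_imp_continuous_on assms)
  then show ?thesis by simp
qed

text \<open>The maximum principle on the annuli between \<open>r\<close> and \<open>R\<close>, for \<open>R\<close> tending to 1: on the outer circle
  \<open>u \<le> 0\<close> suffices, at the price of the error \<open>- \<beta> * ln R\<close>.\<close>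
lemma log_bound_outwards:
  fixes u :: "complex^'n \<Rightarrow> ereal" and \<phi> :: "complex \<Rightarrow> complex^'n"
  assumes u: "u \<in> neg_psh_cone \<Omega>" and \<Omega>: "open \<Omega>"
    and \<phi>: "\<And>i. (\<lambda>s. \<phi> s $ i) holomorphic_on (ball 0 1 - {0})" "\<phi> ` (ball 0 1 - {0}) \<subseteq> \<Omega>"
    and r: "0 < r" and \<beta>: "0 \<le> \<beta>"
    and inner: "\<And>\<zeta>. norm \<zeta> = r \<Longrightarrow> u (\<phi> \<zeta>) \<le> ereal (\<beta> * ln r)"
    and \<zeta>: "r \<le> norm \<zeta>" "norm \<zeta> < 1"
  shows "u (\<phi> \<zeta>) \<le> ereal (\<beta> * ln (norm \<zeta>))"
proof -
  have psh: "plurisubharmonic_on \<Omega> u" and neg: "\<And>z. z \<in> \<Omega> \<Longrightarrow> u z \<le> 0"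
    using u by (auto simp: neg_psh_cone_def)
  have *: "u (\<phi> \<zeta>) \<le> ereal (\<beta> * ln (norm \<zeta>) - \<beta> * ln R)" if R: "norm \<zeta> < R" "R < 1" for R
  proof -
    define K :: "complex set" where "K = cball 0 R - ball 0 r"
    define U :: "complex set" where "U = ball 0 R - cball 0 r"
    have KD: "K \<subseteq> ball 0 1 - {0}" using R r by (auto simp: K_def)
    have "U \<subseteq> K" by (auto simp: K_def U_def)
    show ?thesis
    proof (rule psh_curve_max_principle[OF psh \<Omega>, where K=K and U=U])
      show "compact K" unfolding K_def by (intro compact_diff) auto
      show "open U" unfolding U_def by (intro open_Diff) auto
      show "continuous_on K \<phi>" by (rule continuous_on_subset[OF continuous_on_components[OF \<phi>(1)] KD])
      show "\<phi> ` K \<subseteq> \<Omega>" using \<phi>(2) KD by blast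
      show "(\<lambda>s. \<phi> s $ i) holomorphic_on U" for i
        using \<phi>(1) KD \<open>U \<subseteq> K\<close> by (meson holomorphic_on_subset)
      show "continuous_on K (\<lambda>x. \<beta> * ln (norm x) - \<beta> * ln R)"
        using KD by (intro continuous_intros) auto
      have "harmonic_on U (\<lambda>x. \<beta> * ln (norm x) + (- (\<beta> * ln R)))"
        using KD \<open>U \<subseteq> K\<close> \<open>open U\<close>
        by (intro harmonic_on_add harmonic_on_cmult harmonic_on_const
            harmonic_on_ln_norm) auto
      then show "harmonic_on U (\<lambda>x. \<beta> * ln (norm x) - \<beta> * ln R)" by simp
      show "u (\<phi> x) \<le> ereal (\<beta> * ln (norm x) - \<beta> * ln R)" if x: "x \<in> K - U" for x
      proof -
        have "norm x = r \<or> norm x = R" using x by (auto simp: K_def U_def)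
        then show ?thesis
        proof
          assume xr: "norm x = r"
          have "R > 0" using R(1) norm_ge_zero order.strict_trans1 by blast
          then have "\<beta> * ln R \<le> 0" using R(2) \<beta> by (simp add: mult_nonneg_nonpos)
          then have "ereal (\<beta> * ln r) \<le> ereal (\<beta> * ln (norm x) - \<beta> * ln R)" by (simp add: xr)
          with inner[OF xr] show ?thesis by (rule order_trans)
        next
          assume "norm x = R"
          then show ?thesis using neg[of "\<phi> x"] \<phi>(2) KD x by (auto simp: zero_ereal_def)
        qed
      qed
      show "\<zeta> \<in> K" using \<zeta> R by (auto simp: K_def)
    qed fact
  qed
  have "((\<lambda>R. \<beta> * ln (norm \<zeta>) - \<beta> * ln R) \<longlongrightarrow> \<beta> * ln (norm \<zeta>) - \<beta> * ln 1) (at_left 1)"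
    by (intro tendsto_intros) auto
  then have "((\<lambda>R. ereal (\<beta> * ln (norm \<zeta>) - \<beta> * ln R)) \<longlongrightarrow> ereal (\<beta> * ln (norm \<zeta>))) (at_left 1)"
    by simp
  then show ?thesis
  proof (rule tendsto_lowerbound)
    show "\<forall>\<^sub>F R in at_left 1. u (\<phi> \<zeta>) \<le> ereal (\<beta> * ln (norm \<zeta>) - \<beta> * ln R)"
      unfolding eventually_at_left_field using * \<zeta>(2) by (intro exI[of _ "norm \<zeta>"]) auto
  qed simp
qed

text \<open>By \<open>log_bound_outwards\<close>, a lower bound for the quotient \<open>v \<zeta> / ln (norm \<zeta>)\<close> on a circle persists outside
  that circle.  So values close to the infimum, once attained, are attained on every smaller circle.\<close>
lemma log_ratio_small_circles:
  fixes u :: "complex^'n \<Rightarrow> ereal" and \<phi> :: "complex \<Rightarrow> complex^'n" and v :: "complex \<Rightarrow> real"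
  assumes u: "u \<in> neg_psh_cone \<Omega>" and \<Omega>: "open \<Omega>"
    and \<phi>: "\<And>i. (\<lambda>s. \<phi> s $ i) holomorphic_on (ball 0 1 - {0})" "\<phi> ` (ball 0 1 - {0}) \<subseteq> \<Omega>"
    and v: "\<And>\<zeta>. \<zeta> \<in> ball 0 1 - {0} \<Longrightarrow> u (\<phi> \<zeta>) = ereal (v \<zeta>)"
    and less: "(INF \<zeta>\<in>ball 0 1 - {0}. v \<zeta> / ln (norm \<zeta>)) < \<beta>"
  shows "\<exists>r0. 0 < r0 \<and> r0 < 1 \<and>
    (\<forall>r. 0 < r \<longrightarrow> r \<le> r0 \<longrightarrow> (\<exists>\<zeta>. norm \<zeta> = r \<and> v \<zeta> / ln r < \<beta>))"
proof -
  let ?D = "ball 0 1 - {0::complex}"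
  have nonpos: "v \<zeta> \<le> 0" if "\<zeta> \<in> ?D" for \<zeta>
    using neg_psh_coneD(3)[OF u, of "\<phi> \<zeta>"] \<phi>(2) v[OF that] that by (auto simp: image_subset_iff)
  have lnneg: "ln (norm \<zeta>) < 0" if "\<zeta> \<in> ?D" for \<zeta>
    using that by simp
  have ratio: "0 \<le> v \<zeta> / ln (norm \<zeta>)" if "\<zeta> \<in> ?D" for \<zeta>
    using nonpos[OF that] lnneg[OF that] by (simp add: divide_nonpos_neg)
  have "1/2 \<in> ?D" by simp
  then have "?D \<noteq> {}" by blast
  then have "\<exists>x\<in>(\<lambda>\<zeta>. v \<zeta> / ln (norm \<zeta>)) ` ?D. x < \<beta>"
    using cInf_lessD[OF _ less] by (simp only: image_is_empty not_False_eq_True)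
  then obtain \<zeta>0 where \<zeta>0: "\<zeta>0 \<in> ?D" "v \<zeta>0 / ln (norm \<zeta>0) < \<beta>" by blast
  have \<beta>: "0 \<le> \<beta>" using ratio[OF \<zeta>0(1)] \<zeta>0(2) by linarith
  show ?thesis
  proof (intro exI[of _ "norm \<zeta>0"] conjI allI impI)
    show "0 < norm \<zeta>0" "norm \<zeta>0 < 1" using \<zeta>0(1) by auto
    fix r assume r: "0 < r" "r \<le> norm \<zeta>0"
    show "\<exists>\<zeta>. norm \<zeta> = r \<and> v \<zeta> / ln r < \<beta>"
    proof (rule ccontr)
      assume none: "\<not> ?thesis"
      have *: "v \<zeta> / ln r \<ge> \<beta>" if "norm \<zeta> = r" for \<zeta>
        using none that not_le by blast
      have r1: "r < 1" using r \<zeta>0(1) by auto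
      have lnr: "ln r < 0" using r r1 by simp
      have "u (\<phi> \<zeta>0) \<le> ereal (\<beta> * ln (norm \<zeta>0))"
      proof (rule log_bound_outwards[OF u \<Omega> \<phi> r(1) \<beta> _ r(2)])
        show "norm \<zeta>0 < 1" using \<zeta>0(1) by auto
        fix \<zeta> :: complex assume \<zeta>: "norm \<zeta> = r"
        then have "\<zeta> \<in> ?D" using r r1 by auto
        moreover have "v \<zeta> \<le> \<beta> * ln r" using *[OF \<zeta>] lnr by (simp add: neg_le_divide_eq)
        ultimately show "u (\<phi> \<zeta>) \<le> ereal (\<beta> * ln r)" by (simp add: v)
      qed
      then have "v \<zeta>0 \<le> \<beta> * ln (norm \<zeta>0)" using v[OF \<zeta>0(1)] by simp
      then show False using \<zeta>0(2) lnneg[OF \<zeta>0(1)] by (simp add: neg_divide_less_eq)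
    qed
  qed
qed

text \<open>Lifted by the exponential map, the circle of radius \<open>exp (- L)\<close> becomes a vertical line at distance
  \<open>L\<close> from the boundary of the half plane \<open>Re s < 0\<close>, and one turn around it has length \<open>2 * pi\<close>.  Harnack's constant for
  points so close together tends to 1 for \<open>L\<close> tending to infinity.\<close>
lemma log_split_Harnack:
  fixes u1 u2 :: "complex^'n \<Rightarrow> ereal" and \<phi> :: "complex \<Rightarrow> complex^'n" and v :: "complex \<Rightarrow> real"
  assumes u1: "u1 \<in> neg_psh_cone \<Omega>" and u2: "u2 \<in> neg_psh_cone \<Omega>" and \<Omega>: "open \<Omega>"
    and \<phi>: "\<And>i. (\<lambda>s. \<phi> s $ i) holomorphic_on (ball 0 1 - {0})" "\<phi> ` (ball 0 1 - {0}) \<subseteq> \<Omega>"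
    and v: "continuous_on (ball 0 1 - {0}) v"
      "\<And>\<zeta>. \<zeta> \<in> ball 0 1 - {0} \<Longrightarrow> u1 (\<phi> \<zeta>) = ereal (v \<zeta>)"
      "\<And>\<zeta>. \<zeta> \<in> ball 0 1 - {0} \<Longrightarrow> u2 (\<phi> \<zeta>) = ereal (ln (norm \<zeta>) - v \<zeta>)"
    and s: "Re s' = - L" "Re s'' = - L" "dist s' s'' \<le> 2 * pi" and L: "4 * pi < L"
  shows "- v (exp s'') \<le> (L / 2 + 2 * pi) / (L / 2 - 2 * pi) * (- v (exp s'))"
proof -
  let ?D = "ball 0 1 - {0::complex}"
  have Re_neg: "Re x < 0" if "x \<in> cball s' (L / 2)" for x
  proof -
    have "Re x - Re s' \<le> L / 2"
      using that abs_Re_le_cmod[of "x - s'"] by (auto simp: dist_norm norm_minus_commute)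
    then show ?thesis using s(1) L pi_gt_zero by linarith
  qed
  have eD: "exp x \<in> ?D" if "x \<in> cball s' (L / 2)" for x
    using Re_neg[OF that] by simp
  have ln_exp: "ln (norm (exp x)) = Re x" for x :: complex by simp
  define \<psi> where "\<psi> x = \<phi> (exp x)" for x
  have \<psi>hol: "(\<lambda>x. \<psi> x $ i) holomorphic_on cball s' (L / 2)" for i
    unfolding \<psi>_def
    by (rule holomorphic_on_compose_gen[OF _ \<phi>(1), unfolded o_def]) (use eD in \<open>auto intro!: holomorphic_intros\<close>)
  have \<psi>hol': "(\<lambda>x. \<psi> x $ i) holomorphic_on ball s' (L / 2)" for i
    using \<psi>hol by (rule holomorphic_on_subset) auto
  have \<psi>\<Omega>: "\<psi> ` cball s' (L / 2) \<subseteq> \<Omega>"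
    using eD \<phi>(2) unfolding \<psi>_def by blast
  have psh: "plurisubharmonic_on \<Omega> u1" "plurisubharmonic_on \<Omega> u2"
    using u1 u2 by (auto simp: neg_psh_cone_def)
  have nonneg: "0 \<le> - v (exp x)" if "x \<in> cball s' (L / 2)" for x
    using neg_psh_coneD(3)[OF u1, of "\<phi> (exp x)"] \<phi>(2) v(2)[OF eD[OF that]] eD[OF that]
    by (simp add: image_subset_iff)
  have le: "- v (exp s'') \<le> (L / 2 + dist s' s'') / (L / 2 - dist s' s'') * (- v (exp s'))"
  proof (rule Harnack_max_principle[where V = "\<lambda>x. - v (exp x)"])
    show "continuous_on (sphere s' (L / 2)) (\<lambda>x. - v (exp x))"
      by (intro continuous_intros continuous_on_compose2[OF v(1)]) (use eD in auto)
    show "0 \<le> - v (exp x)" if "x \<in> cball s' (L / 2)" for x by (rule nonneg[OF that])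
    show "s'' \<in> ball s' (L / 2)" using s L by simp
  next
    fix p z assume p: "p holomorphic_on UNIV" "\<And>x. x \<in> sphere s' (L / 2) \<Longrightarrow> - v (exp x) \<le> Re (p x)"
      and z: "z \<in> cball s' (L / 2)"
    have ph: "p holomorphic_on ball s' (L / 2)" "continuous_on (cball s' (L / 2)) p"
      using p(1) by (auto intro: holomorphic_on_subset holomorphic_on_imp_continuous_on continuous_on_subset)
    have "u2 (\<psi> z) \<le> ereal (Re (z + p z))"
    proof (rule psh_curve_max_principle[OF psh(2) \<Omega>, where K="cball s' (L / 2)" and U="ball s' (L / 2)"
          and \<phi>=\<psi> and H="\<lambda>x. Re (x + p x)"])
      show "continuous_on (cball s' (L / 2)) (\<lambda>x. Re (x + p x))" by (intro continuous_intros ph)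
      show "harmonic_on (ball s' (L / 2)) (\<lambda>x. Re (x + p x))"
        by (intro harmonic_on_Re holomorphic_intros ph) auto
      show "u2 (\<psi> x) \<le> ereal (Re (x + p x))" if x: "x \<in> cball s' (L / 2) - ball s' (L / 2)" for x
      proof -
        have "x \<in> sphere s' (L / 2)" "x \<in> cball s' (L / 2)" using x by auto
        then show ?thesis using p(2)[of x] v(3)[OF eD] by (simp add: \<psi>_def)
      qed
    qed (use z \<psi>hol' \<psi>\<Omega> continuous_on_components[OF \<psi>hol] in auto)
    then show "- v (exp z) \<le> Re (p z)" using v(3)[OF eD[OF z]] by (simp add: \<psi>_def)
  next
    fix p z assume p: "p holomorphic_on UNIV" "\<And>x. x \<in> sphere s' (L / 2) \<Longrightarrow> Re (p x) \<le> - v (exp x)"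
      and z: "z \<in> cball s' (L / 2)"
    have ph: "p holomorphic_on ball s' (L / 2)" "continuous_on (cball s' (L / 2)) p"
      using p(1) by (auto intro: holomorphic_on_subset holomorphic_on_imp_continuous_on continuous_on_subset)
    have "u1 (\<psi> z) \<le> ereal (Re (- p z))"
    proof (rule psh_curve_max_principle[OF psh(1) \<Omega>, where K="cball s' (L / 2)" and U="ball s' (L / 2)"
          and \<phi>=\<psi> and H="\<lambda>x. Re (- p x)"])
      show "continuous_on (cball s' (L / 2)) (\<lambda>x. Re (- p x))" by (intro continuous_intros ph)
      show "harmonic_on (ball s' (L / 2)) (\<lambda>x. Re (- p x))"
        by (intro harmonic_on_Re holomorphic_intros ph) auto
      show "u1 (\<psi> x) \<le> ereal (Re (- p x))" if x: "x \<in> cball s' (L / 2) - ball s' (L / 2)" for x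
      proof -
        have "x \<in> sphere s' (L / 2)" "x \<in> cball s' (L / 2)" using x by auto
        then show ?thesis using p(2)[of x] v(2)[OF eD] by (simp add: \<psi>_def)
      qed
    qed (use z \<psi>hol' \<psi>\<Omega> continuous_on_components[OF \<psi>hol] in auto)
    then show "Re (p z) \<le> - v (exp z)" using v(2)[OF eD[OF z]] by (simp add: \<psi>_def)
  qed
  also have "\<dots> \<le> (L / 2 + 2 * pi) / (L / 2 - 2 * pi) * (- v (exp s'))"
  proof (intro mult_right_mono frac_le)
    have "0 < L" using L pi_gt_zero by linarith
    then show "0 \<le> - v (exp s')" by (intro nonneg) simp
  qed (use s L pi_gt_zero in linarith)+
  finally show ?thesis .
qed

text \<open>A version of Bocher's theorem for two negative summands.  Let \<open>B1\<close> and \<open>B2\<close> be the infima of the quotients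
  of \<open>u1\<close> and \<open>u2\<close> by the logarithm.  The quotients add up to 1, hence \<open>B1 + B2 \<le> 1\<close>, and equality makes both
  quotients constant.  On small circles both quotients come close to their infima, perhaps at different points
  of the circle; by Harnack the quotient of \<open>u1\<close> is almost constant on such a circle, so \<open>B1 + B2 \<ge> 1\<close>.\<close>
proposition log_split:
  fixes u1 u2 :: "complex^'n \<Rightarrow> ereal" and \<phi> :: "complex \<Rightarrow> complex^'n"
  assumes u1: "u1 \<in> neg_psh_cone \<Omega>" and u2: "u2 \<in> neg_psh_cone \<Omega>" and \<Omega>: "open \<Omega>"
    and \<phi>: "\<And>i. (\<lambda>s. \<phi> s $ i) holomorphic_on (ball 0 1 - {0})" "\<phi> ` (ball 0 1 - {0}) \<subseteq> \<Omega>"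
    and sum: "\<And>\<zeta>. \<zeta> \<in> ball 0 1 - {0} \<Longrightarrow> u1 (\<phi> \<zeta>) + u2 (\<phi> \<zeta>) = ereal (ln (norm \<zeta>))"
  obtains B where "0 \<le> B" "B \<le> 1"
    "\<And>\<zeta>. \<zeta> \<in> ball 0 1 - {0} \<Longrightarrow> u1 (\<phi> \<zeta>) = ereal (B * ln (norm \<zeta>))"
    "\<And>\<zeta>. \<zeta> \<in> ball 0 1 - {0} \<Longrightarrow> u2 (\<phi> \<zeta>) = ereal ((1 - B) * ln (norm \<zeta>))"
proof -
  let ?D = "ball 0 1 - {0::complex}"
  have \<phi>c: "continuous_on ?D \<phi>" by (rule continuous_on_components[OF \<phi>(1)])
  have \<phi>\<Omega>: "\<phi> \<zeta> \<in> \<Omega>" if "\<zeta> \<in> ?D" for \<zeta> using \<phi>(2) that by blast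
  obtain v where v: "continuous_on ?D v" "\<And>\<zeta>. \<zeta> \<in> ?D \<Longrightarrow> u1 (\<phi> \<zeta>) = ereal (v \<zeta>)"
    "\<And>\<zeta>. \<zeta> \<in> ?D \<Longrightarrow> u2 (\<phi> \<zeta>) = ereal (ln (norm \<zeta>) - v \<zeta>)"
  proof (rule usc_sum_continuous[of ?D "\<lambda>\<zeta>. u1 (\<phi> \<zeta>)" "\<lambda>\<zeta>. u2 (\<phi> \<zeta>)" "\<lambda>\<zeta>. ln (norm \<zeta>)"])
    show "usc_on ?D (\<lambda>\<zeta>. u1 (\<phi> \<zeta>))" "usc_on ?D (\<lambda>\<zeta>. u2 (\<phi> \<zeta>))"
      using u1 u2 by (auto intro!: usc_on_compose[OF _ \<phi>c \<phi>(2)] simp: neg_psh_cone_def plurisubharmonic_on_def)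
    show "u1 (\<phi> \<zeta>) < \<infinity>" "u2 (\<phi> \<zeta>) < \<infinity>" if "\<zeta> \<in> ?D" for \<zeta>
      using u1 u2 \<phi>\<Omega>[OF that] by (auto simp: neg_psh_cone_def plurisubharmonic_on_def)
    show "continuous_on ?D (\<lambda>\<zeta>. ln (norm \<zeta>))" by (intro continuous_intros) auto
    show "u1 (\<phi> \<zeta>) + u2 (\<phi> \<zeta>) = ereal (ln (norm \<zeta>))" if "\<zeta> \<in> ?D" for \<zeta> by (rule sum[OF that])
  qed blast
  define w where "w \<zeta> = ln (norm \<zeta>) - v \<zeta>" for \<zeta>
  have w: "u2 (\<phi> \<zeta>) = ereal (w \<zeta>)" if "\<zeta> \<in> ?D" for \<zeta> using v(3)[OF that] by (simp add: w_def)
  have lnneg: "ln (norm \<zeta>) < 0" if "\<zeta> \<in> ?D" for \<zeta> using that by simp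
  have neg: "v \<zeta> \<le> 0" "w \<zeta> \<le> 0" if "\<zeta> \<in> ?D" for \<zeta>
    using neg_psh_coneD(3)[OF u1 \<phi>\<Omega>[OF that]] neg_psh_coneD(3)[OF u2 \<phi>\<Omega>[OF that]]
      v(2)[OF that] w[OF that] by simp_all
  have ratio: "0 \<le> v \<zeta> / ln (norm \<zeta>)" "0 \<le> w \<zeta> / ln (norm \<zeta>)"
      "v \<zeta> / ln (norm \<zeta>) + w \<zeta> / ln (norm \<zeta>) = 1" if "\<zeta> \<in> ?D" for \<zeta>
    using neg[OF that] lnneg[OF that]
    by (auto simp: divide_nonpos_neg w_def add_divide_distrib[symmetric])
  define B1 where "B1 = (INF \<zeta>\<in>?D. v \<zeta> / ln (norm \<zeta>))"
  define B2 where "B2 = (INF \<zeta>\<in>?D. w \<zeta> / ln (norm \<zeta>))"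
  have half: "1/2 \<in> ?D" by simp
  then have ne: "?D \<noteq> {}" by blast
  have bdd: "bdd_below ((\<lambda>\<zeta>. v \<zeta> / ln (norm \<zeta>)) ` ?D)" "bdd_below ((\<lambda>\<zeta>. w \<zeta> / ln (norm \<zeta>)) ` ?D)"
    by (rule bdd_belowI2[OF ratio(1)], assumption, rule bdd_belowI2[OF ratio(2)], assumption)
  have B1le: "B1 \<le> v \<zeta> / ln (norm \<zeta>)" and B2le: "B2 \<le> w \<zeta> / ln (norm \<zeta>)" if "\<zeta> \<in> ?D" for \<zeta>
    unfolding B1_def B2_def using that bdd by (auto intro: cINF_lower)
  have B0: "0 \<le> B1" "0 \<le> B2"
    unfolding B1_def B2_def
    by (rule cINF_greatest[OF ne ratio(1)], assumption, rule cINF_greatest[OF ne ratio(2)], assumption)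
  have B11: "B1 \<le> 1" using B1le[OF half] ratio[OF half] by linarith
  have "1 \<le> B1 + B2"
  proof (rule field_le_epsilon)
    fix e :: real assume "0 < e"
    define e' where "e' = min 1 (e / 4)"
    have e': "0 < e'" "e' \<le> 1" "4 * e' \<le> e" using \<open>0 < e\<close> by (auto simp: e'_def)
    obtain r1 where r1: "0 < r1" "r1 < 1"
      "\<And>r. 0 < r \<Longrightarrow> r \<le> r1 \<Longrightarrow> \<exists>\<zeta>. norm \<zeta> = r \<and> v \<zeta> / ln r < B1 + e'"
      using log_ratio_small_circles[OF u1 \<Omega> \<phi> v(2), of "B1 + e'"] e'(1) unfolding B1_def by auto
    obtain r2 where r2: "0 < r2" "r2 < 1"
      "\<And>r. 0 < r \<Longrightarrow> r \<le> r2 \<Longrightarrow> \<exists>\<zeta>. norm \<zeta> = r \<and> w \<zeta> / ln r < B2 + e'"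
      using log_ratio_small_circles[OF u2 \<Omega> \<phi> w, of "B2 + e'"] e'(1) unfolding B2_def by auto
    define L where "L = Max {- ln r1, - ln r2, 12 * pi / e'}"
    have L: "- ln r1 \<le> L" "- ln r2 \<le> L" "12 * pi / e' \<le> L" by (auto simp: L_def)
    have e'L: "12 * pi \<le> e' * L" using L(3) e'(1) by (simp add: pos_divide_le_eq mult.commute)
    also have "\<dots> \<le> 1 * L"
    proof (rule mult_right_mono)
      show "0 \<le> L" using L(1) r1(1,2) by (smt (verit) ln_le_zero_iff)
    qed (use e' in auto)
    finally have L4: "4 * pi < L" using pi_gt_zero by linarith
    define r where "r = exp (- L)"
    have "ln r = - L" "0 < r" by (auto simp: r_def)
    have "r \<le> r1" "r \<le> r2"
      using L(1,2) r1(1) r2(1) unfolding r_def by (metis exp_le_cancel_iff exp_ln minus_le_iff)+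
    then obtain \<zeta>' \<zeta>'' where z: "norm \<zeta>' = r" "v \<zeta>' / ln r < B1 + e'" "norm \<zeta>'' = r" "w \<zeta>'' / ln r < B2 + e'"
      using r1(3) r2(3) \<open>0 < r\<close> by metis
    have nz: "\<zeta>' \<noteq> 0" "\<zeta>'' \<noteq> 0" using z \<open>0 < r\<close> by auto
    have "r < 1" using \<open>r \<le> r1\<close> r1(2) by simp
    then have D'': "\<zeta>'' \<in> ?D" and D': "\<zeta>' \<in> ?D" using z nz by simp_all
    have Re: "Re (Ln \<zeta>') = - L" "Re (Ln \<zeta>'') = - L" using z nz \<open>ln r = - L\<close> by auto
    have "dist (Ln \<zeta>') (Ln \<zeta>'') \<le> 2 * pi"
    proof -
      have "Re (Ln \<zeta>' - Ln \<zeta>'') = 0" using Re by simp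
      then have "norm (Ln \<zeta>' - Ln \<zeta>'') = \<bar>Im (Ln \<zeta>' - Ln \<zeta>'')\<bar>" by (simp add: cmod_def)
      then show ?thesis
        using mpi_less_Im_Ln[of \<zeta>'] mpi_less_Im_Ln[of \<zeta>''] Im_Ln_le_pi[of \<zeta>'] Im_Ln_le_pi[of \<zeta>''] nz
        by (simp add: dist_norm)
    qed
    from log_split_Harnack[OF u1 u2 \<Omega> \<phi> v Re this L4]
    have H: "- v \<zeta>'' \<le> (L / 2 + 2 * pi) / (L / 2 - 2 * pi) * (- v \<zeta>')" using nz by simp
    have "(L / 2 + 2 * pi) \<le> (1 + e') * (L / 2 - 2 * pi)"
    proof -
      have "e' * pi \<le> 1 * pi" using e' by (intro mult_right_mono) auto
      moreover have "(1 + e') * (L / 2 - 2 * pi) = L / 2 - 2 * pi + (e' * L) / 2 - 2 * (e' * pi)"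
        by (simp add: algebra_simps)
      ultimately show ?thesis using e'L by linarith
    qed
    then have "(L / 2 + 2 * pi) / (L / 2 - 2 * pi) \<le> 1 + e'"
      using L4 by (simp add: pos_divide_le_eq)
    then have "(L / 2 + 2 * pi) / (L / 2 - 2 * pi) * (- v \<zeta>') \<le> (1 + e') * (- v \<zeta>')"
      using neg(1)[OF D'] by (intro mult_right_mono) auto
    with H have "- v \<zeta>'' \<le> (1 + e') * (- v \<zeta>')" by linarith
    then have "- v \<zeta>'' / L \<le> (1 + e') * (- v \<zeta>') / L"
      using L4 pi_gt_zero by (intro divide_right_mono) linarith+
    then have "v \<zeta>'' / ln r \<le> (1 + e') * (v \<zeta>' / ln r)" by (simp add: \<open>ln r = - L\<close>)
    also have "\<dots> \<le> (1 + e') * (B1 + e')" using z(2) e' by (intro mult_left_mono) auto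
    finally have "v \<zeta>'' / ln r \<le> (1 + e') * (B1 + e')" .
    moreover have "v \<zeta>'' / ln r + w \<zeta>'' / ln r = 1" using ratio(3)[OF D''] z by simp
    ultimately have "1 \<le> (1 + e') * (B1 + e') + (B2 + e')" using z(4) by linarith
    also have "\<dots> = B1 + B2 + 2 * e' + e' * B1 + e' * e'" by (simp add: algebra_simps)
    also have "\<dots> \<le> B1 + B2 + 2 * e' + e' * 1 + e' * 1"
      using e' B11 by (intro add_mono mult_left_mono) auto
    finally show "1 \<le> B1 + B2 + e" using e'(3) by linarith
  qed
  then have eq: "v \<zeta> / ln (norm \<zeta>) = B1" if "\<zeta> \<in> ?D" for \<zeta>
    using B1le[OF that] B2le[OF that] ratio(3)[OF that] by linarith
  show ?thesis
  proof (rule that[of B1])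
    show "u1 (\<phi> \<zeta>) = ereal (B1 * ln (norm \<zeta>))" if "\<zeta> \<in> ?D" for \<zeta>
      using eq[OF that] v(2)[OF that] lnneg[OF that] by (simp add: field_simps)
    show "u2 (\<phi> \<zeta>) = ereal ((1 - B1) * ln (norm \<zeta>))" if "\<zeta> \<in> ?D" for \<zeta>
      using eq[OF that] v(3)[OF that] lnneg[OF that] by (simp add: field_simps)
  qed (use B0 B11 in auto)
qed

section \<open>Blaschke products and the bidisc\<close>

abbreviation moebius :: "complex \<Rightarrow> complex \<Rightarrow> complex" where
  "moebius \<equiv> Moebius_function 0"

definition blaschke_prod :: "(nat \<Rightarrow> complex) \<Rightarrow> nat set \<Rightarrow> complex \<Rightarrow> complex" where
  "blaschke_prod a I s = (\<Prod>i\<in>I. moebius (a i) s)"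

lemma T_moebius: "T b s = elog (norm (moebius b s))"
  by (simp add: T_def Moebius_function_simple)

lemma moebius_denominator:
  assumes "norm b < 1" "norm s \<le> 1"
  shows "1 - norm b \<le> norm (1 - cnj b * s)" "norm (1 - cnj b * s) \<le> 2" "1 - cnj b * s \<noteq> 0"
proof -
  have "norm (cnj b * s) \<le> norm b * 1"
    unfolding norm_mult complex_mod_cnj using assms(2) by (rule mult_left_mono) simp
  moreover have "norm (1::complex) - norm (cnj b * s) \<le> norm (1 - cnj b * s)"
    by (rule norm_triangle_ineq2)
  moreover have "norm (1 - cnj b * s) \<le> norm (1::complex) + norm (cnj b * s)"
    by (rule norm_triangle_ineq4)
  ultimately show *: "1 - norm b \<le> norm (1 - cnj b * s)" "norm (1 - cnj b * s) \<le> 2"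
    using assms(1) by auto
  then show "1 - cnj b * s \<noteq> 0" using assms(1) by auto
qed

lemma moebius_eq_0_iff:
  assumes "norm b < 1" "norm s \<le> 1"
  shows "moebius b s = 0 \<longleftrightarrow> s = b"
  using moebius_denominator[OF assms] by (simp add: Moebius_function_simple)

lemma norm_moebius_le:
  assumes "norm b < 1" "norm s \<le> 1"
  shows "norm (moebius b s) \<le> norm (s - b) / (1 - norm b)"
  using moebius_denominator[OF assms] assms(1)
  by (auto simp: Moebius_function_simple norm_divide intro!: frac_le)

lemma norm_moebius_ge:
  assumes "norm b < 1" "norm s \<le> 1"
  shows "norm (s - b) / 2 \<le> norm (moebius b s)"
  using moebius_denominator[OF assms] unfolding Moebius_function_simple norm_divide
  by (intro frac_le) auto

text \<open>On the unit circle \<open>1 - cnj b * s = s * cnj (s - b)\<close>.\<close>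
lemma norm_moebius_sphere:
  assumes "norm b < 1" "norm s = 1"
  shows "norm (moebius b s) = 1"
proof -
  have "s * cnj s = 1" using complex_norm_square[of s] assms(2) by simp
  then have "1 - cnj b * s = s * cnj (s - b)" by (simp add: algebra_simps)
  then have "norm (1 - cnj b * s) = norm (s - b)"
    by (simp only: norm_mult complex_mod_cnj assms(2) mult_1)
  then show ?thesis
    using moebius_denominator(3)[OF assms(1), of s] assms(2)
    by (auto simp: Moebius_function_simple norm_divide)
qed

lemma continuous_on_moebius:
  assumes "norm b < 1"
  shows "continuous_on (cball 0 1) (moebius b)"
  unfolding Moebius_function_simple
  using moebius_denominator(3)[OF assms] by (intro continuous_intros) auto

lemma norm_moebius_le_1:
  assumes "norm b < 1" "norm s \<le> 1"
  shows "norm (moebius b s) \<le> 1"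
  using Moebius_function_norm_lt_1[OF assms(1), of s] norm_moebius_sphere[OF assms(1), of s] assms(2)
  by (cases "norm s = 1") (auto simp: less_le)

context
  fixes a :: "nat \<Rightarrow> complex" and I :: "nat set"
  assumes fin: "finite I" and a: "\<And>i. i \<in> I \<Longrightarrow> norm (a i) < 1"
begin

lemma blaschke_prod_holomorphic: "blaschke_prod a I holomorphic_on ball 0 1"
  unfolding blaschke_prod_def using a by (intro holomorphic_on_prod Moebius_function_holomorphic)

lemma continuous_on_blaschke_prod: "continuous_on (cball 0 1) (blaschke_prod a I)"
  unfolding blaschke_prod_def using a by (intro continuous_on_prod continuous_on_moebius)

lemma norm_blaschke_prod_le_1: "norm s \<le> 1 \<Longrightarrow> norm (blaschke_prod a I s) \<le> 1"
  unfolding blaschke_prod_def prod_norm[symmetric] using a by (intro prod_le_1) (auto simp: norm_moebius_le_1)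

lemma norm_blaschke_prod_sphere: "norm s = 1 \<Longrightarrow> norm (blaschke_prod a I s) = 1"
  unfolding blaschke_prod_def prod_norm[symmetric] using a by (simp add: norm_moebius_sphere)

lemma norm_blaschke_prod_le:
  assumes "i \<in> I" "norm s \<le> 1"
  shows "norm (blaschke_prod a I s) \<le> norm (moebius (a i) s)"
proof -
  have "norm (blaschke_prod a I s) = norm (moebius (a i) s) * (\<Prod>j\<in>I - {i}. norm (moebius (a j) s))"
    unfolding blaschke_prod_def prod_norm[symmetric] using fin assms(1) by (rule prod.remove)
  also have "\<dots> \<le> norm (moebius (a i) s) * 1"
    using a assms(2) by (intro mult_left_mono prod_le_1) (auto simp: norm_moebius_le_1)
  finally show ?thesis by simp
qed

lemma norm_blaschke_prod_less_1:
  assumes "I \<noteq> {}" "norm s < 1"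
  shows "norm (blaschke_prod a I s) < 1"
proof -
  obtain i where "i \<in> I" using assms(1) by blast
  then show ?thesis
    using norm_blaschke_prod_le[of i s] Moebius_function_norm_lt_1[OF a, of i s 0] assms(2) by force
qed

lemma elog_blaschke_prod: "elog (norm (blaschke_prod a I s)) = (\<Sum>i\<in>I. T (a i) s)"
proof -
  have "elog (norm (blaschke_prod a J s)) = (\<Sum>i\<in>J. T (a i) s)" if "finite J" for J
    using that
    by induction (auto simp: blaschke_prod_def T_moebius norm_mult elog_mult prod_norm[symmetric] prod_nonneg elog_def[of 1])
  then show ?thesis using fin .
qed

lemma ln_blaschke_prod:
  assumes "blaschke_prod a I s \<noteq> 0"
  shows "ln (norm (blaschke_prod a I s)) = (\<Sum>i\<in>I. ln (norm (moebius (a i) s)))"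
proof -
  have "(\<Sum>i\<in>I. ln (norm (moebius (a i) s))) = ln (\<Prod>i\<in>I. norm (moebius (a i) s))"
    using assms fin by (intro ln_prod[symmetric]) (auto simp: blaschke_prod_def)
  then show ?thesis by (simp add: blaschke_prod_def prod_norm)
qed

text \<open>The set where the modulus is at most \<open>d\<close> is compact and does not meet the unit circle.\<close>
lemma blaschke_prod_near_sphere:
  assumes "d < 1"
  obtains \<rho> where "\<rho> < 1" "\<And>s. \<rho> < norm s \<Longrightarrow> norm s \<le> 1 \<Longrightarrow> d < norm (blaschke_prod a I s)"
proof -
  define K where "K = {s\<in>cball 0 1. norm (blaschke_prod a I s) \<in> {..d}}"
  have "closed K"
    unfolding K_def
    using continuous_closed_preimage[of "cball 0 1" "\<lambda>s. norm (blaschke_prod a I s)" "{..d}"]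
      continuous_on_norm[OF continuous_on_blaschke_prod]
    by (simp add: vimage_def Int_def)
  then have K: "compact K" unfolding compact_eq_bounded_closed
    by (auto intro: bounded_subset[of "cball 0 1"] simp: K_def)
  show ?thesis
  proof (cases "K = {}")
    case True
    then show ?thesis using that[of 0] by (force simp: K_def not_le)
  next
    case False
    obtain s0 where s0: "s0 \<in> K" "\<And>s. s \<in> K \<Longrightarrow> norm s \<le> norm s0"
      using continuous_attains_sup[OF K False, of norm] by (auto intro: continuous_intros)
    have "norm s0 < 1"
      using s0(1) norm_blaschke_prod_sphere[of s0] assms by (cases "norm s0 = 1") (auto simp: K_def)
    then show ?thesis
      using that[of "norm s0"] s0(2) by (force simp: K_def not_le)
  qed
qed

end

lemma mem_bidisc [simp]: "z \<in> bidisc \<longleftrightarrow> norm (z $ 1) < 1 \<and> norm (z $ 2) < 1"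
  by (simp add: bidisc_def)

lemma open_bidisc: "open bidisc"
proof -
  have "open {z::complex^2. norm (z $ 1) < 1}" "open {z::complex^2. norm (z $ 2) < 1}"
    by (intro open_Collect_less continuous_intros)+
  then have "open ({z::complex^2. norm (z $ 1) < 1} \<inter> {z. norm (z $ 2) < 1})" by (rule open_Int)
  also have "{z::complex^2. norm (z $ 1) < 1} \<inter> {z. norm (z $ 2) < 1} = bidisc" by auto
  finally show ?thesis .
qed

lemma vector_2_eta: "vector [z $ 1, z $ 2] = (z :: 'a::zero^2)"
  by (simp add: vec_eq_iff forall_2)

lemma holomorphic_on_vector_2:
  assumes "f holomorphic_on S" "g holomorphic_on S"
  shows "(\<lambda>s. (vector [f s, g s] :: complex^2) $ i) holomorphic_on S"
  using assms exhaust_2[of i] by (auto cong: holomorphic_cong)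

lemma continuous_on_vector_2:
  fixes f g :: "'a::topological_space \<Rightarrow> complex"
  assumes "continuous_on S f" "continuous_on S g"
  shows "continuous_on S (\<lambda>s. vector [f s, g s] :: complex^2)"
proof -
  have "continuous_on S (\<lambda>s. \<chi> i. (vector [f s, g s] :: complex^2) $ i)"
  proof (rule continuous_on_vec_lambda)
    fix i :: 2
    show "continuous_on S (\<lambda>s. (vector [f s, g s] :: complex^2) $ i)"
      using assms exhaust_2[of i] by auto
  qed
  then show ?thesis by simp
qed

lemma norm_vec2_le: "norm (z :: complex^2) \<le> norm (z $ 1) + norm (z $ 2)"
  unfolding norm_vec_def using L2_set_le_sum[of UNIV "\<lambda>i. norm (z $ i)"] by (simp add: UNIV_2)

section \<open>Upper bounds along analytic discs through the poles\<close>

definition log_pole :: "(complex^'n \<Rightarrow> ereal) \<Rightarrow> complex^'n \<Rightarrow> real \<Rightarrow> bool" where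
  "log_pole u w \<nu> \<longleftrightarrow> (\<exists>C. \<forall>\<^sub>F s in at w. u s \<le> ereal (\<nu> * ln (norm (s - w)) + C))"

lemma green_function_log_pole:
  "green_function \<Omega> k w \<nu> z =
     (SUP u \<in> {u \<in> neg_psh_cone \<Omega>. \<forall>j\<in>{1..k}. log_pole u (w j) (\<nu> j)}. u z)"
proof -
  have "x - ereal y \<le> ereal C \<longleftrightarrow> x \<le> ereal (y + C)" for x y C
    by (cases x) auto
  then show ?thesis
    unfolding green_function_def log_pole_def by simp
qed

text \<open>The pole condition says nothing about the value at the pole itself; the maximum principle on small
  discs around it does.\<close>
lemma log_pole_value:
  assumes u: "u \<in> neg_psh_cone bidisc" and b: "norm b < 1" and pole: "log_pole u (vector [b, 0]) \<nu>" and \<nu>: "0 < \<nu>"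
  shows "u (vector [b, 0]) = -\<infinity>"
proof -
  let ?w = "vector [b, 0] :: complex^2"
  obtain C d where d: "d > 0" "\<And>z. z \<noteq> ?w \<Longrightarrow> dist z ?w < d \<Longrightarrow> u z \<le> ereal (\<nu> * ln (norm (z - ?w)) + C)"
    using pole unfolding log_pole_def eventually_at by auto
  have "u ?w \<le> ereal M" for M
  proof -
    define \<sigma> where "\<sigma> = min (min (d / 2) ((1 - norm b) / 2)) (exp ((M - C) / \<nu>))"
    have \<sigma>: "0 < \<sigma>" "\<sigma> < d" "\<sigma> < 1 - norm b" "\<sigma> \<le> exp ((M - C) / \<nu>)"
      using d(1) b by (auto simp: \<sigma>_def min_def)
    have "u (vector [b, 0]) \<le> ereal M"
    proof (rule psh_curve_max_principle[OF neg_psh_coneD(1)[OF u] open_bidisc, where K="cball b \<sigma>" and U="ball b \<sigma>"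
          and \<phi>="\<lambda>s. vector [s, 0]" and H="\<lambda>_. M"])
      show "(\<lambda>s. vector [s, 0]) ` cball b \<sigma> \<subseteq> bidisc"
      proof (intro image_subsetI)
        fix s assume "s \<in> cball b \<sigma>"
        then have "norm (s - b) \<le> \<sigma>" by (simp add: dist_norm norm_minus_commute)
        then have "norm s < 1" using norm_triangle_ineq2[of s b] \<sigma>(3) by linarith
        then show "vector [s, 0] \<in> bidisc" by simp
      qed
      show "u (vector [s, 0]) \<le> ereal M" if "s \<in> cball b \<sigma> - ball b \<sigma>" for s
      proof -
        have n: "norm (s - b) = \<sigma>" using that by (simp add: dist_norm norm_minus_commute)
        have eq: "(vector [s, 0] - ?w) $ 1 = s - b" "(vector [s, 0] - ?w) $ 2 = 0" by auto
        have le: "norm (vector [s, 0] - ?w) \<le> \<sigma>"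
          using norm_vec2_le[of "vector [s, 0] - ?w"] n unfolding eq by simp
        have ge: "norm (vector [s, 0] - ?w) \<ge> \<sigma>"
          using Finite_Cartesian_Product.norm_nth_le[of "vector [s, 0] - ?w" 1] n unfolding eq by simp
        have norm_eq: "norm (vector [s, 0] - ?w) = \<sigma>" using le ge by simp
        have "u (vector [s, 0]) \<le> ereal (\<nu> * ln \<sigma> + C)"
          using d(2)[of "vector [s, 0]"] norm_eq \<sigma> by (auto simp: dist_norm)
        also have "\<nu> * ln \<sigma> + C \<le> M"
        proof -
          have "ln \<sigma> \<le> (M - C) / \<nu>" using \<sigma>(1,4) by (metis ln_exp ln_le_cancel_iff exp_gt_zero)
          then show ?thesis using \<nu> by (simp add: pos_le_divide_eq mult.commute)
        qed
        finally show ?thesis by simp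
      qed
    qed (use \<sigma> in \<open>auto intro!: continuous_on_vector_2 holomorphic_on_vector_2 continuous_intros holomorphic_intros harmonic_on_const\<close>)
    then show ?thesis .
  qed
  then show ?thesis by (rule ereal_bot)
qed

text \<open>The disc \<open>s \<mapsto> (s, c * F s)\<close>, with \<open>F\<close> the Blaschke product and \<open>c\<close> chosen so that it meets \<open>z\<close>, stays in the
  bidisc and passes through all the poles \<open>(a i, 0)\<close>.  Along it \<open>u\<close> is negative with logarithmic poles, hence below the
  one variable Green function \<open>S\<close>.  For the comparison \<open>S\<close> is replaced by \<open>(1 - \<eta>) * S + \<eta>\<close>: near the poles the factor
  \<open>1 - \<eta>\<close> absorbs the constants of the pole conditions, and near the unit circle the summand \<open>\<eta>\<close> makes the majorant
  nonnegative.  The singularities of \<open>S\<close> are the poles with index in \<open>J\<close>, those of positive weight; small discs around them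
  are cut out.\<close>
lemma disc_bound:
  assumes u: "u \<in> neg_psh_cone bidisc" and fin: "finite I" and a: "\<And>i. i \<in> I \<Longrightarrow> norm (a i) < 1" and inj: "inj_on a I"
    and \<nu>: "\<And>i. i \<in> I \<Longrightarrow> 0 \<le> \<nu> i" and pole: "\<And>i. i \<in> I \<Longrightarrow> log_pole u (vector [a i, 0]) (\<nu> i)"
    and z: "z \<in> bidisc" "norm (z $ 2) \<le> norm (blaschke_prod a I (z $ 1))"
  shows "u z \<le> (\<Sum>i\<in>I. ereal (\<nu> i) * T (a i) (z $ 1))"
proof -
  let ?F = "blaschke_prod a I"
  define J where "J = {i\<in>I. 0 < \<nu> i}"
  have J: "finite J" "J \<subseteq> I" "\<And>i. i \<in> J \<Longrightarrow> 0 < \<nu> i" using fin by (auto simp: J_def)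
  have z1: "norm (z $ 1) < 1" using z by simp
  have rhs: "(\<Sum>i\<in>I. ereal (\<nu> i) * T (a i) (z $ 1)) = (\<Sum>i\<in>J. ereal (\<nu> i) * T (a i) (z $ 1))"
  proof (rule sum.mono_neutral_right[OF fin J(2)])
    show "\<forall>i\<in>I - J. ereal (\<nu> i) * T (a i) (z $ 1) = 0"
    proof
      fix i assume "i \<in> I - J"
      then have "\<nu> i = 0" using \<nu>[of i] by (auto simp: J_def)
      then show "ereal (\<nu> i) * T (a i) (z $ 1) = 0" by (simp add: zero_ereal_def[symmetric])
    qed
  qed
  consider "J = {}" | i where "i \<in> J" "z $ 1 = a i" | "J \<noteq> {}" "\<forall>i\<in>J. z $ 1 \<noteq> a i"
    by blast
  then show ?thesis
  proof cases
    case 1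
    then show ?thesis using neg_psh_coneD(3)[OF u z(1)] rhs by simp
  next
    case i: (2 i)
    then have iI: "i \<in> I" using J by auto
    have "norm (?F (z $ 1)) \<le> 0"
      using norm_blaschke_prod_le[where a=a, OF fin a iI, where s="z $ 1"] i(2) z1 by (simp add: Moebius_function_eq_zero)
    then have "z $ 2 = 0" using z(2) by simp
    then have "z = vector [a i, 0]" using i(2) vector_2_eta[of z] by simp
    then have "u z = -\<infinity>" using log_pole_value[OF u a[OF iI] pole[OF iI] J(3)[OF i(1)]] by simp
    then show ?thesis by simp
  next
    case ne: 3
    then have I_ne: "I \<noteq> {}" using J(2) by auto
    define S where "S s = (\<Sum>i\<in>J. \<nu> i * ln (norm (moebius (a i) s)))" for s
    have mz: "moebius (a i) s \<noteq> 0" if "i \<in> J" "norm s \<le> 1" "s \<noteq> a i" for i s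
      using that a J(2) by (subst moebius_eq_0_iff) auto
    have Sz: "(\<Sum>i\<in>J. ereal (\<nu> i) * T (a i) (z $ 1)) = ereal (S (z $ 1))"
      unfolding S_def sum_ereal[symmetric]
      using ne(2) mz z1 by (intro sum.cong) (auto simp: T_moebius elog_def)
    define c where "c = (if ?F (z $ 1) = 0 then 0 else z $ 2 / ?F (z $ 1))"
    have c1: "norm c \<le> 1" using z(2) by (simp add: c_def norm_divide)
    have cF: "c * ?F (z $ 1) = z $ 2" using z(2) by (auto simp: c_def)
    define \<phi> :: "complex \<Rightarrow> complex^2" where "\<phi> s = vector [s, c * ?F s]" for s
    have \<phi>z: "\<phi> (z $ 1) = z" using cF vector_2_eta[of z] by (simp add: \<phi>_def)
    have \<phi>bi: "\<phi> s \<in> bidisc" if "norm s < 1" for s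
    proof -
      have "norm c * norm (?F s) \<le> 1 * norm (?F s)" using c1 by (intro mult_right_mono) auto
      then show ?thesis
        using norm_blaschke_prod_less_1[where a=a, OF fin a I_ne that] that by (simp add: \<phi>_def norm_mult)
    qed
    have Fhol: "?F holomorphic_on ball 0 1" by (rule blaschke_prod_holomorphic[where a=a, OF fin a])
    have \<phi>hol: "(\<lambda>s. \<phi> s $ i) holomorphic_on ball 0 1" for i
      unfolding \<phi>_def by (intro holomorphic_on_vector_2 holomorphic_intros Fhol)
    have bound: "u z \<le> ereal ((1 - \<eta>) * S (z $ 1) + \<eta>)" if \<eta>: "0 < \<eta>" "\<eta> < 1" for \<eta>
    proof -
      define H where "H s = (1 - \<eta>) * S s + \<eta>" for s
      define \<Lambda> where "\<Lambda> = sum \<nu> J"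
      have \<Lambda>: "0 < \<Lambda>" unfolding \<Lambda>_def using J ne(1) by (intro sum_pos) auto
      have \<nu>\<Lambda>: "\<nu> i \<le> \<Lambda>" if "i \<in> J" for i
        unfolding \<Lambda>_def using J that by (intro member_le_sum) (auto simp: less_imp_le)
      obtain \<rho>0 where \<rho>0: "\<rho>0 < 1" "\<And>s. \<rho>0 < norm s \<Longrightarrow> norm s \<le> 1 \<Longrightarrow> exp (- \<eta> / \<Lambda>) < norm (?F s)"
        using blaschke_prod_near_sphere[where a=a, OF fin a, of "exp (- \<eta> / \<Lambda>)"] \<eta> \<Lambda> by auto
      obtain \<rho> where \<rho>: "max \<rho>0 (norm (z $ 1)) < \<rho>" "\<rho> < 1" using \<rho>0(1) z1 dense[of "max \<rho>0 (norm (z $ 1))" 1] by auto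
      have outer: "0 \<le> H s" if "norm s = \<rho>" for s
      proof -
        have F: "exp (- \<eta> / \<Lambda>) < norm (?F s)" using \<rho>0(2)[of s] that \<rho> by simp
        then have nz: "?F s \<noteq> 0" using exp_gt_zero[of "- \<eta> / \<Lambda>"] by auto
        then have nz': "moebius (a i) s \<noteq> 0" if "i \<in> I" for i
          using that fin by (auto simp: blaschke_prod_def)
        have ln0: "ln (norm (moebius (a i) s)) \<le> 0" if "i \<in> I" for i
          using norm_moebius_le_1[OF a[OF that], of s] nz'[OF that] \<open>norm s = \<rho>\<close> \<rho> by (simp add: ln_le_zero_iff)
        have "- \<eta> / \<Lambda> \<le> ln (norm (?F s))"
          using F nz by (metis exp_gt_zero less_imp_le ln_exp ln_le_cancel_iff zero_less_norm_iff)
        also have "\<dots> = (\<Sum>i\<in>I. ln (norm (moebius (a i) s)))" by (rule ln_blaschke_prod[where a=a, OF fin a nz])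
        also have "\<dots> \<le> (\<Sum>i\<in>J. ln (norm (moebius (a i) s)))"
          by (subst sum.subset_diff[OF J(2) fin]) (use ln0 in \<open>auto intro!: sum_nonpos\<close>)
        finally have "- \<eta> \<le> \<Lambda> * (\<Sum>i\<in>J. ln (norm (moebius (a i) s)))"
          using \<Lambda> by (simp only: pos_divide_le_eq mult.commute[of \<Lambda>])
        also have "\<dots> \<le> S s"
          unfolding S_def sum_distrib_left using \<nu>\<Lambda> ln0 J(2) by (intro sum_mono mult_right_mono_neg) auto
        finally have "(1 - \<eta>) * (- \<eta>) \<le> (1 - \<eta>) * S s" using \<eta> by (intro mult_left_mono) auto
        moreover have "(1 - \<eta>) * (- \<eta>) + \<eta> \<ge> 0" using \<eta> by (simp add: algebra_simps)
        ultimately show ?thesis by (simp add: H_def)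
      qed
      have inner: "\<forall>\<^sub>F s in at (a i). u (\<phi> s) \<le> ereal (H s)" if i: "i \<in> J" for i
      proof -
        have iI: "i \<in> I" and \<nu>i: "0 < \<nu> i" and ai: "norm (a i) < 1" using i J a by auto
        let ?w = "vector [a i, 0] :: complex^2"
        obtain C where C: "\<forall>\<^sub>F x in at ?w. u x \<le> ereal (\<nu> i * ln (norm (x - ?w)) + C)"
          using pole[OF iI] unfolding log_pole_def by blast
        have F0: "?F (a i) = 0"
          unfolding blaschke_prod_def by (rule prod_zero[OF fin bexI[OF Moebius_function_eq_zero iI]])
        have "isCont \<phi> (a i)"
          using continuous_on_components[OF \<phi>hol] ai by (simp add: continuous_on_eq_continuous_at)
        then have "filterlim \<phi> (at ?w) (at (a i))"
          unfolding filterlim_at using F0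
          by (auto simp: isCont_def \<phi>_def eventually_at_filter vec_eq_iff forall_2)
        then have E1: "\<forall>\<^sub>F s in at (a i). u (\<phi> s) \<le> ereal (\<nu> i * ln (norm (\<phi> s - ?w)) + C)"
          using C by (auto simp: filterlim_iff)
        define R where "R s = (\<Sum>j\<in>J - {i}. \<nu> j * ln (norm (moebius (a j) s)))" for s
        have "isCont R (a i)"
        proof -
          have "isCont (moebius (a j)) (a i)" if "j \<in> J" for j
            using Moebius_function_holomorphic[OF a, of j 0] that J(2) ai
            by (auto intro!: continuous_on_interior holomorphic_on_imp_continuous_on simp: interior_open)
          moreover have "moebius (a j) (a i) \<noteq> 0" if "j \<in> J - {i}" for j
            using that ai inj i J(2) by (intro mz) (auto dest: inj_onD)
          ultimately show ?thesis unfolding R_def by (intro continuous_intros) auto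
        qed
        then have E2: "\<forall>\<^sub>F s in at (a i). R (a i) - 1 < R s"
          unfolding isCont_def by (rule order_tendstoD) simp
        define A where "A = 1 + 1 / (1 - norm (a i))"
        have A: "0 < A" using ai by (simp add: A_def add_pos_pos)
        \<comment> \<open>The bound on \<open>\<eta> * \<nu> i * ln (norm (s - a i))\<close> that absorbs all constants, collected from the estimates below.\<close>
        define m where "m = (1 - \<eta>) * (R (a i) - 1 - \<nu> i * ln 2) + \<eta> - C - \<nu> i * ln A"
        have E3: "\<forall>\<^sub>F s in at (a i). norm (s - a i) < exp (m / (\<eta> * \<nu> i))"
          unfolding eventually_at by (intro exI[of _ "exp (m / (\<eta> * \<nu> i))"]) (simp add: dist_norm)
        have E4: "\<forall>\<^sub>F s in at (a i). s \<in> ball 0 1 - {a i}"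
          using ai by (intro eventually_at_in_open) auto
        show ?thesis
          using E1 E2 E3 E4
        proof eventually_elim
          case (elim s)
          have s: "norm s < 1" "s \<noteq> a i" using elim(4) by auto
          define t where "t = ln (norm (s - a i))"
          have pos: "0 < norm (s - a i)" using s by simp
          have "t \<le> m / (\<eta> * \<nu> i)"
            unfolding t_def using elim(3) pos by (metis exp_gt_zero less_imp_le ln_exp ln_le_cancel_iff)
          then have t: "\<eta> * \<nu> i * t \<le> m"
            using \<eta> \<nu>i by (simp add: pos_le_divide_eq mult.commute)
          have "norm (c * ?F s) \<le> 1 * norm (?F s)" unfolding norm_mult using c1 by (intro mult_right_mono) auto
          also have "\<dots> \<le> norm (s - a i) / (1 - norm (a i))"
            using norm_blaschke_prod_le[where a=a, OF fin a iI, where s=s] norm_moebius_le[OF ai, of s] s by auto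
          finally have "norm (c * ?F s) \<le> norm (s - a i) / (1 - norm (a i))" .
          then have le: "norm (\<phi> s - ?w) \<le> A * norm (s - a i)"
            using norm_vec2_le[of "\<phi> s - ?w"] by (simp add: \<phi>_def A_def algebra_simps)
          have "\<phi> s \<noteq> ?w" using s by (auto simp: \<phi>_def vec_eq_iff forall_2)
          then have "ln (norm (\<phi> s - ?w)) \<le> ln (A * norm (s - a i))"
            using le A pos by (subst ln_le_cancel_iff) auto
          also have "\<dots> = ln A + t" using A pos by (simp add: ln_mult t_def)
          finally have 1: "\<nu> i * ln (norm (\<phi> s - ?w)) \<le> \<nu> i * (ln A + t)"
            using \<nu>i by (intro mult_left_mono) auto
          have "ln (norm (s - a i) / 2) \<le> ln (norm (moebius (a i) s))"
            using norm_moebius_ge[OF ai, of s] s mz[OF i, of s] by (subst ln_le_cancel_iff) auto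
          then have "t - ln 2 \<le> ln (norm (moebius (a i) s))"
            using pos by (simp add: ln_div t_def)
          then have "\<nu> i * (t - ln 2) \<le> \<nu> i * ln (norm (moebius (a i) s))"
            using \<nu>i by (intro mult_left_mono) auto
          moreover have "S s = \<nu> i * ln (norm (moebius (a i) s)) + R s"
            unfolding S_def R_def using J(1) i by (rule sum.remove)
          ultimately have "\<nu> i * (t - ln 2) + (R (a i) - 1) \<le> S s" using elim(2) by linarith
          then have "(1 - \<eta>) * (\<nu> i * (t - ln 2) + (R (a i) - 1)) \<le> (1 - \<eta>) * S s"
            using \<eta> by (intro mult_left_mono) auto
          then have "\<nu> i * (ln A + t) + C \<le> H s"
            using t by (simp add: H_def m_def algebra_simps)
          with 1 have "\<nu> i * ln (norm (\<phi> s - ?w)) + C \<le> H s" by linarith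
          then show ?case using elim(1) by (meson ereal_less_eq(3) order_trans)
        qed
      qed
      have "\<forall>\<^sub>F \<sigma> in at_right 0. \<forall>i\<in>J. (\<forall>s. dist s (a i) = \<sigma> \<longrightarrow> u (\<phi> s) \<le> ereal (H s)) \<and> \<sigma> < dist (z $ 1) (a i)"
      proof (rule eventually_ball_finite[OF J(1)], intro ballI)
        fix i assume i: "i \<in> J"
        obtain d where d: "d > 0" "\<And>s. s \<noteq> a i \<Longrightarrow> dist s (a i) < d \<Longrightarrow> u (\<phi> s) \<le> ereal (H s)"
          using inner[OF i] unfolding eventually_at by auto
        have "0 < min d (dist (z $ 1) (a i))" using d(1) ne(2) i by auto
        then show "\<forall>\<^sub>F \<sigma> in at_right 0. (\<forall>s. dist s (a i) = \<sigma> \<longrightarrow> u (\<phi> s) \<le> ereal (H s)) \<and> \<sigma> < dist (z $ 1) (a i)"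
          unfolding eventually_at_right_field using d(2)
          by (intro exI[of _ "min d (dist (z $ 1) (a i))"]) fastforce
      qed
      moreover have "\<forall>\<^sub>F \<sigma>::real in at_right 0. 0 < \<sigma>" by (simp add: eventually_at_right_less)
      ultimately have "\<forall>\<^sub>F \<sigma> in at_right 0. 0 < \<sigma> \<and> (\<forall>i\<in>J. (\<forall>s. dist s (a i) = \<sigma> \<longrightarrow> u (\<phi> s) \<le> ereal (H s)) \<and> \<sigma> < dist (z $ 1) (a i))"
        by eventually_elim auto
      then obtain \<sigma> where \<sigma>: "0 < \<sigma>" "\<And>i s. i \<in> J \<Longrightarrow> dist s (a i) = \<sigma> \<Longrightarrow> u (\<phi> s) \<le> ereal (H s)"
        "\<And>i. i \<in> J \<Longrightarrow> \<sigma> < dist (z $ 1) (a i)"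
        using eventually_happens'[OF trivial_limit_at_right_real] by blast
      define K where "K = cball 0 \<rho> - (\<Union>i\<in>J. ball (a i) \<sigma>)"
      define U where "U = ball 0 \<rho> - (\<Union>i\<in>J. cball (a i) \<sigma>)"
      have KD: "K \<subseteq> ball 0 1" using \<rho>(2) by (auto simp: K_def)
      have UK: "U \<subseteq> K" by (auto simp: U_def K_def)
      have Kne: "s \<noteq> a i" if "s \<in> K" "i \<in> J" for s i using that \<sigma>(1) by (auto simp: K_def)
      have oU: "open U" unfolding U_def using J(1) by (intro open_Diff closed_UN) auto
      have "u (\<phi> (z $ 1)) \<le> ereal (H (z $ 1))"
      proof (rule psh_curve_max_principle[OF neg_psh_coneD(1)[OF u] open_bidisc, where K=K and U=U and \<phi>=\<phi> and H=H])
        show "compact K" unfolding K_def by (intro compact_diff open_UN) auto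
        show "open U" "U \<subseteq> K" by fact+
        show "continuous_on K \<phi>" by (rule continuous_on_subset[OF continuous_on_components[OF \<phi>hol] KD])
        show "\<phi> ` K \<subseteq> bidisc" using \<phi>bi KD by (force simp del: mem_bidisc)
        show "(\<lambda>s. \<phi> s $ i) holomorphic_on U" for i
          using holomorphic_on_subset[OF \<phi>hol] UK KD by blast
        have Mhol: "moebius (a i) holomorphic_on ball 0 1" if "i \<in> J" for i
          using that J(2) a by (intro Moebius_function_holomorphic) auto
        have nz: "moebius (a i) s \<noteq> 0" if "i \<in> J" "s \<in> K" for i s
          using mz[OF that(1), of s] Kne[OF that(2,1)] KD that(2) by (force simp: less_imp_le)
        have "continuous_on K (moebius (a i))" if "i \<in> J" for i
          using holomorphic_on_imp_continuous_on[OF Mhol[OF that]] KD by (rule continuous_on_subset)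
        then show "continuous_on K H"
          unfolding H_def S_def using nz by (intro continuous_intros) auto
        show "harmonic_on U H"
          unfolding H_def S_def
          using nz UK KD Mhol oU
          by (intro harmonic_on_add harmonic_on_cmult harmonic_on_sum
              harmonic_on_const harmonic_on_ln_norm holomorphic_on_subset[OF Mhol]) auto
        show "u (\<phi> s) \<le> ereal (H s)" if s: "s \<in> K - U" for s
        proof -
          consider "norm s = \<rho>" | i where "i \<in> J" "dist s (a i) = \<sigma>"
            using s by (force simp: K_def U_def dist_commute)
          then show ?thesis
          proof cases
            case 1
            then have "u (\<phi> s) \<le> 0" using \<phi>bi \<rho>(2) by (intro neg_psh_coneD(3)[OF u]) auto
            also have "\<dots> \<le> ereal (H s)" using outer[OF 1] by simp
            finally show ?thesis .
          qed (use \<sigma>(2) in auto)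
        qed
        show "z $ 1 \<in> K" using \<rho>(1) \<sigma>(3) by (force simp: K_def dist_commute)
      qed
      then show ?thesis by (simp add: \<phi>z H_def)
    qed
    have "((\<lambda>\<eta>. (1 - \<eta>) * S (z $ 1) + \<eta>) \<longlongrightarrow> (1 - 0) * S (z $ 1) + 0) (at_right 0)"
      by (intro tendsto_intros)
    then have "((\<lambda>\<eta>. ereal ((1 - \<eta>) * S (z $ 1) + \<eta>)) \<longlongrightarrow> ereal (S (z $ 1))) (at_right 0)"
      by simp
    then have "u z \<le> ereal (S (z $ 1))"
    proof (rule tendsto_lowerbound)
      show "\<forall>\<^sub>F \<eta> in at_right 0. u z \<le> ereal ((1 - \<eta>) * S (z $ 1) + \<eta>)"
        unfolding eventually_at_right_field using bound by (intro exI[of _ 1]) auto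
    qed simp
    then show ?thesis by (simp add: rhs Sz)
  qed
qed

section \<open>The Green function of the bidisc\<close>

definition weighted_h :: "(nat \<Rightarrow> complex) \<Rightarrow> (nat \<Rightarrow> real) \<Rightarrow> nat \<Rightarrow> complex^2 \<Rightarrow> ereal" where
  "weighted_h a \<nu> k z = ereal (\<nu> k) * h a k z + (\<Sum>j=1..<k. ereal (\<nu> j - \<nu> (Suc j)) * h a j z)"

lemma Abel_summation_ereal:
  fixes x :: "nat \<Rightarrow> ereal"
  assumes "1 \<le> k" "\<And>j. j \<in> {1..k} \<Longrightarrow> 0 \<le> \<nu> j" "\<And>j. j \<in> {1..<k} \<Longrightarrow> \<nu> (Suc j) \<le> \<nu> j"
  shows "ereal (\<nu> k) * (\<Sum>i=1..k. x i) + (\<Sum>j=1..<k. ereal (\<nu> j - \<nu> (Suc j)) * (\<Sum>i=1..j. x i)) =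
    (\<Sum>i=1..k. ereal (\<nu> i) * x i)"
  using assms
proof (induction k rule: dec_induct)
  case base
  then show ?case by simp
next
  case (step k)
  let ?S = "\<Sum>i=1..k. x i"
  let ?R = "\<Sum>j=1..<k. ereal (\<nu> j - \<nu> (Suc j)) * (\<Sum>i=1..j. x i)"
  have \<nu>: "0 \<le> \<nu> (Suc k)" "\<nu> (Suc k) \<le> \<nu> k" using step by auto
  have split: "ereal (\<nu> (Suc k)) * ?S + ereal (\<nu> k - \<nu> (Suc k)) * ?S = ereal (\<nu> k) * ?S"
    using \<nu> by (subst ereal_left_distrib[symmetric]) auto
  have IH: "ereal (\<nu> k) * ?S + ?R = (\<Sum>i=1..k. ereal (\<nu> i) * x i)"
    by (rule step.IH) (use step.prems in auto)
  have "ereal (\<nu> (Suc k)) * (\<Sum>i=1..Suc k. x i) + (\<Sum>j=1..<Suc k. ereal (\<nu> j - \<nu> (Suc j)) * (\<Sum>i=1..j. x i))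
      = (ereal (\<nu> (Suc k)) * ?S + ereal (\<nu> (Suc k)) * x (Suc k)) + (?R + ereal (\<nu> k - \<nu> (Suc k)) * ?S)"
    using \<nu> step.hyps by (simp add: ereal_pos_distrib)
  also have "\<dots> = ((ereal (\<nu> (Suc k)) * ?S + ereal (\<nu> k - \<nu> (Suc k)) * ?S) + ?R) + ereal (\<nu> (Suc k)) * x (Suc k)"
    by (simp only: ac_simps)
  also have "\<dots> = (\<Sum>i=1..Suc k. ereal (\<nu> i) * x i)"
    unfolding split IH by simp
  finally show ?case .
qed

context
  fixes a :: "nat \<Rightarrow> complex" and k :: nat
  assumes a: "\<And>i. i \<in> {1..k} \<Longrightarrow> norm (a i) < 1"
begin

lemma norm_blaschke_prod_antimono:
  assumes "j \<le> m" "m \<le> k" "norm s \<le> 1"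
  shows "norm (blaschke_prod a {1..m} s) \<le> norm (blaschke_prod a {1..j} s)"
proof -
  have "{1..m} = {1..j} \<union> {Suc j..m}" using assms(1) by auto
  then have "blaschke_prod a {1..m} s = blaschke_prod a {1..j} s * blaschke_prod a {Suc j..m} s"
    unfolding blaschke_prod_def by (simp add: prod.union_disjoint)
  moreover have "norm (blaschke_prod a {Suc j..m} s) \<le> 1"
    by (rule norm_blaschke_prod_le_1) (use a assms in auto)
  ultimately show ?thesis by (simp add: norm_mult mult_left_le)
qed

lemma h_blaschke:
  assumes "j \<le> k"
  shows "h a j z = max (elog (norm (blaschke_prod a {1..j} (z $ 1)))) (elog (norm (z $ 2)))"
proof -
  have "elog (norm (blaschke_prod a {1..j} (z $ 1))) = (\<Sum>i=1..j. T (a i) (z $ 1))"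
    by (rule elog_blaschke_prod) (use a assms in auto)
  then show ?thesis by (simp add: h_def)
qed

lemma h_in_neg_psh_cone:
  assumes "j \<le> k"
  shows "h a j \<in> neg_psh_cone bidisc"
proof -
  have "(\<lambda>z. elog (norm (z $ 2))) \<in> neg_psh_cone bidisc"
    by (rule elog_norm_in_neg_psh_cone[OF open_bidisc])
       (auto intro!: continuous_intros holomorphic_intros)
  moreover have "(\<lambda>z. T (a i) (z $ 1)) \<in> neg_psh_cone bidisc" if "i \<in> {1..j}" for i
    unfolding T_moebius
  proof (rule elog_norm_in_neg_psh_cone[OF open_bidisc])
    have ai: "norm (a i) < 1" using a that assms by auto
    have hol: "moebius (a i) holomorphic_on ball 0 1" by (rule Moebius_function_holomorphic[OF ai])
    show "continuous_on bidisc (\<lambda>z. moebius (a i) (z $ 1))"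
      by (rule continuous_on_compose2[OF holomorphic_on_imp_continuous_on[OF hol]])
         (auto intro!: continuous_intros)
    show "norm (moebius (a i) (z $ 1)) \<le> 1" if "z \<in> bidisc" for z
      using that ai by (intro norm_moebius_le_1) auto
    show "(\<lambda>s. moebius (a i) ((p + s *s b) $ 1)) holomorphic_on {s. p + s *s b \<in> bidisc}" for p b
      by (rule holomorphic_on_compose_gen[OF _ hol, unfolded o_def]) (auto intro!: holomorphic_intros)
  qed
  ultimately show ?thesis
    unfolding h_def[abs_def] by (intro neg_psh_cone_max neg_psh_cone_sum)
qed

context
  fixes \<nu> :: "nat \<Rightarrow> real"
  assumes k: "1 \<le> k" and \<nu>: "\<And>j. j \<in> {1..k} \<Longrightarrow> 0 \<le> \<nu> j"
    and mono: "\<And>j. j \<in> {1..<k} \<Longrightarrow> \<nu> (Suc j) \<le> \<nu> j"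
begin

text \<open>Writing the functions \<open>h a j z\<close> as partial sums and summing by parts turns the combination of the
  \<open>h a j z\<close> into a single weighted sum.  Different choices of the \<open>x i\<close> give its values in different parts of
  the bidisc.\<close>
lemma weighted_h_eq:
  assumes "\<And>j. j \<in> {1..k} \<Longrightarrow> h a j z = (\<Sum>i=1..j. x i)"
  shows "weighted_h a \<nu> k z = (\<Sum>i=1..k. ereal (\<nu> i) * x i)"
proof -
  have "weighted_h a \<nu> k z =
      ereal (\<nu> k) * (\<Sum>i=1..k. x i) + (\<Sum>j=1..<k. ereal (\<nu> j - \<nu> (Suc j)) * (\<Sum>i=1..j. x i))"
    unfolding weighted_h_def using assms k by (intro arg_cong2[where f="(+)"] sum.cong) auto
  then show ?thesis using Abel_summation_ereal[where \<nu>=\<nu> and x=x, OF k \<nu> mono] by simp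
qed

lemma weighted_h_le:
  assumes "\<And>j. j \<in> {1..k} \<Longrightarrow> h a j z \<le> (\<Sum>i=1..j. x i)"
  shows "weighted_h a \<nu> k z \<le> (\<Sum>i=1..k. ereal (\<nu> i) * x i)"
proof -
  have "weighted_h a \<nu> k z \<le>
      ereal (\<nu> k) * (\<Sum>i=1..k. x i) + (\<Sum>j=1..<k. ereal (\<nu> j - \<nu> (Suc j)) * (\<Sum>i=1..j. x i))"
    unfolding weighted_h_def using assms k \<nu> mono
    by (intro add_mono sum_mono ereal_mult_left_mono) auto
  then show ?thesis using Abel_summation_ereal[where \<nu>=\<nu> and x=x, OF k \<nu> mono] by simp
qed

lemma weighted_h_in_neg_psh_cone: "weighted_h a \<nu> k \<in> neg_psh_cone bidisc"
  unfolding weighted_h_def[abs_def] using k \<nu> mono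
  by (intro neg_psh_cone_add neg_psh_cone_cmult neg_psh_cone_sum h_in_neg_psh_cone) auto

text \<open>Near the pole \<open>i\<close> the functions \<open>h a j\<close> with \<open>j \<ge> i\<close> have a logarithmic pole of weight 1, and their
  coefficients add up to \<open>\<nu> i\<close>; the other ones are nonpositive.\<close>
lemma weighted_h_log_pole:
  assumes i: "i \<in> {1..k}"
  shows "log_pole (weighted_h a \<nu> k) (vector [a i, 0]) (\<nu> i)"
proof -
  let ?w = "vector [a i, 0] :: complex^2"
  define A where "A = 1 / (1 - norm (a i))"
  have ai: "norm (a i) < 1" using a i by auto
  have A: "1 \<le> A" using ai by (simp add: A_def)
  have "\<forall>\<^sub>F z in at ?w. z \<in> bidisc - {?w}"
    using ai by (intro eventually_at_in_open open_bidisc) auto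
  moreover have "\<forall>\<^sub>F z in at ?w. norm (z - ?w) < 1 / A"
    unfolding eventually_at using A by (intro exI[of _ "1 / A"]) (simp add: dist_norm)
  ultimately have "\<forall>\<^sub>F z in at ?w. weighted_h a \<nu> k z \<le> ereal (\<nu> i * ln (norm (z - ?w)) + \<nu> i * ln A)"
  proof eventually_elim
    case (elim z)
    have z1: "norm (z $ 1) < 1" using elim(1) by auto
    have pos: "0 < norm (z - ?w)" using elim(1) by simp
    define l where "l = ln (A * norm (z - ?w))"
    have "l \<le> 0" using elim(2) A pos by (simp add: l_def ln_le_zero_iff field_simps)
    have comp: "norm (z $ 1 - a i) \<le> norm (z - ?w)" "norm (z $ 2) \<le> norm (z - ?w)"
      using Finite_Cartesian_Product.norm_nth_le[of "z - ?w" 1] Finite_Cartesian_Product.norm_nth_le[of "z - ?w" 2] by auto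
    have el: "elog (A * norm (z - ?w)) = ereal l" using A pos by (simp add: elog_def l_def)
    have "weighted_h a \<nu> k z \<le> (\<Sum>j=1..k. ereal (\<nu> j) * (if j = i then ereal l else 0))"
    proof (rule weighted_h_le)
      fix j assume j: "j \<in> {1..k}"
      show "h a j z \<le> (\<Sum>l'=1..j. if l' = i then ereal l else 0)"
      proof (cases "i \<le> j")
        case True
        have "norm (blaschke_prod a {1..j} (z $ 1)) \<le> norm (moebius (a i) (z $ 1))"
          by (rule norm_blaschke_prod_le) (use a i j True z1 in auto)
        also have "\<dots> \<le> norm (z $ 1 - a i) * A"
          using norm_moebius_le[OF ai, of "z $ 1"] z1 by (simp add: A_def)
        also have "\<dots> \<le> A * norm (z - ?w)"
          using comp(1) A by (simp add: mult.commute)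
        finally have 1: "norm (blaschke_prod a {1..j} (z $ 1)) \<le> A * norm (z - ?w)" .
        have "1 * norm (z $ 2) \<le> A * norm (z - ?w)"
          using comp(2) A by (intro mult_mono) auto
        then have "h a j z \<le> elog (A * norm (z - ?w))"
          using 1 j by (auto simp: h_blaschke intro!: elog_mono)
        then show ?thesis using True i by (simp add: el)
      next
        case False
        have "h a j z \<le> 0"
          using neg_psh_coneD(3)[OF h_in_neg_psh_cone, of j z] j elim(1) by simp
        then show ?thesis using False by (simp add: sum.delta)
      qed
    qed
    also have "\<dots> = ereal (\<nu> i * l)"
      using i by (simp add: if_distrib[of "\<lambda>x. _ * x"] cong: if_cong)
    also have "\<nu> i * l = \<nu> i * ln (norm (z - ?w)) + \<nu> i * ln A"
      using A pos by (simp add: l_def ln_mult algebra_simps)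
    finally show ?case .
  qed
  then show ?thesis unfolding log_pole_def by blast
qed

context
  assumes inj: "inj_on a {1..k}"
begin

text \<open>Where \<open>norm (z $ 2)\<close> is at most the modulus of the full Blaschke product, the disc through all poles gives
  the bound.  Elsewhere \<open>norm (z $ 2)\<close> lies between the moduli of the partial products of lengths \<open>m + 1\<close> and \<open>m\<close>.  With
  \<open>z $ 2\<close> fixed, these conditions on the first coordinate cut out a compact part of the disc.  There \<open>weighted_h\<close>
  coincides with a function \<open>H\<close>, harmonic in the first coordinate because the first \<open>m\<close> poles lie outside.  On the two parts of
  its boundary, the discs through the first \<open>m + 1\<close> and the first \<open>m\<close> poles give exactly the bound \<open>H\<close>, and the
  maximum principle extends it inside.\<close>
lemma upper_bound_weighted_h:
  assumes u: "u \<in> neg_psh_cone bidisc"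
    and pole: "\<And>i. i \<in> {1..k} \<Longrightarrow> log_pole u (vector [a i, 0]) (\<nu> i)"
    and z: "z \<in> bidisc"
  shows "u z \<le> weighted_h a \<nu> k z"
proof -
  let ?F = "\<lambda>j. blaschke_prod a {1..j}"
  have disc: "u x \<le> (\<Sum>i=1..m. ereal (\<nu> i) * T (a i) (x $ 1))"
    if "m \<le> k" "x \<in> bidisc" "norm (x $ 2) \<le> norm (?F m (x $ 1))" for m x
    by (rule disc_bound[OF u]) (use that a \<nu> pole inj in \<open>auto intro: inj_on_subset\<close>)
  have z1: "norm (z $ 1) < 1" "norm (z $ 1) \<le> 1" and z2: "norm (z $ 2) < 1" using z by auto
  show ?thesis
  proof (cases "norm (z $ 2) \<le> norm (?F k (z $ 1))")
    case True
    have "weighted_h a \<nu> k z = (\<Sum>i=1..k. ereal (\<nu> i) * T (a i) (z $ 1))"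
    proof (rule weighted_h_eq)
      fix j assume j: "j \<in> {1..k}"
      then have "norm (z $ 2) \<le> norm (?F j (z $ 1))"
        using True norm_blaschke_prod_antimono[of j k "z $ 1"] z1 by auto
      then have "h a j z = elog (norm (?F j (z $ 1)))"
        using j by (simp add: h_blaschke elog_mono max_absorb1)
      also have "\<dots> = (\<Sum>i=1..j. T (a i) (z $ 1))"
        by (rule elog_blaschke_prod) (use a j in auto)
      finally show "h a j z = (\<Sum>i=1..j. T (a i) (z $ 1))" .
    qed
    then show ?thesis using disc[OF _ z True] by simp
  next
    case False
    define m' where "m' = (LEAST j. norm (?F j (z $ 1)) < norm (z $ 2))"
    have m': "norm (?F m' (z $ 1)) < norm (z $ 2)" "m' \<le> k"
      unfolding m'_def using False by (auto intro: LeastI[of _ k] Least_le simp: not_le)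
    have "m' \<noteq> 0"
    proof
      assume "m' = 0"
      then show False using m'(1) z2 by (simp add: blaschke_prod_def)
    qed
    then obtain m where m: "m' = Suc m" by (cases m') auto
    have mk: "m < k" "Suc m \<in> {1..k}" using m m'(2) by auto
    have Fm: "norm (z $ 2) \<le> norm (?F m (z $ 1))"
      using not_less_Least[of m "\<lambda>j. norm (?F j (z $ 1)) < norm (z $ 2)"] m by (simp add: m'_def not_less)
    have FSm: "norm (?F (Suc m) (z $ 1)) < norm (z $ 2)" using m' m by simp
    have z20: "0 < norm (z $ 2)" using FSm norm_ge_zero order.strict_trans1 by blast
    define t where "t = ln (norm (z $ 2))"
    define \<tau> where "\<tau> i s = ln (norm (moebius (a i) s))" for i s
    \<comment> \<open>The increments of \<open>h a j z\<close> in \<open>j\<close>: the maximum is the first entry up to \<open>j = m\<close> and \<open>t\<close> from then on.\<close>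
    define y where "y i s = (if i \<le> m then \<tau> i s else if i = Suc m then t - (\<Sum>l=1..m. \<tau> l s) else 0)" for i s
    define H where "H s = (\<Sum>i=1..m. \<nu> i * \<tau> i s) + \<nu> (Suc m) * (t - (\<Sum>l=1..m. \<tau> l s))" for s
    have cut: "(\<Sum>i=1..n. g i) = (\<Sum>i=1..m. g i) + g (Suc m)" if "Suc m \<le> n" "\<And>i. Suc m < i \<Longrightarrow> g i = 0" for n and g :: "nat \<Rightarrow> real"
      using that(1) by (induction n rule: dec_induct) (auto simp: that(2))
    have nzF: "?F m s \<noteq> 0" if "norm (z $ 2) \<le> norm (?F m s)" for s
      using that z20 by auto
    have nz: "moebius (a i) s \<noteq> 0" if "?F n s \<noteq> 0" "i \<in> {1..n}" for i n s
      using that by (auto simp: blaschke_prod_def)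
    have lnF: "ln (norm (?F n s)) = (\<Sum>i=1..n. \<tau> i s)" if "?F n s \<noteq> 0" "n \<le> k" for n s
      unfolding \<tau>_def by (rule ln_blaschke_prod) (use a that in auto)
    have formula: "weighted_h a \<nu> k z = ereal (H (z $ 1))"
    proof -
      have "weighted_h a \<nu> k z = (\<Sum>i=1..k. ereal (\<nu> i) * ereal (y i (z $ 1)))"
      proof (rule weighted_h_eq)
        fix j assume j: "j \<in> {1..k}"
        have "h a j z = ereal (\<Sum>i=1..j. y i (z $ 1))"
        proof (cases "j \<le> m")
          case True
          have le: "norm (z $ 2) \<le> norm (?F j (z $ 1))"
            using Fm norm_blaschke_prod_antimono[OF True _ z1(2)] mk by simp
          then have nz': "?F j (z $ 1) \<noteq> 0" using z20 by auto
          have "h a j z = elog (norm (?F j (z $ 1)))"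
            using j le by (simp add: h_blaschke elog_mono max_absorb1)
          also have "\<dots> = ereal (\<Sum>i=1..j. \<tau> i (z $ 1))"
            using nz' lnF[OF nz'] j by (simp add: elog_def)
          also have "(\<Sum>i=1..j. \<tau> i (z $ 1)) = (\<Sum>i=1..j. y i (z $ 1))"
            using True by (intro sum.cong) (auto simp: y_def)
          finally show ?thesis .
        next
          case False
          then have "norm (?F j (z $ 1)) \<le> norm (z $ 2)"
            using FSm norm_blaschke_prod_antimono[of "Suc m" j "z $ 1"] z1 j by simp
          then have "h a j z = elog (norm (z $ 2))"
            using j by (simp add: h_blaschke elog_mono max_absorb2)
          also have "\<dots> = ereal t" using z20 by (simp add: elog_def t_def)
          also have "t = (\<Sum>i=1..j. y i (z $ 1))"
            using False by (subst cut) (auto simp: y_def)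
          finally show ?thesis .
        qed
        then show "h a j z = (\<Sum>i=1..j. ereal (y i (z $ 1)))" by simp
      qed
      also have "\<dots> = ereal (\<Sum>i=1..k. \<nu> i * y i (z $ 1))" by simp
      also have "(\<Sum>i=1..k. \<nu> i * y i (z $ 1)) = H (z $ 1)"
        using mk by (subst cut) (auto simp: y_def H_def)
      finally show ?thesis .
    qed
    define K where "K = {s\<in>cball 0 1. norm (?F (Suc m) s) \<le> norm (z $ 2) \<and> norm (z $ 2) \<le> norm (?F m s)}"
    define U where "U = {s\<in>ball 0 1. norm (?F (Suc m) s) < norm (z $ 2) \<and> norm (z $ 2) < norm (?F m s)}"
    have contF: "continuous_on (cball 0 1) (?F n)" if "n \<le> k" for n
      by (rule continuous_on_blaschke_prod) (use a that in auto)
    have sphere: "norm (?F n s) = 1" if "n \<le> k" "norm s = 1" for n s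
      by (rule norm_blaschke_prod_sphere) (use a that in auto)
    have KD: "K \<subseteq> ball 0 1"
    proof
      fix s assume "s \<in> K"
      then have "norm s \<noteq> 1" "norm s \<le> 1" using sphere[of "Suc m" s] mk z2 by (auto simp: K_def)
      then show "s \<in> ball 0 1" by simp
    qed
    have UK: "U \<subseteq> K" by (auto simp: U_def K_def)
    have Knz: "moebius (a i) s \<noteq> 0" if "s \<in> K" "i \<in> {1..m}" for s i
      using that by (intro nz[OF nzF]) (auto simp: K_def)
    have Mhol: "moebius (a i) holomorphic_on ball 0 1" if "i \<in> {1..m}" for i
      using that mk a by (intro Moebius_function_holomorphic) auto
    define \<phi> :: "complex \<Rightarrow> complex^2" where "\<phi> s = vector [s, z $ 2]" for s
    have "u (\<phi> (z $ 1)) \<le> ereal (H (z $ 1))"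
    proof (rule psh_curve_max_principle[OF neg_psh_coneD(1)[OF u] open_bidisc, where K=K and U=U
          and \<phi>=\<phi> and H=H])
      have "closed ((cball 0 1 \<inter> (\<lambda>s. norm (?F (Suc m) s)) -` {..norm (z $ 2)}) \<inter>
          (cball 0 1 \<inter> (\<lambda>s. norm (?F m s)) -` {norm (z $ 2)..}))"
        using mk by (intro closed_Int continuous_closed_preimage continuous_on_norm contF) auto
      also have "\<dots> = K" by (auto simp: K_def)
      finally show "compact K" unfolding compact_eq_bounded_closed
        by (auto intro: bounded_subset[of "cball 0 1"] simp: K_def)
      have "open ((ball 0 1 \<inter> (\<lambda>s. norm (?F (Suc m) s)) -` {..<norm (z $ 2)}) \<inter>
          (ball 0 1 \<inter> (\<lambda>s. norm (?F m s)) -` {norm (z $ 2)<..}))"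
        using mk by (intro open_Int continuous_open_preimage continuous_on_norm continuous_on_subset[OF contF]) auto
      also have "\<dots> = U" by (auto simp: U_def)
      finally show oU: "open U" .
      show "U \<subseteq> K" by fact
      show "continuous_on K \<phi>" unfolding \<phi>_def by (intro continuous_on_vector_2 continuous_intros)
      show "\<phi> ` K \<subseteq> bidisc" using KD z2 by (auto simp: \<phi>_def)
      show "(\<lambda>s. \<phi> s $ i) holomorphic_on U" for i
        unfolding \<phi>_def by (intro holomorphic_on_vector_2 holomorphic_intros)
      have "continuous_on K (moebius (a i))" if "i \<in> {1..m}" for i
        using holomorphic_on_imp_continuous_on[OF Mhol[OF that]] KD by (rule continuous_on_subset)
      then show "continuous_on K H"
        unfolding H_def \<tau>_def using Knz by (intro continuous_intros) auto
      have \<tau>h: "harmonic_on U (\<lambda>s. \<Sum>i=1..m. c i * \<tau> i s)" for c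
        unfolding \<tau>_def
        using Knz UK KD oU
        by (intro harmonic_on_sum harmonic_on_cmult harmonic_on_ln_norm
            holomorphic_on_subset[OF Mhol]) auto
      have "harmonic_on U (\<lambda>s. (\<Sum>i=1..m. \<nu> i * \<tau> i s) + \<nu> (Suc m) * (t + (\<Sum>l=1..m. (- 1) * \<tau> l s)))"
        by (intro harmonic_on_add harmonic_on_cmult harmonic_on_const \<tau>h)
      then show "harmonic_on U H" by (simp add: H_def[abs_def] sum_negf)
      show "z $ 1 \<in> K" using Fm FSm z1 by (auto simp: K_def)
      fix s assume s: "s \<in> K - U"
      have s1: "norm s < 1" using s KD by auto
      have bd: "\<phi> s \<in> bidisc" using s1 z2 by (simp add: \<phi>_def)
      have Fnz: "?F m s \<noteq> 0" using s by (intro nzF) (auto simp: K_def)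
      have Tsum: "(\<Sum>i=1..n. ereal (\<nu> i) * T (a i) s) = ereal (\<Sum>i=1..n. \<nu> i * \<tau> i s)" if "?F n s \<noteq> 0" for n
        unfolding sum_ereal[symmetric] using nz[OF that]
        by (intro sum.cong) (auto simp: T_moebius elog_def \<tau>_def)
      consider "norm (?F (Suc m) s) = norm (z $ 2)" | "norm (?F m s) = norm (z $ 2)"
        using s s1 by (force simp: K_def U_def)
      then show "u (\<phi> s) \<le> ereal (H s)"
      proof cases
        case 1
        then have nz1: "?F (Suc m) s \<noteq> 0" using z20 by auto
        have "u (\<phi> s) \<le> (\<Sum>i=1..Suc m. ereal (\<nu> i) * T (a i) s)"
          using disc[of "Suc m" "\<phi> s"] mk bd 1 by (simp add: \<phi>_def)
        also have "\<dots> = ereal (\<Sum>i=1..Suc m. \<nu> i * \<tau> i s)" by (rule Tsum[OF nz1])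
        also have "(\<Sum>i=1..Suc m. \<nu> i * \<tau> i s) = H s"
          using lnF[OF nz1] mk 1 by (simp add: H_def t_def)
        finally show ?thesis .
      next
        case 2
        have "u (\<phi> s) \<le> (\<Sum>i=1..m. ereal (\<nu> i) * T (a i) s)"
          using disc[of m "\<phi> s"] mk bd 2 by (simp add: \<phi>_def)
        also have "\<dots> = ereal (\<Sum>i=1..m. \<nu> i * \<tau> i s)" by (rule Tsum[OF Fnz])
        also have "(\<Sum>i=1..m. \<nu> i * \<tau> i s) = H s"
          using lnF[OF Fnz] mk 2 by (simp add: H_def t_def)
        finally show ?thesis .
      qed
    qed
    then show ?thesis by (simp add: \<phi>_def vector_2_eta formula)
  qed
qed

theorem green_function_bidisc:
  assumes w: "\<And>i. i \<in> {1..k} \<Longrightarrow> w i = vector [a i, 0]" and z: "z \<in> bidisc"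
  shows "green_function bidisc k w \<nu> z = weighted_h a \<nu> k z"
  unfolding green_function_log_pole
proof (rule antisym)
  show "(SUP u\<in>{u \<in> neg_psh_cone bidisc. \<forall>j\<in>{1..k}. log_pole u (w j) (\<nu> j)}. u z) \<le> weighted_h a \<nu> k z"
    using w z by (intro SUP_least upper_bound_weighted_h) auto
  show "weighted_h a \<nu> k z \<le> (SUP u\<in>{u \<in> neg_psh_cone bidisc. \<forall>j\<in>{1..k}. log_pole u (w j) (\<nu> j)}. u z)"
    using w weighted_h_in_neg_psh_cone weighted_h_log_pole by (intro SUP_upper) auto
qed

text \<open>One of the summands, \<open>h a p\<close>, is finite and nonzero at the pole number \<open>Suc p\<close>, where the whole sum is \<open>-\<infinity>\<close>; so
  this summand is not a multiple of the sum.\<close>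
lemma weighted_h_not_extremal:
  assumes p: "p \<in> {1..<k}" "\<nu> (Suc p) < \<nu> p" "0 < \<nu> (Suc p)"
  shows "\<not> extremal_psh bidisc (weighted_h a \<nu> k)"
proof
  assume ext: "extremal_psh bidisc (weighted_h a \<nu> k)"
  let ?w = "vector [a (Suc p), 0] :: complex^2"
  define f where "f j z = ereal (\<nu> j - \<nu> (Suc j)) * h a j z" for j z
  have f: "f j \<in> neg_psh_cone bidisc" if "j \<in> {1..<k}" for j
    unfolding f_def[abs_def] using that mono by (intro neg_psh_cone_cmult h_in_neg_psh_cone) auto
  define u2 where "u2 z = ereal (\<nu> k) * h a k z + (\<Sum>j\<in>{1..<k} - {p}. f j z)" for z
  have "u2 \<in> neg_psh_cone bidisc"
    unfolding u2_def[abs_def] using k \<nu> f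
    by (intro neg_psh_cone_add neg_psh_cone_cmult neg_psh_cone_sum h_in_neg_psh_cone) auto
  moreover have "weighted_h a \<nu> k z = f p z + u2 z" for z
  proof -
    have "(\<Sum>j=1..<k. f j z) = f p z + (\<Sum>j\<in>{1..<k} - {p}. f j z)"
      using p(1) by (intro sum.remove) auto
    then show ?thesis by (simp add: weighted_h_def u2_def f_def ac_simps)
  qed
  ultimately obtain c where c: "0 \<le> c" "\<forall>z\<in>bidisc. f p z = ereal c * weighted_h a \<nu> k z"
    using ext f[OF p(1)] unfolding extremal_psh_def by blast
  have Sp: "Suc p \<in> {1..k}" using p(1) by auto
  have ap: "norm (a (Suc p)) < 1" using a Sp by auto
  have "weighted_h a \<nu> k ?w = -\<infinity>"
    by (rule log_pole_value[OF weighted_h_in_neg_psh_cone ap weighted_h_log_pole[OF Sp] p(3)])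
  then have "f p ?w = ereal c * -\<infinity>" using c(2) ap by simp
  then have val: "f p ?w = 0 \<or> f p ?w = -\<infinity>"
    using c(1) by (cases "c = 0") (auto simp: zero_ereal_def[symmetric])
  let ?F = "blaschke_prod a {1..p} (a (Suc p))"
  have "moebius (a i) (a (Suc p)) \<noteq> 0" if "i \<in> {1..p}" for i
  proof -
    have "i \<in> {1..k}" "i \<noteq> Suc p" using that p(1) by auto
    then have "a (Suc p) \<noteq> a i" using inj Sp by (auto dest: inj_onD)
    then show ?thesis using moebius_eq_0_iff[OF a[OF \<open>i \<in> {1..k}\<close>], of "a (Suc p)"] ap by simp
  qed
  then have F0: "?F \<noteq> 0" by (simp add: blaschke_prod_def)
  have F1: "norm ?F < 1"
    by (rule norm_blaschke_prod_less_1) (use a p ap in auto)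
  have "h a p ?w = ereal (ln (norm ?F))"
    using p(1) F0 by (simp add: h_blaschke elog_def)
  then have "f p ?w = ereal ((\<nu> p - \<nu> (Suc p)) * ln (norm ?F))" by (simp add: f_def)
  moreover have "(\<nu> p - \<nu> (Suc p)) * ln (norm ?F) \<noteq> 0" using p(2) F0 F1 by simp
  ultimately show False using val by (auto simp: zero_ereal_def)
qed

end

end

end

section \<open>Extremality for equal weights\<close>

text \<open>The bound is known in a cone around the vertical axis through the pole.  A point \<open>z\<close> outside that cone
  lies in a disc \<open>{z $ 1} \<times> cball 0 (2 * q)\<close> whose boundary is in the cone and whose radius is at most a multiple of the
  distance of \<open>z\<close> from the pole.\<close>
lemma log_pole_of_cone_bound:
  assumes u: "u \<in> neg_psh_cone bidisc" and b: "norm b < 1" and \<beta>: "0 \<le> \<beta>"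
    and bound: "\<And>z. z \<in> bidisc \<Longrightarrow> norm (moebius b (z $ 1)) < norm (z $ 2) \<Longrightarrow> u z \<le> ereal (\<beta> * ln (norm (z $ 2)))"
  shows "log_pole u (vector [b, 0]) \<beta>"
proof -
  let ?w = "vector [b, 0] :: complex^2"
  define A where "A = 2 / (1 - norm b)"
  have A: "1 \<le> A" "0 < A"
  proof -
    have "- 1 \<le> norm b" using norm_ge_zero[of b] by linarith
    then show "1 \<le> A" "0 < A" using b by (simp_all add: A_def pos_le_divide_eq)
  qed
  have "\<forall>\<^sub>F z in at ?w. z \<in> bidisc - {?w}"
    using b by (intro eventually_at_in_open open_bidisc) auto
  moreover have "\<forall>\<^sub>F z in at ?w. norm (z - ?w) < 1 / A"
    unfolding eventually_at using A by (intro exI[of _ "1 / A"]) (simp add: dist_norm)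
  ultimately have "\<forall>\<^sub>F z in at ?w. u z \<le> ereal (\<beta> * ln (norm (z - ?w)) + \<beta> * ln A)"
  proof eventually_elim
    case (elim z)
    have z: "z \<in> bidisc" "norm (z $ 1) < 1" "z \<noteq> ?w" using elim(1) by auto
    have pos: "0 < norm (z - ?w)" using z by simp
    have comp: "norm (z $ 1 - b) \<le> norm (z - ?w)" "norm (z $ 2) \<le> norm (z - ?w)"
      using Finite_Cartesian_Product.norm_nth_le[of "z - ?w" 1] Finite_Cartesian_Product.norm_nth_le[of "z - ?w" 2] by auto
    have "\<exists>r. 0 < r \<and> r \<le> A * norm (z - ?w) \<and> u z \<le> ereal (\<beta> * ln r)"
    proof (cases "norm (moebius b (z $ 1)) < norm (z $ 2)")
      case True
      have "1 * norm (z $ 2) \<le> A * norm (z - ?w)" using comp(2) A by (intro mult_mono) auto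
      moreover have "0 < norm (z $ 2)" using True norm_ge_zero order.strict_trans1 by blast
      ultimately show ?thesis using bound[OF z(1) True] by (intro exI[of _ "norm (z $ 2)"]) auto
    next
      case False
      define q where "q = norm (moebius b (z $ 1))"
      have "q \<noteq> 0"
      proof
        assume "q = 0"
        then have "z $ 1 = b" "z $ 2 = 0" using False moebius_eq_0_iff[OF b, of "z $ 1"] z(2) by (auto simp: q_def)
        then show False using z(3) by (simp add: vec_eq_iff forall_2)
      qed
      then have q: "0 < q" by (simp add: q_def)
      have "2 * q \<le> 2 * (norm (z $ 1 - b) / (1 - norm b))"
        using norm_moebius_le[OF b, of "z $ 1"] z(2) by (simp add: q_def)
      also have "\<dots> = A * norm (z $ 1 - b)" by (simp add: A_def)
      also have "\<dots> \<le> A * norm (z - ?w)" using comp(1) A by simp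
      finally have qA: "2 * q \<le> A * norm (z - ?w)" .
      also have "\<dots> < 1" using elim(2) A by (simp add: field_simps)
      finally have q1: "2 * q < 1" .
      have "u (vector [z $ 1, z $ 2]) \<le> ereal (\<beta> * ln (2 * q))"
      proof (rule psh_curve_max_principle[OF neg_psh_coneD(1)[OF u] open_bidisc, where K="cball 0 (2 * q)" and U="ball 0 (2 * q)"
            and \<phi>="\<lambda>s. vector [z $ 1, s]" and H="\<lambda>_. \<beta> * ln (2 * q)"])
        show "u (vector [z $ 1, s]) \<le> ereal (\<beta> * ln (2 * q))" if "s \<in> cball 0 (2 * q) - ball 0 (2 * q)" for s
        proof -
          have n: "norm s = 2 * q" using that by auto
          then show ?thesis
            using bound[of "vector [z $ 1, s]"] z(2) q1 q by (simp add: q_def)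
        qed
        have "norm (z $ 2) \<le> q" using False by (simp add: q_def)
        then show "z $ 2 \<in> cball 0 (2 * q)" using q by simp
      qed (use z(2) q1 in \<open>auto intro!: continuous_on_vector_2 holomorphic_on_vector_2 continuous_intros
            holomorphic_intros harmonic_on_const\<close>)
      then show ?thesis using q qA by (intro exI[of _ "2 * q"]) (simp add: vector_2_eta)
    qed
    then obtain r where r: "0 < r" "r \<le> A * norm (z - ?w)" "u z \<le> ereal (\<beta> * ln r)" by blast
    have "\<beta> * ln r \<le> \<beta> * ln (A * norm (z - ?w))"
      using r A pos \<beta> by (intro mult_left_mono) auto
    also have "\<dots> = \<beta> * ln (norm (z - ?w)) + \<beta> * ln A"
      using A pos by (simp add: ln_mult algebra_simps)
    finally show ?case using r(3) by (meson ereal_less_eq(3) order_trans)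
  qed
  then show ?thesis unfolding log_pole_def by blast
qed

text \<open>In the cone over the pole, \<open>h a k z = elog (norm (z $ 2))\<close>.  The discs \<open>s \<mapsto> (\<mu> (c * s), s)\<close>, with
  \<open>\<mu>\<close> the Moebius map taking 0 to \<open>a i\<close> and \<open>norm c < 1\<close>, fill the cone, and by \<open>log_split\<close> each of them carries a constant
  \<open>Bf c\<close>.  The same lemma for \<open>s \<mapsto> (\<mu> (c * s\<^sup>2), s)\<close> shows that \<open>Bf (c * s)\<close> does not depend on \<open>s\<close>, and by
  continuity at 0 it equals \<open>Bf 0\<close>.\<close>
lemma log_split_near_pole:
  assumes a: "\<And>i. i \<in> {1..k} \<Longrightarrow> norm (a i) < 1" and i: "i \<in> {1..k}"
    and u1: "u1 \<in> neg_psh_cone bidisc" and u2: "u2 \<in> neg_psh_cone bidisc"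
    and sum: "\<And>z. z \<in> bidisc \<Longrightarrow> h a k z = u1 z + u2 z"
  obtains B where "0 \<le> B" "B \<le> 1"
    "\<And>z. z \<in> bidisc \<Longrightarrow> norm (moebius (a i) (z $ 1)) < norm (z $ 2) \<Longrightarrow>
       u1 z = ereal (B * ln (norm (z $ 2))) \<and> u2 z = ereal ((1 - B) * ln (norm (z $ 2)))"
proof -
  let ?D = "ball 0 1 - {0::complex}"
  let ?\<mu> = "moebius (- a i)"
  have ai: "norm (a i) < 1" "norm (- a i) < 1" using a i by auto
  have inv: "moebius (a i) (?\<mu> x) = x" if "norm x < 1" for x
    by (rule Moebius_function_compose) (use ai that in auto)
  have inv': "?\<mu> (moebius (a i) x) = x" if "norm x < 1" for x
    by (rule Moebius_function_compose) (use ai that in auto)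
  have \<mu>1: "norm (?\<mu> x) < 1" if "norm x < 1" for x
    using Moebius_function_norm_lt_1[OF ai(2) that] .
  have \<mu>hol: "?\<mu> holomorphic_on ball 0 1" by (rule Moebius_function_holomorphic[OF ai(2)])
  have hval: "u1 z + u2 z = ereal (ln (norm (z $ 2)))"
    if "z \<in> bidisc" "norm (moebius (a i) (z $ 1)) \<le> norm (z $ 2)" "z $ 2 \<noteq> 0" for z
  proof -
    have "norm (blaschke_prod a {1..k} (z $ 1)) \<le> norm (moebius (a i) (z $ 1))"
      by (rule norm_blaschke_prod_le) (use a i that in auto)
    with that(2) have "elog (norm (blaschke_prod a {1..k} (z $ 1))) \<le> elog (norm (z $ 2))"
      by (intro elog_mono) auto
    moreover have "elog (norm (blaschke_prod a {1..k} (z $ 1))) = (\<Sum>i=1..k. T (a i) (z $ 1))"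
      by (rule elog_blaschke_prod) (use a in auto)
    ultimately have "h a k z = elog (norm (z $ 2))" by (simp add: h_def max_absorb2)
    then show ?thesis using sum[OF that(1)] that(3) by (simp add: elog_def)
  qed
  have curve: "\<exists>B. 0 \<le> B \<and> B \<le> 1 \<and> (\<forall>s\<in>?D. u1 (vector [?\<mu> (c * s ^ Suc n), s]) = ereal (B * ln (norm s)) \<and>
      u2 (vector [?\<mu> (c * s ^ Suc n), s]) = ereal ((1 - B) * ln (norm s)))" if c: "norm c < 1" for c n
  proof -
    let ?\<phi> = "\<lambda>s. vector [?\<mu> (c * s ^ Suc n), s] :: complex^2"
    have cn: "norm (c * s ^ Suc n) \<le> norm s" if "norm s < 1" for s
    proof -
      have "norm c * norm s ^ n \<le> 1 * 1"
        using c that by (intro mult_mono power_le_one) auto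
      then have "norm c * norm s ^ n * norm s \<le> 1 * norm s" by (intro mult_right_mono) auto
      then show ?thesis by (simp add: norm_mult norm_power mult_ac)
    qed
    have in_bd: "?\<phi> s \<in> bidisc" if "norm s < 1" for s
      using \<mu>1[of "c * s ^ Suc n"] cn[OF that] that by simp
    obtain B where B: "0 \<le> B" "B \<le> 1"
      "\<And>s. s \<in> ?D \<Longrightarrow> u1 (?\<phi> s) = ereal (B * ln (norm s))"
      "\<And>s. s \<in> ?D \<Longrightarrow> u2 (?\<phi> s) = ereal ((1 - B) * ln (norm s))"
    proof (rule log_split[OF u1 u2 open_bidisc, where \<phi>="?\<phi>"])
      have "(\<lambda>s. ?\<mu> (c * s ^ Suc n)) holomorphic_on ?D"
      proof (rule holomorphic_on_compose_gen[OF _ \<mu>hol, unfolded o_def])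
        show "(\<lambda>s. c * s ^ Suc n) ` ?D \<subseteq> ball 0 1"
        proof (intro image_subsetI)
          fix s assume "s \<in> ?D"
          then show "c * s ^ Suc n \<in> ball 0 1" using cn[of s] by (simp only: mem_ball_0) auto
        qed
      qed (intro holomorphic_intros)
      then show "(\<lambda>s. ?\<phi> s $ l) holomorphic_on ?D" for l
        by (intro holomorphic_on_vector_2 holomorphic_intros)
      show "?\<phi> ` ?D \<subseteq> bidisc"
      proof (intro image_subsetI)
        fix s assume "s \<in> ?D"
        then show "?\<phi> s \<in> bidisc" by (intro in_bd) simp
      qed
      show "u1 (?\<phi> s) + u2 (?\<phi> s) = ereal (ln (norm s))" if "s \<in> ?D" for s
      proof -
        have s: "norm s < 1" "s \<noteq> 0" using that by auto
        have "norm (c * s ^ Suc n) < 1" using cn[OF s(1)] s(1) by linarith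
        then show ?thesis using hval[OF in_bd[OF s(1)]] inv[of "c * s ^ Suc n"] cn[OF s(1)] s(2)
          by (simp del: power_Suc)
      qed
    qed blast
    then show ?thesis by blast
  qed
  have "\<forall>c. \<exists>B. norm c < 1 \<longrightarrow> 0 \<le> B \<and> B \<le> 1 \<and> (\<forall>s\<in>?D. u1 (vector [?\<mu> (c * s), s]) = ereal (B * ln (norm s)) \<and>
      u2 (vector [?\<mu> (c * s), s]) = ereal ((1 - B) * ln (norm s)))"
    using curve[of _ 0] by simp
  then obtain Bf where Bf: "\<And>c. norm c < 1 \<Longrightarrow> 0 \<le> Bf c \<and> Bf c \<le> 1"
    "\<And>c s. norm c < 1 \<Longrightarrow> s \<in> ?D \<Longrightarrow> u1 (vector [?\<mu> (c * s), s]) = ereal (Bf c * ln (norm s)) \<and>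
      u2 (vector [?\<mu> (c * s), s]) = ereal ((1 - Bf c) * ln (norm s))"
    by metis
  have cont: "continuous_on (ball 0 1) Bf"
  proof -
    let ?\<psi> = "\<lambda>c. vector [?\<mu> (c * (1/2)), 1/2] :: complex^2"
    have \<psi>c: "continuous_on (ball 0 1) ?\<psi>"
    proof (intro continuous_on_vector_2 continuous_on_const)
      show "continuous_on (ball 0 1) (\<lambda>c. ?\<mu> (c * (1/2)))"
        by (rule continuous_on_compose2[OF holomorphic_on_imp_continuous_on[OF \<mu>hol]])
           (auto intro!: continuous_intros simp: norm_mult norm_divide)
    qed
    have \<psi>b: "?\<psi> ` ball 0 1 \<subseteq> bidisc"
    proof (intro image_subsetI)
      fix c :: complex assume "c \<in> ball 0 1"
      then have "norm (c * (1/2)) < 1" by (simp add: norm_mult norm_divide)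
      from \<mu>1[OF this] show "?\<psi> c \<in> bidisc" by (simp add: norm_divide)
    qed
    have half: "1/2 \<in> ?D" by simp
    have val: "u1 (?\<psi> c) = ereal (Bf c * ln (1/2))" "u2 (?\<psi> c) = ereal ((1 - Bf c) * ln (1/2))" if "c \<in> ball 0 1" for c
      using Bf(2)[of c "1/2"] that half by (auto simp: norm_divide)
    obtain G where G: "continuous_on (ball 0 1) G" "\<And>c. c \<in> ball 0 1 \<Longrightarrow> u1 (?\<psi> c) = ereal (G c)"
    proof (rule usc_sum_continuous[of "ball 0 1" "\<lambda>c. u1 (?\<psi> c)" "\<lambda>c. u2 (?\<psi> c)" "\<lambda>_. ln (1/2)"])
      show "usc_on (ball 0 1) (\<lambda>c. u1 (?\<psi> c))" by (rule usc_on_compose[OF neg_psh_coneD(2)[OF u1] \<psi>c \<psi>b])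
      show "usc_on (ball 0 1) (\<lambda>c. u2 (?\<psi> c))" by (rule usc_on_compose[OF neg_psh_coneD(2)[OF u2] \<psi>c \<psi>b])
      show "u1 (?\<psi> c) < \<infinity>" "u2 (?\<psi> c) < \<infinity>" "u1 (?\<psi> c) + u2 (?\<psi> c) = ereal (ln (1/2))" if "c \<in> ball 0 1" for c
        unfolding val[OF that] by (auto simp: algebra_simps)
    qed (auto intro: continuous_on_const)
    have "continuous_on (ball 0 1) (\<lambda>c. G c / ln (1/2))" using G(1) by (intro continuous_intros) auto
    then show ?thesis
    proof (rule continuous_on_eq)
      fix c :: complex assume c: "c \<in> ball 0 1"
      have "ln (1/2) \<noteq> (0::real)" by simp
      then show "G c / ln (1/2) = Bf c" using G(2)[OF c] val(1)[OF c] by (simp add: field_simps)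
    qed
  qed
  have scale: "Bf (c * s) = Bf 0" if c: "norm c < 1" and s: "s \<in> ?D" for c s
  proof -
    obtain B where B: "\<And>\<xi>. \<xi> \<in> ?D \<Longrightarrow> u1 (vector [?\<mu> (c * \<xi> ^ 2), \<xi>]) = ereal (B * ln (norm \<xi>))"
      using curve[OF c, of 1] by (auto simp: numeral_2_eq_2)
    have eq: "Bf (c * \<xi>) = B" if \<xi>: "\<xi> \<in> ?D" for \<xi>
    proof -
      have "norm c * norm \<xi> < 1 * norm \<xi>" using c \<xi> by (intro mult_strict_right_mono) auto
      moreover have "norm \<xi> < 1" using \<xi> by simp
      ultimately have "norm (c * \<xi>) < 1" unfolding norm_mult by linarith
      from Bf(2)[OF this \<xi>] B[OF \<xi>] have "Bf (c * \<xi>) * ln (norm \<xi>) = B * ln (norm \<xi>)"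
        by (simp add: power2_eq_square mult.assoc)
      then show ?thesis using \<xi> by auto
    qed
    have "isCont Bf 0" using cont by (simp add: continuous_on_eq_continuous_at)
    then have "((\<lambda>\<xi>. Bf (c * \<xi>)) \<longlongrightarrow> Bf 0) (at 0)"
      by (intro isCont_tendsto_compose[where g=Bf]) (auto intro!: tendsto_eq_intros)
    moreover have "\<forall>\<^sub>F \<xi> in at 0. Bf (c * \<xi>) = B"
      using eventually_at_in_open[of "ball 0 1" "0::complex"] by (auto elim!: eventually_mono simp: eq)
    ultimately have "((\<lambda>_. B) \<longlongrightarrow> Bf 0) (at (0::complex))" by (rule Lim_transform_eventually)
    then have "B = Bf 0" by (simp add: tendsto_const_iff)
    then show ?thesis using eq[OF s] by simp
  qed
  have const: "Bf c = Bf 0" if c: "norm c < 1" for c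
  proof (cases "c = 0")
    case False
    \<comment> \<open>Every \<open>c\<close> in the disc is a product of two elements of the disc.\<close>
    have sq: "csqrt c * csqrt c = c" by (metis power2_csqrt power2_eq_square)
    then have "norm (csqrt c) * norm (csqrt c) < 1" using c by (metis norm_mult)
    then have "norm (csqrt c) < 1" using abs_square_less_1[of "norm (csqrt c)"] by (simp add: power2_eq_square)
    then show ?thesis using scale[of "csqrt c" "csqrt c"] False sq by simp
  qed simp
  show ?thesis
  proof (rule that[of "Bf 0"])
    show "0 \<le> Bf 0" "Bf 0 \<le> 1" using Bf(1)[of 0] by auto
    fix z assume z: "z \<in> bidisc" "norm (moebius (a i) (z $ 1)) < norm (z $ 2)"
    have z2: "z $ 2 \<in> ?D" using z by auto
    define c where "c = moebius (a i) (z $ 1) / z $ 2"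
    have c: "norm c < 1" using z z2 by (simp add: c_def norm_divide)
    have "vector [?\<mu> (c * z $ 2), z $ 2] = z"
      using inv'[of "z $ 1"] z(1) z2 vector_2_eta[of z] by (simp add: c_def)
    then show "u1 z = ereal (Bf 0 * ln (norm (z $ 2))) \<and> u2 z = ereal ((1 - Bf 0) * ln (norm (z $ 2)))"
      using Bf(2)[OF c z2] const[OF c] by simp
  qed
qed

text \<open>Upper semicontinuity: a negative value at a point forces negative values nearby.\<close>
lemma neg_psh_zero_on_axis:
  assumes u: "u \<in> neg_psh_cone bidisc" and zero: "\<And>y. y \<in> bidisc \<Longrightarrow> y $ 2 \<noteq> 0 \<Longrightarrow> u y = 0"
    and z: "z \<in> bidisc"
  shows "u z = 0"
proof (rule ccontr)
  assume nz: "u z \<noteq> 0"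
  then have z2: "z $ 2 = 0" and "u z < 0"
    using zero[OF z] neg_psh_coneD(3)[OF u z] by auto
  then have "\<forall>\<^sub>F y in at z within bidisc. u y < 0"
    using neg_psh_coneD(2)[OF u] z unfolding usc_on_def by blast
  then obtain d where d: "d > 0" "\<And>y. y \<in> bidisc \<Longrightarrow> y \<noteq> z \<Longrightarrow> dist y z < d \<Longrightarrow> u y < 0"
    unfolding eventually_at by auto
  define e where "e = min (d / 2) (1 / 2)"
  have e: "0 < e" "e < d" "e < 1" using d(1) by (auto simp: e_def)
  define y :: "complex^2" where "y = vector [z $ 1, of_real e]"
  have y: "y \<in> bidisc" "y $ 2 \<noteq> 0" using z e by (auto simp: y_def)
  have "norm (y - z) \<le> e"
    using norm_vec2_le[of "y - z"] z2 e by (simp add: y_def)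
  then have "u y < 0" using y z2 e by (intro d(2)) (auto simp: dist_norm)
  then show False using zero[OF y] by simp
qed

text \<open>Near each pole a decomposition \<open>h = u1 + u2\<close> splits the logarithm in a ratio \<open>B : 1 - B\<close>.  The cones over
  different poles overlap where \<open>norm (z $ 2)\<close> is close to 1, so the ratio is the same for all poles.  Now \<open>u1\<close> and \<open>u2\<close>
  have poles of weights \<open>B\<close> and \<open>1 - B\<close>, and the upper bound for the Green function gives \<open>u1 \<le> B * h\<close> and
  \<open>u2 \<le> (1 - B) * h\<close>.  As the sum is \<open>h\<close>, both are equalities.\<close>
theorem extremal_h:
  assumes k: "1 \<le> k" and a: "\<And>i. i \<in> {1..k} \<Longrightarrow> norm (a i) < 1" and inj: "inj_on a {1..k}"
  shows "extremal_psh bidisc (h a k)"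
  unfolding extremal_psh_def
proof (intro conjI ballI impI)
  show "h a k \<in> neg_psh_cone bidisc" by (rule h_in_neg_psh_cone[where a=a, OF a]) auto
  fix u1 u2 :: "complex^2 \<Rightarrow> ereal"
  assume u: "u1 \<in> neg_psh_cone bidisc" "u2 \<in> neg_psh_cone bidisc" and "\<forall>z\<in>bidisc. h a k z = u1 z + u2 z"
  then have sum: "\<And>z. z \<in> bidisc \<Longrightarrow> h a k z = u1 z + u2 z" by blast
  let ?near = "\<lambda>B i. \<forall>z\<in>bidisc. norm (moebius (a i) (z $ 1)) < norm (z $ 2) \<longrightarrow>
       u1 z = ereal (B * ln (norm (z $ 2))) \<and> u2 z = ereal ((1 - B) * ln (norm (z $ 2)))"
  have one: "1 \<in> {1..k}" using k by simp
  obtain B where B: "0 \<le> B" "B \<le> 1" "?near B 1"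
    using log_split_near_pole[where a=a, OF a one u sum] by metis
  have near: "?near B i" if i: "i \<in> {1..k}" for i
  proof -
    obtain B' where B': "?near B' i"
      using log_split_near_pole[where a=a, OF a i u sum] by metis
    obtain r where r: "max (norm (a i)) (norm (a 1)) < r" "r < 1"
      using a[OF i] a[OF one] dense[of "max (norm (a i)) (norm (a 1))" 1] by auto
    have r0: "0 < r" using r(1) norm_ge_zero[of "a i"] by linarith
    define y :: "complex^2" where "y = vector [0, of_real r]"
    have y: "y \<in> bidisc" "y $ 1 = 0" "norm (y $ 2) = r" using r r0 by (auto simp: y_def)
    have "norm (moebius (a i) (y $ 1)) < norm (y $ 2)" "norm (moebius (a 1) (y $ 1)) < norm (y $ 2)"
      unfolding y(2,3) Moebius_function_of_zero using r(1) by auto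
    then have "u1 y = ereal (B' * ln r)" "u1 y = ereal (B * ln r)" using B(3) B' y(1,3) by auto
    then have "B * ln r = B' * ln r" by simp
    moreover have "ln r \<noteq> 0" using r(2) r0 by simp
    ultimately have "B = B'" by simp
    then show ?thesis using B' by simp
  qed
  have poles: "log_pole u1 (vector [a i, 0]) B" "log_pole u2 (vector [a i, 0]) (1 - B)" if i: "i \<in> {1..k}" for i
    using near[OF i] B(1,2)
    by (auto intro!: log_pole_of_cone_bound[OF u(1) a[OF i]] log_pole_of_cone_bound[OF u(2) a[OF i]])
  have wh: "weighted_h a (\<lambda>_. \<beta>) k z = ereal \<beta> * h a k z" for \<beta> z
    by (simp add: weighted_h_def zero_ereal_def[symmetric])
  have upper: "u1 z \<le> ereal B * h a k z" "u2 z \<le> ereal (1 - B) * h a k z" if z: "z \<in> bidisc" for z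
    using upper_bound_weighted_h[where a=a and \<nu>="\<lambda>_. B", OF a k _ _ inj u(1) poles(1) z]
      upper_bound_weighted_h[where a=a and \<nu>="\<lambda>_. 1 - B", OF a k _ _ inj u(2) poles(2) z] B(1,2)
    by (simp_all add: wh)
  have finite_case: "u1 z = ereal B * h a k z \<and> u2 z = ereal (1 - B) * h a k z"
    if z: "z \<in> bidisc" and hz: "h a k z \<noteq> -\<infinity>" for z
  proof -
    obtain r where r: "h a k z = ereal r"
      using hz neg_psh_coneD(4)[OF \<open>h a k \<in> neg_psh_cone bidisc\<close> z] by (cases "h a k z") auto
    have s: "u1 z + u2 z = ereal r" using sum[OF z] r by simp
    then obtain x y where xy: "u1 z = ereal x" "u2 z = ereal y" "x + y = r"
      using neg_psh_coneD(4)[OF u(1) z] neg_psh_coneD(4)[OF u(2) z] by (cases "u1 z"; cases "u2 z") auto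
    then show ?thesis using upper[OF z] r by (auto simp: algebra_simps)
  qed
  have h_fin: "h a k z \<noteq> -\<infinity>" if "z $ 2 \<noteq> 0" for z
    using that by (auto simp: h_def elog_def max_def)
  \<comment> \<open>At the poles \<open>h a k z = -\<infinity>\<close>; the product is \<open>-\<infinity>\<close> for \<open>\<beta> > 0\<close> but 0 for \<open>\<beta> = 0\<close>.\<close>
  have all: "v z = ereal \<beta> * h a k z"
    if v: "v \<in> neg_psh_cone bidisc" and le: "\<And>z. z \<in> bidisc \<Longrightarrow> v z \<le> ereal \<beta> * h a k z" and \<beta>: "0 \<le> \<beta>"
      and fin: "\<And>z. z \<in> bidisc \<Longrightarrow> h a k z \<noteq> -\<infinity> \<Longrightarrow> v z = ereal \<beta> * h a k z" and z: "z \<in> bidisc"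
    for v \<beta> z
  proof (cases "h a k z = -\<infinity>")
    case True
    show ?thesis
    proof (cases "\<beta> = 0")
      case True
      then have "v z = 0"
        using fin h_fin by (intro neg_psh_zero_on_axis[OF v _ z]) (auto simp: zero_ereal_def[symmetric])
      then show ?thesis using True by (simp add: zero_ereal_def[symmetric])
    next
      case False
      then show ?thesis using le[OF z] \<open>h a k z = -\<infinity>\<close> \<beta> by simp
    qed
  qed (use fin z in blast)
  have "u1 z = ereal B * h a k z" if z: "z \<in> bidisc" for z
    by (rule all[OF u(1) upper(1) B(1) conjunct1[OF finite_case] z])
  moreover have "u2 z = ereal (1 - B) * h a k z" if z: "z \<in> bidisc" for z
  proof (rule all[OF u(2) upper(2) _ conjunct2[OF finite_case] z])
    show "0 \<le> 1 - B" using B(2) by simp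
  qed
  ultimately show "\<exists>c1 c2. 0 \<le> c1 \<and> 0 \<le> c2 \<and> (\<forall>z\<in>bidisc. u1 z = ereal c1 * h a k z) \<and> (\<forall>z\<in>bidisc. u2 z = ereal c2 * h a k z)"
    using B(1,2) by (intro exI[of _ B] exI[of _ "1 - B"]) simp
qed

theorem mainTheorem6:
  fixes k :: nat and a :: "nat \<Rightarrow> complex" and \<nu> :: "nat \<Rightarrow> real" and w :: "nat \<Rightarrow> complex^2"
  assumes "1 \<le> k"
    and "\<forall>i\<in>{1..k}. norm (a i) < 1"
    and "inj_on a {1..k}"
    and "\<forall>i\<in>{1..k}. w i = vector [a i, 0]"
    and "\<forall>j\<in>{1..k}. 0 \<le> \<nu> j"
    and "\<nu> 1 = 1"
    and "\<forall>j\<in>{1..<k}. \<nu> (Suc j) \<le> \<nu> j"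
  shows
    "(\<forall>j\<in>{1..k}. \<forall>z\<in>bidisc. green_function bidisc j w (\<lambda>_. 1) z = h a j z)
     \<and>
     ((\<exists>i\<in>{1..k}. \<exists>j\<in>{1..k}. \<nu> i \<noteq> \<nu> j) \<longrightarrow>
        (\<forall>z\<in>bidisc. green_function bidisc k w \<nu> z =
           ereal (\<nu> k) * h a k z + (\<Sum>j=1..<k. ereal (\<nu> j - \<nu> (Suc j)) * h a j z)))
     \<and>
     ((\<exists>i\<in>{1..k}. \<exists>j\<in>{1..k}. 0 < \<nu> i \<and> 0 < \<nu> j \<and> \<nu> i \<noteq> \<nu> j) \<longrightarrow>
        green_function bidisc k w \<nu> \<in> neg_psh_cone bidisc \<and>
        \<not> extremal_psh bidisc (green_function bidisc k w \<nu>))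
     \<and>
     ((\<forall>i\<in>{1..k}. \<forall>j\<in>{1..k}. \<nu> i = \<nu> j) \<longrightarrow>
        (\<forall>z\<in>bidisc. green_function bidisc k w \<nu> z =
           max (\<Sum>i=1..k. T (a i) (z $ 1)) (elog (norm (z $ 2)))) \<and>
        extremal_psh bidisc (green_function bidisc k w \<nu>))"
proof -
  note k = assms(1)
  have a: "\<And>i. i \<in> {1..k} \<Longrightarrow> norm (a i) < 1" and w: "\<And>i. i \<in> {1..k} \<Longrightarrow> w i = vector [a i, 0]"
    and \<nu>: "\<And>j. j \<in> {1..k} \<Longrightarrow> 0 \<le> \<nu> j" and mono: "\<And>j. j \<in> {1..<k} \<Longrightarrow> \<nu> (Suc j) \<le> \<nu> j"
    using assms by auto
  note inj = assms(3)
  have green: "green_function bidisc k w \<nu> z = weighted_h a \<nu> k z" if "z \<in> bidisc" for z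
    by (rule green_function_bidisc[where a=a and \<nu>=\<nu> and w=w, OF a k \<nu> mono inj w that])
  have unit: "green_function bidisc j w (\<lambda>_. 1) z = h a j z" if j: "j \<in> {1..k}" and z: "z \<in> bidisc" for j z
  proof -
    have "green_function bidisc j w (\<lambda>_. 1) z = weighted_h a (\<lambda>_. 1) j z"
      by (rule green_function_bidisc[where a=a and w=w, OF _ _ _ _ _ _ z]) (use j a w inj in \<open>auto intro: inj_on_subset\<close>)
    also have "\<dots> = h a j z"
      by (simp add: weighted_h_def zero_ereal_def[symmetric] one_ereal_def[symmetric])
    finally show ?thesis .
  qed
  have nonext: "green_function bidisc k w \<nu> \<in> neg_psh_cone bidisc \<and> \<not> extremal_psh bidisc (green_function bidisc k w \<nu>)"
    if differ: "\<exists>i\<in>{1..k}. \<exists>j\<in>{1..k}. 0 < \<nu> i \<and> 0 < \<nu> j \<and> \<nu> i \<noteq> \<nu> j"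
  proof
    show "green_function bidisc k w \<nu> \<in> neg_psh_cone bidisc"
      by (rule neg_psh_cone_cong[OF weighted_h_in_neg_psh_cone[where a=a and \<nu>=\<nu>, OF a k \<nu> mono]]) (simp_all add: green)
    have "\<exists>p\<in>{1..<k}. \<nu> (Suc p) < \<nu> p \<and> 0 < \<nu> (Suc p)"
    proof (rule ccontr)
      assume none: "\<not> ?thesis"
      have two: "\<nu> n = \<nu> 1 \<or> \<nu> n = 0" if "1 \<le> n" "n \<le> k" for n
        using that
      proof (induction n rule: dec_induct)
        case (step n)
        then have "n \<in> {1..<k}" "Suc n \<in> {1..k}" by auto
        then have "\<nu> (Suc n) = \<nu> n \<or> \<nu> (Suc n) = 0"
        proof -
          have "\<not> (\<nu> (Suc n) < \<nu> n \<and> 0 < \<nu> (Suc n))" using none \<open>n \<in> {1..<k}\<close> by blast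
          then show ?thesis using mono[OF \<open>n \<in> {1..<k}\<close>] \<nu>[OF \<open>Suc n \<in> {1..k}\<close>] by linarith
        qed
        moreover have "\<nu> n = \<nu> 1 \<or> \<nu> n = 0" using step by simp
        ultimately show ?case by auto
      qed simp
      obtain i j where "i \<in> {1..k}" "j \<in> {1..k}" "0 < \<nu> i" "0 < \<nu> j" "\<nu> i \<noteq> \<nu> j"
        using differ by blast
      then show False using two[of i] two[of j] by auto
    qed
    then obtain p where p: "p \<in> {1..<k}" "\<nu> (Suc p) < \<nu> p" "0 < \<nu> (Suc p)" by blast
    show "\<not> extremal_psh bidisc (green_function bidisc k w \<nu>)"
    proof
      assume "extremal_psh bidisc (green_function bidisc k w \<nu>)"
      from extremal_psh_cong[OF this green] show False
        using weighted_h_not_extremal[where a=a and \<nu>=\<nu>, OF a k \<nu> mono inj p] by blast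
    qed
  qed
  have equal: "green_function bidisc k w \<nu> z = h a k z"
    if eq: "\<forall>i\<in>{1..k}. \<forall>j\<in>{1..k}. \<nu> i = \<nu> j" and z: "z \<in> bidisc" for z
  proof -
    have one: "\<nu> j = 1" if "j \<in> {1..k}" for j
    proof -
      have "1 \<in> {1..k}" using k by simp
      then have "\<nu> j = \<nu> 1" using eq that by blast
      then show ?thesis using assms(6) by simp
    qed
    have "(\<Sum>j=1..<k. ereal (\<nu> j - \<nu> (Suc j)) * h a j z) = 0"
      using one by (intro sum.neutral) (auto simp: zero_ereal_def[symmetric])
    then show ?thesis using one[of k] k by (simp add: green[OF z] weighted_h_def one_ereal_def[symmetric])
  qed
  have ext: "extremal_psh bidisc (green_function bidisc k w \<nu>)" if "\<forall>i\<in>{1..k}. \<forall>j\<in>{1..k}. \<nu> i = \<nu> j"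
    by (rule extremal_psh_cong[OF extremal_h[where a=a, OF k a inj] equal[OF that, symmetric]])
  show ?thesis
    using unit green[unfolded weighted_h_def] nonext equal[unfolded h_def] ext by blast
qed

end
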